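(* Let $\mu,\nu$ be probability measures on $\mathbb{R}$ with $\mu\preceq\nu$ in convex order, such that $J:=\mathrm{conv}(\mathrm{supp}(\nu))$ is compact. Let $c:\mathbb{R}\times\mathbb{R}\to\mathbb{R}$ be a lower-semicontinuous cost satisfying $c(x,y)\le a(x)+b(y)$ for some $a\in L^1(\mu)$, $b\in L^1(\nu)$, with $\mathbf{P}(c):=\inf_{\mathbb{P}\in\mathsf{M}(\mu,\nu)}\mathbb{E}^{\mathbb{P}}[c(X,Y)]$ finite. Assume $c$ is Lipschitz on $J\times J$ and there is a Lipschitz function $u:J\to\mathbb{R}$ such that $y\mapsto c(x,y)+u(y)$ is convex on $J$ for $\mu$-a.e. $x$. Then there exists a dual maximizer $(f,g,h)$ such that $f$ and $g$ are Lipschitz on $J$ and $h$ is bounded on $J$. In particular, $\nu(g)-\mu(f)=\mathbb{E}^{\mathbb{P}^*}[c(X,Y)]$ for every minimizer $\mathbb{P}^*$, where $\mu(f)=\int f\,d\mu$ and $\nu(g)=\int g\,d\nu$.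
   Context: $(X,Y)$ denotes the canonical process on $\Omega=\mathbb{R}\times\mathbb{R}$. $\mu\preceq\nu$ in convex order means $\int\xi\,d\mu\le\int\xi\,d\nu$ for every convex $\xi$. $\mathsf{M}(\mu,\nu)$ is the set of probability measures $\mathbb{P}$ on $\Omega$ with $X\sim_{\mathbb{P}}\mu$, $Y\sim_{\mathbb{P}}\nu$ and $\mathbb{E}^{\mathbb{P}}[Y|X]=X$ $\mathbb{P}$-a.s. A minimizer is a $\mathbb{P}^*\in\mathsf{M}(\mu,\nu)$ with $\mathbb{E}^{\mathbb{P}^*}[c(X,Y)]=\mathbf{P}(c)$. A dual maximizer is a triple of functions $f:\mathbb{R}\to\mathbb{R}\cup\{+\infty\}$, $g:\mathbb{R}\to\mathbb{R}\cup\{-\infty\}$, $h:\mathbb{R}\to\mathbb{R}$ such that $f$ is finite $\mu$-a.s., $g$ is finite $\nu$-a.s., $g(y)-f(x)-h(x)(y-x)\le c(x,y)$ for all $x,y\in\mathbb{R}$, and for every minimizer $\mathbb{P}^*$ one has $g(y)-f(x)-h(x)(y-x)=c(x,y)$ for $\mathbb{P}^*$-a.e. $(x,y)$. *)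

theory Defs
  imports "HOL-Probability.Probability"
begin

definition prob_on_R :: "real measure \<Rightarrow> bool" where
  "prob_on_R M \<longleftrightarrow> prob_space M \<and> sets M = sets borel"

text \<open>Convex order; both measures are assumed to have a finite first moment
  (so that the integrals of convex functions are well-defined).\<close>
definition convex_order :: "real measure \<Rightarrow> real measure \<Rightarrow> bool" where
  "convex_order \<mu> \<nu> \<longleftrightarrow> integrable \<mu> (\<lambda>x. x) \<and> integrable \<nu> (\<lambda>x. x) \<and>
     (\<forall>\<xi>. convex_on UNIV \<xi> \<longrightarrow> integrable \<mu> \<xi> \<longrightarrow> integrable \<nu> \<xi> \<longrightarrow>
        (\<integral>x. \<xi> x \<partial>\<mu>) \<le> (\<integral>x. \<xi> x \<partial>\<nu>))"

definition supp :: "real measure \<Rightarrow> real set" where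
  "supp M = {x. \<forall>e>0. emeasure M (ball x e) > 0}"

text \<open>Martingale couplings M(mu,nu): P on R x R with marginals mu, nu and
  E[Y|X] = X a.s. (written out via the defining property of conditional
  expectation w.r.t. sigma(X)).\<close>
definition mart_couplings :: "real measure \<Rightarrow> real measure \<Rightarrow> (real \<times> real) measure set" where
  "mart_couplings \<mu> \<nu> = {P. prob_space P \<and> sets P = sets borel \<and>
      distr P borel fst = \<mu> \<and> distr P borel snd = \<nu> \<and>
      integrable P snd \<and> integrable P fst \<and>
      (\<forall>A \<in> sets borel. (\<integral>z. indicator A (fst z) * (snd z - fst z) \<partial>P) = 0)}"

text \<open>Extended-valued expectation of c(X,Y) under P: positive part minus negative part
  (well-defined here since the positive part is integrable).\<close>
definition expect_c :: "(real \<times> real) measure \<Rightarrow> (real \<Rightarrow> real \<Rightarrow> real) \<Rightarrow> ereal" where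
  "expect_c P c = enn2ereal (\<integral>\<^sup>+z. ennreal (max (c (fst z) (snd z)) 0) \<partial>P)
                 - enn2ereal (\<integral>\<^sup>+z. ennreal (max (- c (fst z) (snd z)) 0) \<partial>P)"

definition primal :: "real measure \<Rightarrow> real measure \<Rightarrow> (real \<Rightarrow> real \<Rightarrow> real) \<Rightarrow> ereal" where
  "primal \<mu> \<nu> c = (INF P \<in> mart_couplings \<mu> \<nu>. expect_c P c)"

definition minimizer :: "real measure \<Rightarrow> real measure \<Rightarrow> (real \<Rightarrow> real \<Rightarrow> real) \<Rightarrow> (real \<times> real) measure \<Rightarrow> bool" where
  "minimizer \<mu> \<nu> c P \<longleftrightarrow> P \<in> mart_couplings \<mu> \<nu> \<and> expect_c P c = primal \<mu> \<nu> c"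

definition lsc_cost :: "(real \<Rightarrow> real \<Rightarrow> real) \<Rightarrow> bool" where
  "lsc_cost c \<longleftrightarrow> (\<forall>t. closed {z :: real \<times> real. c (fst z) (snd z) \<le> t})"

definition dual_maximizer ::
  "real measure \<Rightarrow> real measure \<Rightarrow> (real \<Rightarrow> real \<Rightarrow> real) \<Rightarrow>
   (real \<Rightarrow> ereal) \<Rightarrow> (real \<Rightarrow> ereal) \<Rightarrow> (real \<Rightarrow> real) \<Rightarrow> bool" where
  "dual_maximizer \<mu> \<nu> c f g h \<longleftrightarrow>
     (\<forall>x. f x \<noteq> -\<infinity>) \<and> (\<forall>y. g y \<noteq> \<infinity>) \<and>
     (AE x in \<mu>. f x \<noteq> \<infinity>) \<and> (AE y in \<nu>. g y \<noteq> -\<infinity>) \<and>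
     (\<forall>x y. g y - f x - ereal (h x * (y - x)) \<le> ereal (c x y)) \<and>
     (\<forall>P. minimizer \<mu> \<nu> c P \<longrightarrow>
        (AE z in P. g (snd z) - f (fst z) - ereal (h (fst z) * (snd z - fst z))
                     = ereal (c (fst z) (snd z))))"

end

theory Submission
  imports Defs "HOL-Complex_Analysis.Great_Picard"
begin

text \<open>Adding \<open>u\<close> to the cost makes \<open>c x\<close> convex for almost every \<open>x\<close> and only shifts \<open>g\<close>. Relax the
  martingale constraint to a penalty \<open>K * E \<bar>E[Y | X] - X\<bar>\<close> with \<open>K\<close> larger than the Lipschitz constant of
  the cost: on the dual side this means \<open>\<bar>h\<bar> \<le> K\<close>, so that the dual functions are equi-Lipschitz.
  For finitely supported marginals in convex order an optimizer of the relaxed problem is already a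
  martingale. Otherwise \<open>h = K\<close> at some atoms and \<open>h = - K\<close> at others; starting from the former, the
  lower bound \<open>K - L\<close> for the left slopes of \<open>g\<close> propagates to the right along atoms whose contact sets
  overlap, because \<open>c x\<close> is convex. The largest point \<open>p\<close> reached is crossed by no mass and separates the
  two kinds of atoms, which contradicts the convex order tested with \<open>max 0 (p - x)\<close>. The general case
  follows by discretisation, weak compactness of couplings and Arzela--Ascoli. A single triple with the
  value of the primal problem serves all minimizers, since its gap is nonnegative with zero mean.\<close>

subsection \<open>Farkas' lemma\<close>

text \<open>The obstacle is a bound on the slopes \<open>h\<close> that is uniform in the
  discretisation: dual solutions of the constrained finite problems need not have one, and without
  it no limit can be extracted. The penalty builds the bound into the dual. Any \<open>K > L\<close>
  will do: \<open>K - L\<close> is the slope that is propagated to the right, and it has to be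
  positive in order to clash with slopes of at most \<open>- (K - L)\<close> at atoms with
  \<open>h = - K\<close>. To keep the discretised marginals in convex order, the two sides are
  treated in opposite ways: \<mu> is contracted to barycentres of cells, which lowers integrals of
  convex functions, and \<nu> is spread to the ends of cells, which raises them. Convexity of the
  cost in \<open>y\<close> is known for almost every \<open>x\<close> only, so the cost of an atom
  is sampled at a suitable point of its cell and not at the barycentre. Of the dual functions only
  \<open>g\<close> is carried to the limit. Both \<open>f\<close> and \<open>h\<close> are rebuilt
  from the limit as value and slope of a concave envelope with slopes in \<open>{-K..K}\<close>, so
  the discrete slopes never have to converge and \<open>h\<close> is measurable by
  construction.\<close>

inductive_set row_cone :: "(('v \<Rightarrow> real) \<times> real) set \<Rightarrow> (('v \<Rightarrow> real) \<times> real) set"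
  for S where
    gen: "r \<in> S \<Longrightarrow> r \<in> row_cone S"
  | comb: "r \<in> row_cone S \<Longrightarrow> q \<in> row_cone S \<Longrightarrow> 0 \<le> s \<Longrightarrow> 0 \<le> t \<Longrightarrow>
      (\<lambda>v. s * fst r v + t * fst q v, s * snd r + t * snd q) \<in> row_cone S"

text \<open>Elimination is applied to rows that already come from elimination. Membership in the
  cone composes across these rounds, so explicit multipliers are extracted only once, at the
  end.\<close>

lemma row_cone_trans:
  assumes "r \<in> row_cone S'" "S' \<subseteq> row_cone S"
  shows "r \<in> row_cone S"
  using assms by (induction rule: row_cone.induct) (auto intro: row_cone.comb)

lemma row_cone_zero_coeff:
  assumes "r \<in> row_cone S" "\<forall>r\<in>S. fst r v = 0"
  shows "fst r v = 0"
  using assms by (induction rule: row_cone.induct) auto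

lemma row_cone_weights:
  assumes "r \<in> row_cone ((\<lambda>i. (A i, B i)) ` I)" "finite I"
  obtains w :: "'i \<Rightarrow> real" where "\<And>i. 0 \<le> w i"
    "\<And>v. fst r v = (\<Sum>i\<in>I. w i * A i v)" "snd r = (\<Sum>i\<in>I. w i * B i)"
proof -
  have "\<exists>w. (\<forall>i. 0 \<le> w i) \<and> (\<forall>v. fst r v = (\<Sum>i\<in>I. w i * A i v)) \<and> snd r = (\<Sum>i\<in>I. w i * B i)"
    using assms(1)
  proof (induction rule: row_cone.induct)
    case (gen r)
    then obtain i where i: "i \<in> I" "r = (A i, B i)" by auto
    have d: "(\<Sum>j\<in>I. (if j = i then 1 else 0) * F j) = F i" for F :: "'i \<Rightarrow> real"
      using i(1) assms(2) by (simp add: if_distrib[of "\<lambda>x. x * _"] cong: if_cong)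
    show ?case
      by (rule exI[of _ "\<lambda>j. if j = i then 1 else 0"]) (simp only: d i(2) fst_conv snd_conv, simp)
  next
    case (comb r q s t)
    then obtain w w' where "\<forall>i. 0 \<le> w i" "\<forall>v. fst r v = (\<Sum>i\<in>I. w i * A i v)" "snd r = (\<Sum>i\<in>I. w i * B i)"
      "\<forall>i. 0 \<le> w' i" "\<forall>v. fst q v = (\<Sum>i\<in>I. w' i * A i v)" "snd q = (\<Sum>i\<in>I. w' i * B i)"
      by blast
    with comb.hyps show ?case
      by (intro exI[of _ "\<lambda>i. s * w i + t * w' i"])
        (auto simp: sum_distrib_left sum.distrib algebra_simps)
  qed
  then show thesis using that by blast
qed

lemma finite_separation:
  fixes A B :: "real set"
  assumes "finite A" "finite B" "\<And>a b. a \<in> A \<Longrightarrow> b \<in> B \<Longrightarrow> a \<le> b"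
  obtains t where "\<And>a. a \<in> A \<Longrightarrow> a \<le> t" "\<And>b. b \<in> B \<Longrightarrow> t \<le> b"
proof (cases "A = {}")
  case True
  show thesis
  proof (cases "B = {}")
    case False then show thesis using True assms that[of "Min B"] by auto
  qed (use True that in auto)
next
  case False
  then show thesis using assms that[of "Max A"] by (auto simp: Max_le_iff)
qed

text \<open>Fourier--Motzkin elimination of the variables in \<open>V\<close>, one at a time.\<close>
lemma farkas_cone:
  assumes "finite V" "finite S"
    and "\<not> (\<exists>x. \<forall>r\<in>S. (\<Sum>v\<in>V. fst r v * x v) \<le> snd r)"
  shows "\<exists>r\<in>row_cone S. (\<forall>v\<in>V. fst r v = 0) \<and> snd r < 0"
  using assms
proof (induction V arbitrary: S rule: finite_induct)
  case empty
  then show ?case by (auto simp: not_le intro: row_cone.gen)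
next
  case (insert v0 V)
  define Z where "Z = {r\<in>S. fst r v0 = 0}"
  define Q where "Q = {r\<in>S. fst r v0 > 0}"
  define N where "N = {r\<in>S. fst r v0 < 0}"
  \<comment> \<open>Both rows are scaled by positive factors so that the coefficients of
    \<open>v0\<close> become \<open>1\<close> and \<open>- 1\<close> and cancel.\<close>
  define cmb where "cmb = (\<lambda>(r, q). ((\<lambda>v. (1 / fst r v0) * fst r v + (1 / - fst q v0) * fst q v),
    (1 / fst r v0) * snd r + (1 / - fst q v0) * snd q) :: ('a \<Rightarrow> real) \<times> real)"
  define S' where "S' = Z \<union> cmb ` (Q \<times> N)"
  have fin: "finite Z" "finite Q" "finite N" "finite S'"
    using insert.prems(1) by (auto simp: Z_def Q_def N_def S'_def)
  have "cmb (r, q) \<in> row_cone S" if "r \<in> Q" "q \<in> N" for r q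
    unfolding cmb_def split using that
    by (intro row_cone.comb) (auto simp: Q_def N_def intro: row_cone.gen)
  then have sub: "S' \<subseteq> row_cone S"
    by (auto simp: S'_def Z_def intro: row_cone.gen)
  have z: "\<forall>r\<in>S'. fst r v0 = 0"
    by (auto simp: S'_def Z_def Q_def N_def cmb_def)
  have "\<not> (\<exists>x. \<forall>r\<in>S'. (\<Sum>v\<in>V. fst r v * x v) \<le> snd r)"
  proof
    assume "\<exists>x. \<forall>r\<in>S'. (\<Sum>v\<in>V. fst r v * x v) \<le> snd r"
    then obtain x where x: "\<And>r. r \<in> S' \<Longrightarrow> (\<Sum>v\<in>V. fst r v * x v) \<le> snd r" by blast
    \<comment> \<open>The bound that row \<open>r\<close> puts on \<open>v0\<close> when the other
      unknowns equal \<open>x\<close>: an upper bound for rows in \<open>Q\<close>, a lower bound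
      for rows in \<open>N\<close>. A combined row says precisely that two such bounds are
      compatible.\<close>
    define bd where "bd r = (snd r - (\<Sum>v\<in>V. fst r v * x v)) / fst r v0" for r :: "('a \<Rightarrow> real) \<times> real"
    have le: "bd q \<le> bd r" if r: "r \<in> Q" and q: "q \<in> N" for r q
    proof -
      have pos: "fst r v0 > 0" "fst q v0 < 0" using r q by (auto simp: Q_def N_def)
      have "cmb (r, q) \<in> S'" using r q by (auto simp: S'_def)
      from x[OF this] have "(1 / fst r v0) * (\<Sum>v\<in>V. fst r v * x v) + (1 / - fst q v0) * (\<Sum>v\<in>V. fst q v * x v)
         \<le> (1 / fst r v0) * snd r + (1 / - fst q v0) * snd q"
        by (simp add: cmb_def algebra_simps sum.distrib sum_subtractf sum_negf sum_distrib_left sum_distrib_right sum_divide_distrib)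
      then show ?thesis unfolding bd_def diff_divide_distrib
        by (simp add: algebra_simps sum_negf sum_divide_distrib)
    qed
    obtain t where t: "\<And>q. q \<in> N \<Longrightarrow> bd q \<le> t" "\<And>r. r \<in> Q \<Longrightarrow> t \<le> bd r"
      using finite_separation[of "bd ` N" "bd ` Q"] fin le by (metis (no_types, lifting) finite_imageI image_iff)
    have "(\<Sum>v\<in>insert v0 V. fst r v * (x(v0 := t)) v) \<le> snd r" if r: "r \<in> S" for r
    proof -
      have e: "(\<Sum>v\<in>insert v0 V. fst r v * (x(v0 := t)) v) = fst r v0 * t + (\<Sum>v\<in>V. fst r v * x v)"
        using insert.hyps by (simp, intro sum.cong) auto
      consider "fst r v0 = 0" | "fst r v0 > 0" | "fst r v0 < 0" by linarith
      then show ?thesis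
      proof cases
        case 1
        then show ?thesis using x[of r] r e by (auto simp: S'_def Z_def)
      next
        case 2
        then show ?thesis using t(2)[of r] r e by (auto simp: Q_def bd_def field_simps)
      next
        case 3
        then show ?thesis using t(1)[of r] r e by (auto simp: N_def bd_def field_simps)
      qed
    qed
    then show False using insert.prems(2) by blast
  qed
  from insert.IH[OF fin(4) this] obtain r where r: "r \<in> row_cone S'" "\<forall>v\<in>V. fst r v = 0" "snd r < 0"
    by blast
  then show ?case
    using row_cone_trans[OF r(1) sub] row_cone_zero_coeff[OF r(1) z] by auto
qed

lemma farkas:
  fixes A :: "'i \<Rightarrow> 'v \<Rightarrow> real"
  assumes "finite V" "finite I"
    and "\<not> (\<exists>x. \<forall>i\<in>I. (\<Sum>v\<in>V. A i v * x v) \<le> B i)"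
  obtains w where "\<And>i. 0 \<le> w i" "\<And>v. v \<in> V \<Longrightarrow> (\<Sum>i\<in>I. w i * A i v) = 0"
    "(\<Sum>i\<in>I. w i * B i) < 0"
proof -
  have "\<exists>r\<in>row_cone ((\<lambda>i. (A i, B i)) ` I). (\<forall>v\<in>V. fst r v = 0) \<and> snd r < 0"
    by (rule farkas_cone) (use assms in auto)
  then obtain r where r: "r \<in> row_cone ((\<lambda>i. (A i, B i)) ` I)" "\<forall>v\<in>V. fst r v = 0" "snd r < 0"
    by blast
  from row_cone_weights[OF r(1) assms(2)] obtain w where w: "\<And>i. 0 \<le> w i"
    "\<And>v. fst r v = (\<Sum>i\<in>I. w i * A i v)" "snd r = (\<Sum>i\<in>I. w i * B i)"
    by metis
  show thesis
    by (rule that[of w]) (use w r in auto)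
qed

subsection \<open>Finitely supported marginals\<close>

text \<open>Source atoms are indexed instead of being identified with their positions: positions may
  coincide, and the cost of atom \<open>i\<close> will be sampled at a point other than its
  position.\<close>

definition weight_coupling :: "'i set \<Rightarrow> real set \<Rightarrow> ('i \<Rightarrow> real) \<Rightarrow> (real \<Rightarrow> real) \<Rightarrow> ('i \<Rightarrow> real \<Rightarrow> real) \<Rightarrow> bool" where
  "weight_coupling I Y m n \<pi> \<longleftrightarrow> (\<forall>i\<in>I. \<forall>y\<in>Y. 0 \<le> \<pi> i y) \<and>
     (\<forall>i\<in>I. (\<Sum>y\<in>Y. \<pi> i y) = m i) \<and> (\<forall>y\<in>Y. (\<Sum>i\<in>I. \<pi> i y) = n y)"

text \<open>For a coupling, the inner sum of the penalty is \<open>m i\<close> times the mean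
  displacement given atom \<open>i\<close>. The outer sum therefore needs no further weights to be
  an expectation.\<close>

definition penalised_cost :: "'i set \<Rightarrow> real set \<Rightarrow> ('i \<Rightarrow> real) \<Rightarrow> ('i \<Rightarrow> real \<Rightarrow> real) \<Rightarrow> real \<Rightarrow> ('i \<Rightarrow> real \<Rightarrow> real) \<Rightarrow> real" where
  "penalised_cost I Y x c K \<pi> =
     (\<Sum>i\<in>I. \<Sum>y\<in>Y. \<pi> i y * c i y) + K * (\<Sum>i\<in>I. \<bar>\<Sum>y\<in>Y. \<pi> i y * (y - x i)\<bar>)"

lemma sum_delta_mult:
  fixes a :: "'a \<Rightarrow> real"
  assumes "finite I"
  shows "(\<Sum>k\<in>I. (if k = i then a k else 0) * f k) = (if i \<in> I then a i * f i else 0)"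
    and "(\<Sum>k\<in>I. f k * (if i = k then a k else 0)) = (if i \<in> I then f i * a i else 0)"
  using assms by (auto simp: if_distrib[of "\<lambda>x. x * _"] if_distrib[of "\<lambda>x. _ * x"] cong: if_cong)

text \<open>Strong duality through Farkas: that some feasible triple reaches the value
  \<open>v\<close> is a finite linear system, and a certificate of its infeasibility is, after
  rescaling, a coupling with penalised cost below \<open>v\<close>. The two-sided bound on
  \<open>h\<close> is what turns into the absolute value in the penalty.\<close>

lemma penalised_dual:
  fixes m x :: "'i \<Rightarrow> real" and n :: "real \<Rightarrow> real"
  assumes fin: "finite I" "finite Y" and K: "0 \<le> K"
    and v: "\<And>\<pi>. weight_coupling I Y m n \<pi> \<Longrightarrow> v \<le> penalised_cost I Y x c K \<pi>"
  obtains f h g where "\<And>i y. i \<in> I \<Longrightarrow> y \<in> Y \<Longrightarrow> g y - f i - h i * (y - x i) \<le> c i y"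
    "\<And>i. i \<in> I \<Longrightarrow> \<bar>h i\<bar> \<le> K" "v \<le> (\<Sum>y\<in>Y. n y * g y) - (\<Sum>i\<in>I. m i * f i)"
proof -
  \<comment> \<open>Unknowns: \<open>f\<close> and \<open>h\<close> on \<open>I\<close>,
    \<open>g\<close> on \<open>Y\<close>. Rows: the inequality for each pair \<open>(i, y)\<close>,
    then \<open>h i \<le> K\<close>, then \<open>- h i \<le> K\<close>, and one last row asking for
    a dual value of at least \<open>v\<close>.\<close>
  define V where "V = I <+> (I <+> Y)"
  define R where "R = (I \<times> Y) <+> (I <+> (I <+> {()}))"
  define A :: "('i \<times> real) + ('i + ('i + unit)) \<Rightarrow> 'i + ('i + real) \<Rightarrow> real" where
    "A = case_sum (\<lambda>(i, y). case_sum (\<lambda>k. if k = i then - 1 else 0)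
            (case_sum (\<lambda>k. if k = i then - (y - x i) else 0) (\<lambda>z. if z = y then 1 else 0)))
         (case_sum (\<lambda>i. case_sum (\<lambda>k. 0) (case_sum (\<lambda>k. if k = i then 1 else 0) (\<lambda>z. 0)))
         (case_sum (\<lambda>i. case_sum (\<lambda>k. 0) (case_sum (\<lambda>k. if k = i then - 1 else 0) (\<lambda>z. 0)))
           (\<lambda>_. case_sum m (case_sum (\<lambda>k. 0) (\<lambda>z. - n z)))))"
  define B :: "('i \<times> real) + ('i + ('i + unit)) \<Rightarrow> real" where
    "B = case_sum (\<lambda>(i, y). c i y) (case_sum (\<lambda>i. K) (case_sum (\<lambda>i. K) (\<lambda>_. - v)))"
  have finV: "finite V" and finR: "finite R" using fin by (auto simp: V_def R_def)
  have "\<exists>z. \<forall>r\<in>R. (\<Sum>v\<in>V. A r v * z v) \<le> B r"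
  proof (rule ccontr)
    assume "\<not> ?thesis"
    from farkas[OF finV finR this] obtain w where w: "\<And>r. 0 \<le> w r"
      "\<And>v. v \<in> V \<Longrightarrow> (\<Sum>r\<in>R. w r * A r v) = 0" "(\<Sum>r\<in>R. w r * B r) < 0" by blast
    \<comment> \<open>The multipliers of the four groups of rows. The equations for \<open>h\<close>
      give \<open>s i - t i\<close> as the drift of atom \<open>i\<close>, so
      \<open>s i + t i\<close> dominates its absolute value.\<close>
    define \<pi> where "\<pi> i y = w (Inl (i, y))" for i y
    define s where "s i = w (Inr (Inl i))" for i
    define t where "t i = w (Inr (Inr (Inl i)))" for i
    define l where "l = w (Inr (Inr (Inr ())))"
    have nn: "\<pi> i y \<ge> 0" "s i \<ge> 0" "t i \<ge> 0" "l \<ge> 0" for i y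
      using w(1) by (auto simp: \<pi>_def s_def t_def l_def)
    have sumR: "(\<Sum>r\<in>R. w r * F r) = (\<Sum>i\<in>I. \<Sum>y\<in>Y. \<pi> i y * F (Inl (i, y))) +
      ((\<Sum>i\<in>I. s i * F (Inr (Inl i))) + ((\<Sum>i\<in>I. t i * F (Inr (Inr (Inl i)))) + l * F (Inr (Inr (Inr ())))))"
      for F
      using fin by (simp add: R_def sum.Plus sum.cartesian_product \<pi>_def s_def t_def l_def split_def)
    have e1: "(\<Sum>y\<in>Y. \<pi> i y) = l * m i" if "i \<in> I" for i
    proof -
      have "(\<Sum>r\<in>R. w r * A r (Inl i)) = 0" using that by (intro w(2)) (auto simp: V_def)
      then have "(\<Sum>k\<in>I. \<Sum>y\<in>Y. \<pi> k y * (if i = k then - 1 else 0)) + l * m i = 0"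
        by (simp add: sumR A_def)
      also have "(\<Sum>k\<in>I. \<Sum>y\<in>Y. \<pi> k y * (if i = k then - 1 else 0)) = - (\<Sum>y\<in>Y. \<pi> i y)"
        unfolding sum_distrib_right[symmetric] using fin(1) that by (subst sum_delta_mult(2)) auto
      finally show ?thesis by simp
    qed
    have e2: "(\<Sum>i\<in>I. \<pi> i y) = l * n y" if "y \<in> Y" for y
    proof -
      have "(\<Sum>r\<in>R. w r * A r (Inr (Inr y))) = 0" using that by (intro w(2)) (auto simp: V_def)
      then have "(\<Sum>i\<in>I. \<Sum>z\<in>Y. \<pi> i z * (if y = z then 1 else 0)) - l * n y = 0"
        by (simp add: sumR A_def)
      then show ?thesis using fin that by (simp add: sum_delta_mult)
    qed
    have e3: "s i - t i = (\<Sum>y\<in>Y. \<pi> i y * (y - x i))" if "i \<in> I" for i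
    proof -
      have "(\<Sum>r\<in>R. w r * A r (Inr (Inl i))) = 0" using that by (intro w(2)) (auto simp: V_def)
      then have "(\<Sum>k\<in>I. \<Sum>y\<in>Y. \<pi> k y * (if i = k then - (y - x k) else 0)) + (s i - t i) = 0"
        using fin that by (simp add: sumR A_def sum_delta_mult)
      also have "(\<Sum>k\<in>I. \<Sum>y\<in>Y. \<pi> k y * (if i = k then - (y - x k) else 0)) =
         (\<Sum>k\<in>I. if i = k then (\<Sum>y\<in>Y. \<pi> k y * - (y - x k)) else 0)"
        by (intro sum.cong) auto
      also have "\<dots> = - (\<Sum>y\<in>Y. \<pi> i y * (y - x i))"
        using fin(1) that by (simp add: sum_negf[symmetric] algebra_simps)
      finally show ?thesis by simp
    qed
    have e4: "(\<Sum>i\<in>I. \<Sum>y\<in>Y. \<pi> i y * c i y) + K * (\<Sum>i\<in>I. s i + t i) < l * v"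
      using w(3) by (simp add: sumR B_def sum.distrib sum_distrib_left sum_distrib_right algebra_simps)
    have pen: "(\<Sum>i\<in>I. \<bar>\<Sum>y\<in>Y. \<pi> i y * (y - x i)\<bar>) \<le> (\<Sum>i\<in>I. s i + t i)"
    proof (rule sum_mono)
      fix i assume "i \<in> I"
      then show "\<bar>\<Sum>y\<in>Y. \<pi> i y * (y - x i)\<bar> \<le> s i + t i" using e3[of i] nn(2,3)[of i] by linarith
    qed
    have le: "penalised_cost I Y x c K \<pi> < l * v"
      unfolding penalised_cost_def using e4 mult_left_mono[OF pen K] by linarith
    show False
    proof (cases "l = 0")
      \<comment> \<open>With no weight on the row for \<open>v\<close>, the row sums force all
        weights to vanish and the strict inequality reads \<open>0 < 0\<close>.\<close>
      case True
      have "\<pi> i y = 0" if "i \<in> I" "y \<in> Y" for i y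
        using e1[OF that(1)] True nn(1) that(2) fin(2) by (simp add: sum_nonneg_eq_0_iff)
      then have "penalised_cost I Y x c K \<pi> = 0" by (simp add: penalised_cost_def)
      then show False using le True by simp
    next
      case False
      then have l: "l > 0" using nn(4) by simp
      have "weight_coupling I Y m n (\<lambda>i y. \<pi> i y / l)"
        unfolding weight_coupling_def using l nn(1) e1 e2 by (simp add: sum_divide_distrib[symmetric])
      from v[OF this] have "v \<le> penalised_cost I Y x c K (\<lambda>i y. \<pi> i y / l)" .
      also have "\<dots> = penalised_cost I Y x c K \<pi> / l"
        using l unfolding penalised_cost_def
        by (simp add: add_divide_distrib sum_divide_distrib[symmetric])
      also have "\<dots> < v" using le l by (simp add: field_simps)
      finally show False by simp
    qed
  qed
  then obtain z where z: "\<And>r. r \<in> R \<Longrightarrow> (\<Sum>v\<in>V. A r v * z v) \<le> B r" by blast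
  define f where "f i = z (Inl i)" for i
  define h where "h i = z (Inr (Inl i))" for i
  define g where "g y = z (Inr (Inr y))" for y
  have sumV: "(\<Sum>v\<in>V. F v * z v) = (\<Sum>i\<in>I. F (Inl i) * f i) + ((\<Sum>i\<in>I. F (Inr (Inl i)) * h i) +
      (\<Sum>y\<in>Y. F (Inr (Inr y)) * g y))" for F
    using fin by (simp add: V_def sum.Plus f_def g_def h_def)
  show thesis
  proof (rule that[of g f h])
    show "g y - f i - h i * (y - x i) \<le> c i y" if "i \<in> I" "y \<in> Y" for i y
    proof -
      have "(\<Sum>v\<in>V. A (Inl (i, y)) v * z v) = g y - f i - h i * (y - x i)"
        using that fin by (simp only: sumV) (simp add: A_def sum_delta_mult, simp add: algebra_simps)
      then show ?thesis using z[of "Inl (i, y)"] that by (auto simp: R_def B_def)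
    qed
    show "\<bar>h i\<bar> \<le> K" if "i \<in> I" for i
    proof -
      have "Inr (Inl i) \<in> R" "Inr (Inr (Inl i)) \<in> R" using that by (auto simp: R_def)
      from this[THEN z] show ?thesis using that fin
        by (simp add: sumV A_def B_def sum_delta_mult abs_le_iff)
    qed
    show "v \<le> (\<Sum>y\<in>Y. n y * g y) - (\<Sum>i\<in>I. m i * f i)"
    proof -
      have "Inr (Inr (Inr ())) \<in> R" by (auto simp: R_def)
      from z[OF this] show ?thesis by (simp add: sumV A_def B_def sum_negf)
    qed
  qed
qed

text \<open>Weights lie in the unit interval, so couplings that vanish off
  \<open>I \<times> Y\<close> form a compact set in the product topology, on which the cost is
  continuous. The product coupling shows that it is not empty.\<close>

lemma penalised_primal:
  fixes m x :: "'i \<Rightarrow> real" and n :: "real \<Rightarrow> real"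
  assumes fin: "finite I" "finite Y" and pos: "\<And>i. i \<in> I \<Longrightarrow> 0 \<le> m i" "\<And>y. y \<in> Y \<Longrightarrow> 0 \<le> n y"
    and mass: "(\<Sum>i\<in>I. m i) = 1" "(\<Sum>y\<in>Y. n y) = 1"
  obtains \<pi> where "weight_coupling I Y m n \<pi>"
    "\<And>\<pi>'. weight_coupling I Y m n \<pi>' \<Longrightarrow> penalised_cost I Y x c K \<pi> \<le> penalised_cost I Y x c K \<pi>'"
proof -
  define P where "P = PiE UNIV (\<lambda>z. if z \<in> I \<times> Y then {0..1::real} else {0})"
  define S where "S = {p \<in> P. weight_coupling I Y m n (curry p)}"
  have cP: "compact P"
  proof -
    have "compactin (product_topology (\<lambda>i. euclidean) UNIV) P"
      unfolding P_def by (subst compactin_PiE) auto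
    then show ?thesis by (simp add: euclidean_product_topology)
  qed
  have cS: "compact S"
  proof -
    have "S = P \<inter> {p. weight_coupling I Y m n (curry p)}" by (auto simp: S_def)
    moreover have "closed {p. weight_coupling I Y m n (curry p)}"
      unfolding weight_coupling_def curry_def Ball_def
      by (intro closed_Collect_conj closed_Collect_all closed_Collect_imp closed_Collect_le closed_Collect_eq open_Collect_const
          continuous_intros continuous_on_product_coordinates)
    ultimately show ?thesis using cP by (simp add: compact_Int_closed)
  qed
  \<comment> \<open>Values off \<open>I \<times> Y\<close> do not affect the cost, so every coupling
    has a competitor inside the compact set.\<close>
  have trunc: "(\<lambda>z. if z \<in> I \<times> Y then \<pi> (fst z) (snd z) else 0) \<in> S"
    if "weight_coupling I Y m n \<pi>" for \<pi>
  proof -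
    have "\<pi> i y \<le> 1" if iy: "i \<in> I" "y \<in> Y" for i y
    proof -
      have "\<pi> i y \<le> (\<Sum>y\<in>Y. \<pi> i y)"
        using iy fin \<open>weight_coupling I Y m n \<pi>\<close> by (intro member_le_sum) (auto simp: weight_coupling_def)
      also have "\<dots> = m i" using iy \<open>weight_coupling I Y m n \<pi>\<close> by (auto simp: weight_coupling_def)
      also have "\<dots> \<le> 1" using member_le_sum[of i I m] iy fin pos mass by auto
      finally show ?thesis .
    qed
    then show ?thesis using that by (auto simp: S_def P_def weight_coupling_def)
  qed
  have cont: "continuous_on S (\<lambda>p. penalised_cost I Y x c K (curry p))"
    unfolding penalised_cost_def curry_def
    by (intro continuous_intros continuous_on_subset[OF continuous_on_product_coordinates subset_UNIV])
  have "weight_coupling I Y m n (\<lambda>i y. m i * n y)"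
    using pos mass by (auto simp: weight_coupling_def sum_distrib_left[symmetric] sum_distrib_right[symmetric])
  then have "S \<noteq> {}" using trunc by blast
  from continuous_attains_inf[OF cS this cont] obtain p where p: "p \<in> S"
    "\<And>q. q \<in> S \<Longrightarrow> penalised_cost I Y x c K (curry p) \<le> penalised_cost I Y x c K (curry q)" by blast
  show thesis
  proof (rule that[of "curry p"])
    show "weight_coupling I Y m n (curry p)" using p(1) by (simp add: S_def)
    show "penalised_cost I Y x c K (curry p) \<le> penalised_cost I Y x c K \<pi>'"
      if "weight_coupling I Y m n \<pi>'" for \<pi>'
    proof -
      have "penalised_cost I Y x c K (curry p) \<le> penalised_cost I Y x c K (curry (\<lambda>z. if z \<in> I \<times> Y then \<pi>' (fst z) (snd z) else 0))"
        by (intro p(2) trunc that)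
      also have "\<dots> = penalised_cost I Y x c K \<pi>'"
        by (simp add: penalised_cost_def)
      finally show ?thesis .
    qed
  qed
qed

section \<open>The optimal relaxed coupling is a martingale: propagation of slopes\<close>

lemma convex_on_slope_right:
  fixes \<phi> :: "real \<Rightarrow> real"
  assumes "convex_on S \<phi>" "w \<in> S" "r \<in> S" "w < p" "p \<le> q" "q < r"
    and slope: "s * (p - w) \<le> \<phi> p - \<phi> w"
  shows "s * (r - q) \<le> \<phi> r - \<phi> q"
proof -
  have "s \<le> (\<phi> w - \<phi> p) / (w - p)" using slope assms(4) by (simp add: field_simps)
  also have "\<dots> \<le> (\<phi> w - \<phi> r) / (w - r)"
    using assms by (intro convex_on_slope_le(1)[of S]) auto
  also have "\<dots> \<le> (\<phi> q - \<phi> r) / (q - r)"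
    using assms by (intro convex_on_slope_le(2)[of S]) auto
  finally show ?thesis using assms(6) by (simp add: field_simps)
qed

text \<open>Complementary slackness drives the argument: mass sits only where
  \<open>\<phi> i\<close> touches \<open>g\<close> from above, and a nonzero drift
  \<open>d i\<close> forces \<open>h i\<close> to equal \<open>K\<close> or \<open>- K\<close>
  according to its sign. An atom \<open>a\<close> with positive drift makes the comparison at the
  separating point strict by the amount \<open>d a\<close>.\<close>

lemma penalised_optimal_martingale:
  fixes m x :: "'i \<Rightarrow> real" and n :: "real \<Rightarrow> real"
  assumes fin: "finite I" "finite Y" and m: "\<And>i. i \<in> I \<Longrightarrow> 0 < m i"
    and mean: "(\<Sum>i\<in>I. m i * x i) = (\<Sum>y\<in>Y. n y * y)"
    and put: "\<And>p. (\<Sum>i\<in>I. m i * max 0 (p - x i)) \<le> (\<Sum>y\<in>Y. n y * max 0 (p - y))"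
    and conv: "\<And>i. i \<in> I \<Longrightarrow> convex_on S (c i)" and YS: "Y \<subseteq> S"
    and lip: "\<And>i y z. i \<in> I \<Longrightarrow> y \<in> Y \<Longrightarrow> z \<in> Y \<Longrightarrow> \<bar>c i y - c i z\<bar> \<le> L * \<bar>y - z\<bar>"
    and L: "0 \<le> L" "L < K"
    and \<pi>: "weight_coupling I Y m n \<pi>"
    and feas: "\<And>i y. i \<in> I \<Longrightarrow> y \<in> Y \<Longrightarrow> g y - f i - h i * (y - x i) \<le> c i y"
    and hK: "\<And>i. i \<in> I \<Longrightarrow> \<bar>h i\<bar> \<le> K"
    and opt: "penalised_cost I Y x c K \<pi> \<le> (\<Sum>y\<in>Y. n y * g y) - (\<Sum>i\<in>I. m i * f i)"
  shows "\<forall>i\<in>I. (\<Sum>y\<in>Y. \<pi> i y * (y - x i)) = 0"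
proof -
  define d where "d i = (\<Sum>y\<in>Y. \<pi> i y * (y - x i))" for i
  define \<phi> where "\<phi> i y = f i + h i * (y - x i) + c i y" for i y
  have \<pi>0: "0 \<le> \<pi> i y" if "i \<in> I" "y \<in> Y" for i y using \<pi> that by (auto simp: weight_coupling_def)
  have row: "(\<Sum>y\<in>Y. \<pi> i y) = m i" if "i \<in> I" for i using \<pi> that by (auto simp: weight_coupling_def)
  have col: "(\<Sum>i\<in>I. \<pi> i y) = n y" if "y \<in> Y" for y using \<pi> that by (auto simp: weight_coupling_def)
  have sumY: "(\<Sum>y\<in>Y. n y * F y) = (\<Sum>i\<in>I. \<Sum>y\<in>Y. \<pi> i y * F y)" for F
  proof -
    have "(\<Sum>y\<in>Y. n y * F y) = (\<Sum>y\<in>Y. \<Sum>i\<in>I. \<pi> i y * F y)"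
      using col by (simp add: sum_distrib_right[symmetric])
    then show ?thesis by (simp add: sum.swap[of _ I Y])
  qed
  have sumI: "(\<Sum>i\<in>I. m i * F i) = (\<Sum>i\<in>I. \<Sum>y\<in>Y. \<pi> i y * F i)" for F
    using row by (simp add: sum_distrib_right[symmetric])
  \<comment> \<open>All summands are nonnegative and their total is the primal minus the dual value,
    so each of them vanishes.\<close>
  have gap: "(\<Sum>i\<in>I. (\<Sum>y\<in>Y. \<pi> i y * (\<phi> i y - g y)) + (K * \<bar>d i\<bar> - h i * d i)) \<le> 0"
  proof -
    have A: "(\<Sum>y\<in>Y. \<pi> i y * (\<phi> i y - g y)) - h i * d i =
        (\<Sum>y\<in>Y. \<pi> i y * c i y) - (\<Sum>y\<in>Y. \<pi> i y * g y) + (\<Sum>y\<in>Y. \<pi> i y * f i)" for i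
      unfolding d_def \<phi>_def sum_distrib_left sum.distrib[symmetric] sum_subtractf[symmetric]
      by (intro sum.cong refl) (simp add: algebra_simps)
    have "(\<Sum>i\<in>I. (\<Sum>y\<in>Y. \<pi> i y * (\<phi> i y - g y)) + (K * \<bar>d i\<bar> - h i * d i))
      = (\<Sum>i\<in>I. K * \<bar>d i\<bar> + ((\<Sum>y\<in>Y. \<pi> i y * (\<phi> i y - g y)) - h i * d i))"
      by (intro sum.cong refl) simp
    also have "\<dots> = penalised_cost I Y x c K \<pi> - ((\<Sum>y\<in>Y. n y * g y) - (\<Sum>i\<in>I. m i * f i))"
      unfolding A sumY sumI penalised_cost_def d_def[symmetric]
      by (simp add: sum.distrib sum_subtractf sum_distrib_left)
    finally have "(\<Sum>i\<in>I. (\<Sum>y\<in>Y. \<pi> i y * (\<phi> i y - g y)) + (K * \<bar>d i\<bar> - h i * d i))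
      = penalised_cost I Y x c K \<pi> - ((\<Sum>y\<in>Y. n y * g y) - (\<Sum>i\<in>I. m i * f i))" .
    then show ?thesis using opt by simp
  qed
  have nn1: "0 \<le> \<pi> i y * (\<phi> i y - g y)" if "i \<in> I" "y \<in> Y" for i y
    using \<pi>0[OF that] feas[OF that] by (simp add: \<phi>_def)
  have nn2: "0 \<le> K * \<bar>d i\<bar> - h i * d i" if "i \<in> I" for i
    using mult_right_mono[OF hK[OF that], of "\<bar>d i\<bar>"] abs_ge_self[of "h i * d i"] by (simp add: abs_mult)
  have nn: "0 \<le> (\<Sum>y\<in>Y. \<pi> i y * (\<phi> i y - g y)) + (K * \<bar>d i\<bar> - h i * d i)" if "i \<in> I" for i
    using nn1[OF that] nn2[OF that] by (intro add_nonneg_nonneg sum_nonneg) auto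
  have zero: "(\<Sum>y\<in>Y. \<pi> i y * (\<phi> i y - g y)) = 0 \<and> h i * d i = K * \<bar>d i\<bar>" if i: "i \<in> I" for i
  proof -
    have "(\<Sum>i\<in>I. (\<Sum>y\<in>Y. \<pi> i y * (\<phi> i y - g y)) + (K * \<bar>d i\<bar> - h i * d i)) = 0"
      using gap sum_nonneg[of I, OF nn] by (intro antisym) auto
    then have "(\<Sum>y\<in>Y. \<pi> i y * (\<phi> i y - g y)) + (K * \<bar>d i\<bar> - h i * d i) = 0"
      by (subst (asm) sum_nonneg_eq_0_iff[OF fin(1)]) (use nn i in blast)+
    moreover have "0 \<le> (\<Sum>y\<in>Y. \<pi> i y * (\<phi> i y - g y))" using nn1[OF i] by (auto intro: sum_nonneg)
    ultimately show ?thesis using nn2[OF i] by linarith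
  qed
  have ge: "g y \<le> \<phi> i y" if "i \<in> I" "y \<in> Y" for i y using feas[OF that] by (simp add: \<phi>_def)
  define \<Gamma> where "\<Gamma> i = {y\<in>Y. 0 < \<pi> i y}" for i
  have eq: "\<phi> i y = g y" if "i \<in> I" "y \<in> \<Gamma> i" for i y
  proof -
    have "\<pi> i y * (\<phi> i y - g y) = 0"
      using zero[OF that(1)] nn1[OF that(1)] that(2) sum_nonneg_eq_0_iff[OF fin(2), of "\<lambda>y. \<pi> i y * (\<phi> i y - g y)"]
      by (auto simp: \<Gamma>_def)
    then show ?thesis using that by (auto simp: \<Gamma>_def)
  qed
  have \<Gamma>sum: "(\<Sum>y\<in>Y. \<pi> i y * F y) = (\<Sum>y\<in>\<Gamma> i. \<pi> i y * F y)" if "i \<in> I" for i F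
    unfolding \<Gamma>_def using fin(2) \<pi>0[OF that] by (intro sum.mono_neutral_right) (auto simp: not_less intro: antisym)
  have \<Gamma>ne: "\<Gamma> i \<noteq> {}" if "i \<in> I" for i
    using \<Gamma>sum[OF that, of "\<lambda>_. 1"] row[OF that] m[OF that] by auto
  have \<Gamma>Y: "\<Gamma> i \<subseteq> Y" for i by (auto simp: \<Gamma>_def)
  have conv\<phi>: "convex_on S (\<phi> i)" if "i \<in> I" for i
  proof -
    have "convex_on S (\<lambda>y. (h i * y + (f i - h i * x i)) + c i y)"
      by (rule convex_on_add[OF convex_onI conv[OF that]])
        (auto simp: algebra_simps intro: convex_on_imp_convex[OF conv[OF that]])
    moreover have "\<phi> i = (\<lambda>y. (h i * y + (f i - h i * x i)) + c i y)"
      by (auto simp: \<phi>_def algebra_simps)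
    ultimately show ?thesis by simp
  qed
  \<comment> \<open>At a good point every chord of \<open>g\<close> to the left has slope at least
    \<open>K - L\<close>.\<close>
  define good where "good p \<longleftrightarrow> p \<in> Y \<and> (\<forall>y\<in>Y. y < p \<longrightarrow> (K - L) * (p - y) \<le> g p - g y)" for p
  \<comment> \<open>Positive drift means \<open>h i = K\<close>, so \<open>\<phi> i\<close> grows at
    rate at least \<open>K - L\<close>; it equals \<open>g\<close> at \<open>y\<close> and lies
    above \<open>g\<close> elsewhere on the grid.\<close>
  have start: "good y" if i: "i \<in> I" and d: "0 < d i" and y: "y \<in> \<Gamma> i" for i y
  proof -
    have "h i = K" using zero[OF i] d by auto
    have "(K - L) * (y - z) \<le> g y - g z" if z: "z \<in> Y" "z < y" for z
    proof -
      have "\<bar>c i y - c i z\<bar> \<le> L * (y - z)"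
        using lip[OF i, of y z] y z \<Gamma>Y by auto
      then have "- (L * (y - z)) \<le> c i y - c i z" by linarith
      then have "(K - L) * (y - z) \<le> \<phi> i y - \<phi> i z" by (simp add: \<phi>_def \<open>h i = K\<close> algebra_simps)
      then show ?thesis using eq[OF i y] ge[OF i z(1)] by linarith
    qed
    then show ?thesis using y \<Gamma>Y by (auto simp: good_def)
  qed
  \<comment> \<open>Since \<open>\<phi> i\<close> equals \<open>g\<close> at \<open>w\<close> and
    lies above it at \<open>p\<close>, its chord from \<open>w\<close> to \<open>p\<close> has slope
    at least \<open>K - L\<close>. Convexity keeps this slope up to \<open>r\<close>, where
    \<open>\<phi> i\<close> equals \<open>g\<close> again.\<close>
  have step: "good r" if p: "good p" and i: "i \<in> I" and w: "w \<in> \<Gamma> i" "w < p" and r: "r \<in> \<Gamma> i" "p < r" for p i w r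
  proof -
    have pY: "p \<in> Y" using p by (simp add: good_def)
    have "(K - L) * (p - w) \<le> g p - g w" using p w \<Gamma>Y by (auto simp: good_def)
    then have sl: "(K - L) * (p - w) \<le> \<phi> i p - \<phi> i w" using eq[OF i w(1)] ge[OF i pY] by linarith
    have *: "(K - L) * (r - y) \<le> g r - g y" if y: "y \<in> Y" "p \<le> y" "y < r" for y
    proof -
      have "(K - L) * (r - y) \<le> \<phi> i r - \<phi> i y"
        using y w r sl \<Gamma>Y YS by (intro convex_on_slope_right[OF conv\<phi>[OF i], of w r p y]) auto
      then show ?thesis using eq[OF i r(1)] ge[OF i y(1)] by linarith
    qed
    have "(K - L) * (r - y) \<le> g r - g y" if y: "y \<in> Y" "y < r" for y
    proof (cases "p \<le> y")
      case False
      then have "(K - L) * (p - y) \<le> g p - g y" using p y by (auto simp: good_def)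
      then show ?thesis using *[OF pY] r(2) by (simp add: algebra_simps)
    qed (use * y in auto)
    then show ?thesis using r \<Gamma>Y by (auto simp: good_def)
  qed
  \<comment> \<open>Negative drift means \<open>h i = - K\<close>, so \<open>\<phi> i\<close> falls
    at rate at least \<open>K - L\<close>. A contact point to the left of \<open>p\<close> would
    make \<open>g\<close> fall towards \<open>p\<close>, against goodness of
    \<open>p\<close>.\<close>
  have stop: "p \<le> y" if p: "good p" and i: "i \<in> I" and d: "d i < 0" and y: "y \<in> \<Gamma> i" for p i y
  proof (rule ccontr)
    assume "\<not> p \<le> y"
    then have yp: "y < p" by simp
    have pY: "p \<in> Y" and yY: "y \<in> Y" using p y \<Gamma>Y by (auto simp: good_def)
    have "h i * d i = - K * d i" using zero[OF i] d by simp
    then have "h i = - K" using d by (metis less_irrefl mult_right_cancel)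
    have "(K - L) * (p - y) \<le> g p - g y" using p yY yp by (auto simp: good_def)
    also have "\<dots> \<le> \<phi> i p - \<phi> i y" using eq[OF i y] ge[OF i pY] by linarith
    also have "\<dots> = - K * (p - y) + (c i p - c i y)" by (simp add: \<phi>_def \<open>h i = - K\<close> algebra_simps)
    also have "\<dots> \<le> - K * (p - y) + L * (p - y)"
      using lip[OF i pY yY] yp by auto
    finally have "(K - L) * (p - y) \<le> 0" using yp L by (simp add: algebra_simps)
    then show False using yp L by (simp add: mult_le_0_iff)
  qed
  have dsum: "(\<Sum>i\<in>I. d i) = 0"
    using mean sumY[of "\<lambda>y. y"] sumI[of x] unfolding d_def by (simp add: algebra_simps sum_subtractf)
  show ?thesis
  proof (rule ccontr)
    assume "\<not> ?thesis"
    then obtain j where j: "j \<in> I" "d j \<noteq> 0" by (auto simp: d_def)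
    have "\<exists>a\<in>I. 0 < d a"
    proof (rule ccontr)
      assume "\<not> (\<exists>a\<in>I. 0 < d a)"
      then have "\<forall>i\<in>I. d i = 0"
        using dsum sum_nonneg_eq_0_iff[OF fin(1), of "\<lambda>i. - d i"] by (auto simp: not_less sum_negf)
      then show False using j by blast
    qed
    then obtain a where a: "a \<in> I" "0 < d a" by blast
    define p where "p = Max {p. good p}"
    have fg: "finite {p. good p}" using fin(2) by (rule rev_finite_subset) (auto simp: good_def)
    obtain ya where ya: "ya \<in> \<Gamma> a" using \<Gamma>ne[OF a(1)] by blast
    have p: "good p" unfolding p_def using start[OF a ya] fg by (metis Max_in empty_iff mem_Collect_eq)
    have pmax: "q \<le> p" if "good q" for q unfolding p_def using fg that by simp
    \<comment> \<open>By maximality of \<open>p\<close> the contact set of each atom lies on one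
      side of \<open>p\<close>. If it lies to the left, \<open>max 0 (p - y)\<close> is linear on it
      and the sum is computed exactly, up to the drift, which \<open>stop\<close> shows to be
      nonnegative.\<close>
    have one: "(\<Sum>y\<in>Y. \<pi> i y * max 0 (p - y)) \<le> m i * max 0 (p - x i) - (if i = a then d a else 0)" if i: "i \<in> I" for i
    proof (cases "\<forall>y\<in>\<Gamma> i. p \<le> y")
      case True
      then have "(\<Sum>y\<in>Y. \<pi> i y * max 0 (p - y)) = 0" unfolding \<Gamma>sum[OF i] by (intro sum.neutral) auto
      moreover have "d a \<le> m i * max 0 (p - x i)" if "i = a"
      proof -
        \<comment> \<open>All contact points of \<open>a\<close> are good, hence at most
          \<open>p\<close>; here they are also at least \<open>p\<close>, so the atom sends all its
          mass to \<open>p\<close>.\<close>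
        have "\<forall>y\<in>\<Gamma> a. y = p" using True that pmax start[OF a] by (auto intro: antisym)
        then have "d a = (\<Sum>y\<in>\<Gamma> a. \<pi> a y * (p - x a))" unfolding d_def \<Gamma>sum[OF a(1)] by (intro sum.cong) auto
        also have "\<dots> = m a * (p - x a)"
          using \<Gamma>sum[OF a(1), of "\<lambda>_. 1"] row[OF a(1)] by (simp add: sum_distrib_right[symmetric])
        also have "\<dots> \<le> m a * max 0 (p - x a)" using m[OF a(1)] by (intro mult_left_mono) auto
        finally show ?thesis using that by simp
      qed
      ultimately show ?thesis using m[OF i] by auto
    next
      case False
      then obtain w where w: "w \<in> \<Gamma> i" "w < p" by (auto simp: not_le)
      have left: "\<forall>y\<in>\<Gamma> i. y \<le> p" using step[OF p i w] pmax by (meson not_le)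
      have di: "0 \<le> d i" using stop[OF p i _ w(1)] w(2) by linarith
      have "(\<Sum>y\<in>Y. \<pi> i y * max 0 (p - y)) = (\<Sum>y\<in>Y. \<pi> i y * (p - y))"
        unfolding \<Gamma>sum[OF i] using left by (intro sum.cong) auto
      also have "\<dots> = (\<Sum>y\<in>Y. \<pi> i y * (p - x i)) - d i"
        unfolding d_def by (simp add: sum_subtractf[symmetric] algebra_simps)
      also have "\<dots> = m i * (p - x i) - d i" using row[OF i] by (simp add: sum_distrib_right[symmetric])
      also have "\<dots> \<le> m i * max 0 (p - x i) - d i" using m[OF i] by (simp add: mult_left_mono)
      also have "\<dots> \<le> m i * max 0 (p - x i) - (if i = a then d a else 0)" using di by simp
      finally show ?thesis .
    qed
    have "(\<Sum>y\<in>Y. n y * max 0 (p - y)) \<le> (\<Sum>i\<in>I. m i * max 0 (p - x i) - (if i = a then d a else 0))"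
      unfolding sumY by (rule sum_mono) (rule one)
    also have "\<dots> = (\<Sum>i\<in>I. m i * max 0 (p - x i)) - d a"
      using fin(1) a(1) by (simp add: sum_subtractf)
    finally show False using put[of p] a(2) by linarith
  qed
qed

text \<open>For a martingale the penalty is zero, so the optimal value of the relaxed problem is the
  cost of an admissible coupling and its dual solution, with slopes bounded by \<open>K\<close>,
  serves the constrained problem.\<close>

lemma finite_martingale_duality:
  fixes m x :: "'i \<Rightarrow> real" and n :: "real \<Rightarrow> real"
  assumes fin: "finite I" "finite Y" and m: "\<And>i. i \<in> I \<Longrightarrow> 0 < m i" and n: "\<And>y. y \<in> Y \<Longrightarrow> 0 \<le> n y"
    and mass: "(\<Sum>i\<in>I. m i) = 1" "(\<Sum>y\<in>Y. n y) = 1"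
    and mean: "(\<Sum>i\<in>I. m i * x i) = (\<Sum>y\<in>Y. n y * y)"
    and put: "\<And>p. (\<Sum>i\<in>I. m i * max 0 (p - x i)) \<le> (\<Sum>y\<in>Y. n y * max 0 (p - y))"
    and conv: "\<And>i. i \<in> I \<Longrightarrow> convex_on S (c i)" and YS: "Y \<subseteq> S"
    and lip: "\<And>i y z. i \<in> I \<Longrightarrow> y \<in> Y \<Longrightarrow> z \<in> Y \<Longrightarrow> \<bar>c i y - c i z\<bar> \<le> L * \<bar>y - z\<bar>"
    and L: "0 \<le> L" "L < K"
  obtains \<pi> f h g where "weight_coupling I Y m n \<pi>"
    "\<And>i. i \<in> I \<Longrightarrow> (\<Sum>y\<in>Y. \<pi> i y * (y - x i)) = 0"
    "\<And>i y. i \<in> I \<Longrightarrow> y \<in> Y \<Longrightarrow> g y - f i - h i * (y - x i) \<le> c i y"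
    "\<And>i. i \<in> I \<Longrightarrow> \<bar>h i\<bar> \<le> K"
    "(\<Sum>i\<in>I. \<Sum>y\<in>Y. \<pi> i y * c i y) \<le> (\<Sum>y\<in>Y. n y * g y) - (\<Sum>i\<in>I. m i * f i)"
proof -
  obtain \<pi> where \<pi>: "weight_coupling I Y m n \<pi>"
    "\<And>\<pi>'. weight_coupling I Y m n \<pi>' \<Longrightarrow> penalised_cost I Y x c K \<pi> \<le> penalised_cost I Y x c K \<pi>'"
    by (rule penalised_primal[OF fin _ n mass, of x c K]) (auto dest: m)
  obtain f h g where d: "\<And>i y. i \<in> I \<Longrightarrow> y \<in> Y \<Longrightarrow> g y - f i - h i * (y - x i) \<le> c i y"
    "\<And>i. i \<in> I \<Longrightarrow> \<bar>h i\<bar> \<le> K"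
    "penalised_cost I Y x c K \<pi> \<le> (\<Sum>y\<in>Y. n y * g y) - (\<Sum>i\<in>I. m i * f i)"
    by (rule penalised_dual[OF fin _ \<pi>(2)]) (use L in auto)
  have mart: "\<forall>i\<in>I. (\<Sum>y\<in>Y. \<pi> i y * (y - x i)) = 0"
    by (rule penalised_optimal_martingale[OF fin m mean put conv YS lip L \<pi>(1) d])
  show thesis
    by (rule that[OF \<pi>(1) _ d(1,2)]) (use mart d(3) in \<open>auto simp: penalised_cost_def\<close>)
qed

subsection \<open>Concave envelopes with bounded slope\<close>

text \<open>\<open>C\<close> stands for the sum of the cost and \<open>u\<close>, extended from the
  interval to the plane, so that its Lipschitz bound carries no domain conditions. Convexity stays
  outside the locale, since it is known only for almost every \<open>x\<close> and only on the
  interval.\<close>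

locale lipschitz_cost =
  fixes C :: "real \<Rightarrow> real \<Rightarrow> real" and L K \<alpha> \<beta> :: real
  assumes \<alpha>\<beta>: "\<alpha> < \<beta>" and L0: "0 \<le> L" and LK: "L < K"
    and C_lip: "\<bar>C x y - C x' y'\<bar> \<le> L * (\<bar>x - x'\<bar> + \<bar>y - y'\<bar>)"
begin

lemma K0: "0 \<le> K" using L0 LK by simp

lemma continuous_C: "continuous_on UNIV (\<lambda>z. C (fst z) (snd z))"
proof (rule lipschitz_on_continuous_on)
  show "(2 * L)-lipschitz_on UNIV (\<lambda>z. C (fst z) (snd z))"
  proof (rule lipschitz_onI)
    fix z w :: "real \<times> real"
    have "dist (C (fst z) (snd z)) (C (fst w) (snd w)) \<le> L * (dist (fst z) (fst w) + dist (snd z) (snd w))"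
      using C_lip by (simp add: dist_real_def)
    also have "\<dots> \<le> L * (dist z w + dist z w)"
      using L0 by (intro mult_left_mono add_mono dist_fst_le dist_snd_le)
    finally show "dist (C (fst z) (snd z)) (C (fst w) (snd w)) \<le> 2 * L * dist z w" by simp
  qed (use L0 in simp)
qed

text \<open>Geometrically: the line of slope \<open>h\<close> through the point
  \<open>(x, t)\<close> lies above \<open>g - C x\<close> on the interval.\<close>

definition dual_slack :: "(real \<Rightarrow> real) \<Rightarrow> real \<Rightarrow> real \<Rightarrow> real \<Rightarrow> bool" where
  "dual_slack g x h t \<longleftrightarrow> (\<forall>y\<in>{\<alpha>..\<beta>}. g y - h * (y - x) - C x y \<le> t)"

text \<open>\<open>dual_f g x\<close> is the value at \<open>x\<close> of the concave envelope of \<open>g - C x\<close> on the interval, with supporting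
  slopes restricted to \<open>{-K..K}\<close>. Taking the least optimal slope makes \<open>dual_h g\<close> Borel measurable.\<close>
definition dual_f :: "(real \<Rightarrow> real) \<Rightarrow> real \<Rightarrow> real" where
  "dual_f g x = Inf {t. \<exists>h\<in>{-K..K}. dual_slack g x h t}"

definition dual_h :: "(real \<Rightarrow> real) \<Rightarrow> real \<Rightarrow> real" where
  "dual_h g x = Inf {h\<in>{-K..K}. dual_slack g x h (dual_f g x)}"

context
  fixes g :: "real \<Rightarrow> real" and M :: real
  assumes g_lip: "M-lipschitz_on {\<alpha>..\<beta>} g"
begin

lemma dual_f_bdd_below: "bdd_below {t. \<exists>h\<in>{-K..K}. dual_slack g x h t}"
proof (rule bdd_belowI)
  fix t assume "t \<in> {t. \<exists>h\<in>{-K..K}. dual_slack g x h t}"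
  then obtain h where h: "h \<in> {-K..K}" "dual_slack g x h t" by blast
  have "g \<alpha> - h * (\<alpha> - x) - C x \<alpha> \<le> t" using h(2) \<alpha>\<beta> by (auto simp: dual_slack_def)
  moreover have "h * (\<alpha> - x) \<le> K * \<bar>\<alpha> - x\<bar>"
  proof -
    have "h * (\<alpha> - x) \<le> \<bar>h\<bar> * \<bar>\<alpha> - x\<bar>" by (metis abs_ge_self abs_mult)
    also have "\<dots> \<le> K * \<bar>\<alpha> - x\<bar>" using h(1) by (intro mult_right_mono) auto
    finally show ?thesis .
  qed
  ultimately show "g \<alpha> - K * \<bar>\<alpha> - x\<bar> - C x \<alpha> \<le> t" by linarith
qed

lemma dual_f_le: "h \<in> {-K..K} \<Longrightarrow> dual_slack g x h t \<Longrightarrow> dual_f g x \<le> t"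
  unfolding dual_f_def by (rule cInf_lower[OF _ dual_f_bdd_below]) auto

lemma dual_f_nonempty: "{t. \<exists>h\<in>{-K..K}. dual_slack g x h t} \<noteq> {}"
proof -
  have "dual_slack g x 0 (g \<alpha> + M * (\<beta> - \<alpha>) - C x \<alpha> + L * (\<beta> - \<alpha>))"
    unfolding dual_slack_def
  proof
    fix y assume y: "y \<in> {\<alpha>..\<beta>}"
    have M0: "0 \<le> M" using g_lip by (rule lipschitz_on_nonneg)
    have "\<bar>g y - g \<alpha>\<bar> \<le> M * (y - \<alpha>)"
      using lipschitz_onD[OF g_lip, of y \<alpha>] y \<alpha>\<beta> by (auto simp: dist_real_def)
    moreover have "M * (y - \<alpha>) \<le> M * (\<beta> - \<alpha>)" using y M0 by (intro mult_left_mono) auto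
    moreover have "\<bar>C x y - C x \<alpha>\<bar> \<le> L * (y - \<alpha>)" using C_lip[of x y x \<alpha>] y by auto
    moreover have "L * (y - \<alpha>) \<le> L * (\<beta> - \<alpha>)" using y L0 by (intro mult_left_mono) auto
    ultimately show "g y - 0 * (y - x) - C x y \<le> g \<alpha> + M * (\<beta> - \<alpha>) - C x \<alpha> + L * (\<beta> - \<alpha>)" by linarith
  qed
  then show ?thesis using K0 by (auto intro!: exI bexI[of _ 0])
qed

lemma dual_f_attained: "\<exists>h\<in>{-K..K}. dual_slack g x h (dual_f g x)"
proof -
  have "\<exists>h\<in>{-K..K}. dual_slack g x h (dual_f g x + 1 / Suc n)" for n
  proof -
    obtain t where "\<exists>h\<in>{-K..K}. dual_slack g x h t" "t < dual_f g x + 1 / Suc n"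
      using cInf_lessD[OF dual_f_nonempty[of x], of "dual_f g x + 1 / Suc n"] by (auto simp: dual_f_def)
    then show ?thesis unfolding dual_slack_def by force
  qed
  then obtain hs where hs: "\<And>n. hs n \<in> {-K..K}" "\<And>n. dual_slack g x (hs n) (dual_f g x + 1 / Suc n)"
    by metis
  obtain h r where h: "h \<in> {-K..K}" "strict_mono (r :: nat \<Rightarrow> nat)" "(\<lambda>n. hs (r n)) \<longlonglongrightarrow> h"
    using compact_Icc[of "-K" K, unfolded compact_def] hs(1) by (metis (no_types, lifting) comp_def ext)
  have "dual_slack g x h (dual_f g x)"
    unfolding dual_slack_def
  proof
    fix y assume y: "y \<in> {\<alpha>..\<beta>}"
    have a: "(\<lambda>n. g y - hs (r n) * (y - x) - C x y) \<longlonglongrightarrow> g y - h * (y - x) - C x y"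
      by (intro tendsto_intros h)
    have b: "(\<lambda>n. dual_f g x + 1 / Suc (r n)) \<longlonglongrightarrow> dual_f g x + 0"
      using LIMSEQ_subseq_LIMSEQ[OF LIMSEQ_inverse_real_of_nat h(2)]
      by (intro tendsto_intros) (simp add: comp_def inverse_eq_divide)
    show "g y - h * (y - x) - C x y \<le> dual_f g x"
      using LIMSEQ_le[OF a b] hs(2) y by (auto simp: dual_slack_def)
  qed
  then show ?thesis using h(1) by blast
qed

lemma dual_slack_shift:
  assumes "h \<in> {-K..K}" "dual_slack g x h t"
  shows "dual_slack g x' h (t + (K + L) * \<bar>x' - x\<bar>)"
  unfolding dual_slack_def
proof
  fix y assume y: "y \<in> {\<alpha>..\<beta>}"
  have "h * (x' - x) \<le> K * \<bar>x' - x\<bar>"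
  proof -
    have "h * (x' - x) \<le> \<bar>h\<bar> * \<bar>x' - x\<bar>" by (metis abs_ge_self abs_mult)
    also have "\<dots> \<le> K * \<bar>x' - x\<bar>" using assms(1) by (intro mult_right_mono) auto
    finally show ?thesis .
  qed
  moreover have "\<bar>C x' y - C x y\<bar> \<le> L * \<bar>x' - x\<bar>" using C_lip[of x' y x y] by simp
  moreover have "g y - h * (y - x) - C x y \<le> t" using assms(2) y by (auto simp: dual_slack_def)
  ultimately show "g y - h * (y - x') - C x' y \<le> t + (K + L) * \<bar>x' - x\<bar>"
    by (simp add: algebra_simps)
qed

text \<open>A slope that is optimal at \<open>x\<close> is a competitor at \<open>x'\<close>, where
  the line moves by at most \<open>K\<close> and the cost by at most \<open>L\<close> per unit of
  distance. The constant does not depend on that of \<open>g\<close>.\<close>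

lemma dual_f_lipschitz: "(K + L)-lipschitz_on UNIV (dual_f g)"
proof -
  have "dual_f g x' \<le> dual_f g x + (K + L) * \<bar>x' - x\<bar>" for x x'
    using dual_f_attained[of x] dual_f_le dual_slack_shift by blast
  then have "\<bar>dual_f g x - dual_f g x'\<bar> \<le> (K + L) * \<bar>x - x'\<bar>" for x x'
    by (smt (verit, best) abs_minus_commute)
  then show ?thesis using K0 L0 by (intro lipschitz_onI) (auto simp: dist_real_def)
qed

lemma dual_slack_closed: "closed {(h, x). dual_slack g x h (dual_f g x)}"
proof -
  have "continuous_on UNIV (dual_f g)" using dual_f_lipschitz by (rule lipschitz_on_continuous_on)
  then have "continuous_on UNIV (\<lambda>p :: real \<times> real. dual_f g (snd p))"
    by (rule continuous_on_compose2) (auto intro: continuous_intros)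
  moreover have "continuous_on UNIV (\<lambda>p :: real \<times> real. C (snd p) y)" for y
    by (rule continuous_on_compose2[OF continuous_C, of UNIV "\<lambda>p. (snd p, y)", simplified]) (intro continuous_intros)
  ultimately have "closed {p. \<forall>y\<in>{\<alpha>..\<beta>}. g y - fst p * (y - snd p) - C (snd p) y \<le> dual_f g (snd p)}"
    unfolding Ball_def by (intro closed_Collect_all closed_Collect_imp closed_Collect_le open_Collect_const continuous_intros)
  then show ?thesis by (simp add: dual_slack_def split_def)
qed

lemma dual_h_least:
  "dual_h g x \<in> {-K..K}" "dual_slack g x (dual_h g x) (dual_f g x)"
  "h \<in> {-K..K} \<Longrightarrow> dual_slack g x h (dual_f g x) \<Longrightarrow> dual_h g x \<le> h"
proof -
  let ?S = "{h\<in>{-K..K}. dual_slack g x h (dual_f g x)}"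
  have "closed {h. dual_slack g x h (dual_f g x)}"
    unfolding dual_slack_def Ball_def by (intro closed_Collect_all closed_Collect_imp closed_Collect_le open_Collect_const continuous_intros)
  then have "closed ({-K..K} \<inter> {h. dual_slack g x h (dual_f g x)})" by (intro closed_Int closed_atLeastAtMost)
  then have cl: "closed ?S" by (simp add: Int_def)
  have bd: "bdd_below ?S" by (rule bdd_belowI[of _ "-K"]) auto
  have "dual_h g x \<in> ?S"
    unfolding dual_h_def using dual_f_attained[of x] by (intro closed_contains_Inf cl bd) auto
  then show "dual_h g x \<in> {-K..K}" "dual_slack g x (dual_h g x) (dual_f g x)" by auto
  show "dual_h g x \<le> h" if "h \<in> {-K..K}" "dual_slack g x h (dual_f g x)"
    unfolding dual_h_def using that by (intro cInf_lower bd) auto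
qed

text \<open>As \<open>dual_h g\<close> is the least optimal slope, a sublevel set consists of the
  \<open>x\<close> that have some optimal slope below \<open>t\<close>. It is the projection of a
  closed set along a compact interval, hence closed; the function is even lower
  semicontinuous.\<close>

lemma dual_h_measurable: "dual_h g \<in> borel_measurable borel"
proof (rule borel_measurableI_le)
  fix t
  have "{x. dual_h g x \<le> t} = {x. \<exists>h. h \<in> {-K..min K t} \<and> (h, x) \<in> {(h, x). dual_slack g x h (dual_f g x)}}"
    using dual_h_least by fastforce
  moreover have "closed \<dots>"
    by (rule closed_compact_projection[OF compact_Icc dual_slack_closed])
  ultimately have "closed {x. dual_h g x \<le> t}" by simp
  then show "{x \<in> space borel. dual_h g x \<le> t} \<in> sets borel" by simp
qed

end

text \<open>An optimal line for \<open>g'\<close>, raised by \<open>e\<close>, supports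
  \<open>g\<close>. The sign of \<open>e\<close> is free: positive values give stability under
  uniform limits, negative ones the exact effect of adding a constant.\<close>

lemma dual_f_mono:
  assumes "M-lipschitz_on {\<alpha>..\<beta>} g" "M'-lipschitz_on {\<alpha>..\<beta>} g'"
    and "\<And>y. y \<in> {\<alpha>..\<beta>} \<Longrightarrow> g y \<le> g' y + e"
  shows "dual_f g x \<le> dual_f g' x + e"
proof -
  obtain h where h: "h \<in> {-K..K}" "dual_slack g' x h (dual_f g' x)" using dual_f_attained[OF assms(2)] by blast
  then have "dual_slack g x h (dual_f g' x + e)" using assms(3) unfolding dual_slack_def by fastforce
  then show ?thesis using dual_f_le[OF assms(1) h(1)] by blast
qed

end

subsection \<open>Discretisation of the marginals\<close>

lemma interval_grid:
  fixes \<alpha> \<beta> \<delta> :: real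
  assumes "\<alpha> < \<beta>" "0 < \<delta>"
  obtains d :: real and N :: nat and k :: "real \<Rightarrow> nat"
  where "0 < d" "d \<le> \<delta>" "\<beta> = \<alpha> + real N * d" "k \<in> measurable borel (count_space UNIV)" "\<And>x. k x < N"
    "\<And>x. x \<in> {\<alpha>..\<beta>} \<Longrightarrow> \<alpha> + real (k x) * d \<le> x \<and> x \<le> \<alpha> + real (k x) * d + d"
proof -
  define N where "N = Suc (nat \<lceil>(\<beta> - \<alpha>) / \<delta>\<rceil>)"
  define d where "d = (\<beta> - \<alpha>) / real N"
  \<comment> \<open>The cap \<open>N - 1\<close> places the right end point, which would open a
    further cell, in the last one.\<close>
  define k where "k x = min (N - 1) (nat \<lfloor>(x - \<alpha>) / d\<rfloor>)" for x
  have "0 < real N" by (simp add: N_def)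
  then have d: "0 < d" using assms unfolding d_def by (intro divide_pos_pos) auto
  have \<beta>: "\<beta> = \<alpha> + real N * d" by (simp add: d_def N_def)
  have "(\<beta> - \<alpha>) / \<delta> \<le> real N" unfolding N_def by linarith
  then have "d \<le> \<delta>" using assms \<open>0 < real N\<close> by (simp add: d_def pos_divide_le_eq mult.commute)
  moreover have "k \<in> measurable borel (count_space UNIV)" unfolding k_def by measurable
  moreover have "k x < N" for x by (simp add: k_def N_def)
  moreover have "\<alpha> + real (k x) * d \<le> x \<and> x \<le> \<alpha> + real (k x) * d + d" if x: "x \<in> {\<alpha>..\<beta>}" for x
  proof -
    define q where "q = (x - \<alpha>) / d"
    have q0: "0 \<le> q" using x d by (simp add: q_def)
    have qN: "q \<le> real N" using x d \<beta> by (simp add: q_def field_simps)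
    have "real (k x) \<le> q \<and> q \<le> real (k x) + 1"
    proof (cases "nat \<lfloor>q\<rfloor> \<le> N - 1")
      case True
      then have "k x = nat \<lfloor>q\<rfloor>" by (simp add: k_def q_def)
      then show ?thesis using q0 by (simp add: less_imp_le)
    next
      case False
      then have "k x = N - 1" "real N \<le> real (nat \<lfloor>q\<rfloor>)" by (auto simp: k_def q_def)
      moreover have "real (nat \<lfloor>q\<rfloor>) \<le> q" using q0 by simp
      ultimately show ?thesis using qN by (simp add: N_def)
    qed
    then show ?thesis using d by (simp add: q_def field_simps)
  qed
  ultimately show thesis using that[OF d _ \<beta>] by blast
qed

lemma finite_measure_integrable_bounded_on:
  fixes f :: "'a :: topological_space \<Rightarrow> real"
  assumes "finite_measure M" "sets M = sets borel" "AE x in M. x \<in> S"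
    and "f \<in> borel_measurable borel" and "\<And>x. x \<in> S \<Longrightarrow> \<bar>f x\<bar> \<le> B"
  shows "integrable M f"
proof (rule finite_measure.integrable_const_bound[OF assms(1)])
  show "AE x in M. norm (f x) \<le> B" using assms(3) by eventually_elim (use assms(5) in auto)
  show "f \<in> borel_measurable M" using assms(2,4) by (simp cong: measurable_cong_sets)
qed

lemma lipschitz_bound_on_interval:
  fixes q :: "real \<Rightarrow> real"
  assumes q: "B-lipschitz_on UNIV q" and y: "y \<in> {\<alpha>..\<beta>}"
  shows "\<bar>q y\<bar> \<le> \<bar>q \<alpha>\<bar> + B * (\<beta> - \<alpha>)"
proof -
  have "\<bar>q y - q \<alpha>\<bar> \<le> B * (y - \<alpha>)" using lipschitz_onD[OF q, of y \<alpha>] y by (simp add: dist_real_def)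
  also have "\<dots> \<le> B * (\<beta> - \<alpha>)" using y lipschitz_on_nonneg[OF q] by (intro mult_left_mono) auto
  finally show ?thesis by linarith
qed

lemma integrable_lipschitz_on_interval:
  fixes q :: "real \<Rightarrow> real"
  assumes M: "prob_space M" "sets M = sets borel" "AE x in M. x \<in> {\<alpha>..\<beta>}"
    and q: "B-lipschitz_on UNIV q"
  shows "integrable M q"
  by (rule finite_measure_integrable_bounded_on[OF prob_space.finite_measure[OF M(1)] M(2,3)
        borel_measurable_continuous_onI[OF lipschitz_on_continuous_on[OF q]] lipschitz_bound_on_interval[OF q]])

text \<open>Each cell is collapsed to its barycentre \<open>x i\<close>: the mean is kept and, by
  Jensen, put values go down. The point \<open>t i\<close> of the same cell is chosen inside the
  almost sure set \<open>R\<close>, to which the barycentre may fail to belong. The final upper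
  estimate is one-sided because it can be applied to a function and to its negative.\<close>

lemma source_discretisation:
  fixes \<mu> :: "real measure" and k :: "real \<Rightarrow> nat" and d :: real
  assumes prob: "prob_space \<mu>" and sets: "sets \<mu> = sets borel"
    and supp: "AE x in \<mu>. x \<in> {\<alpha>..\<beta>}" and R: "AE x in \<mu>. R x"
    and k[measurable]: "k \<in> measurable borel (count_space UNIV)" "\<And>x. k x < N"
    and cell: "\<And>x. x \<in> {\<alpha>..\<beta>} \<Longrightarrow> \<alpha> + real (k x) * d \<le> x \<and> x \<le> \<alpha> + real (k x) * d + d"
  obtains I :: "nat set" and m x t :: "nat \<Rightarrow> real" and A :: "nat \<Rightarrow> real set"
  where "finite I" "\<And>i. i \<in> I \<Longrightarrow> 0 < m i" "(\<Sum>i\<in>I. m i) = 1"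
    "\<And>i. i \<in> I \<Longrightarrow> R (t i)" "\<And>i. i \<in> I \<Longrightarrow> x i \<in> {\<alpha>..\<beta>}"
    "(\<Sum>i\<in>I. m i * x i) = (\<integral>y. y \<partial>\<mu>)"
    "\<And>p. (\<Sum>i\<in>I. m i * max 0 (p - x i)) \<le> (\<integral>y. max 0 (p - y) \<partial>\<mu>)"
    "\<And>i y. i \<in> I \<Longrightarrow> y \<in> A i \<Longrightarrow> \<bar>y - t i\<bar> \<le> d \<and> \<bar>y - x i\<bar> \<le> d"
    "\<And>i. i \<in> I \<Longrightarrow> \<bar>t i - x i\<bar> \<le> d"
    "\<And>f v e. integrable \<mu> f \<Longrightarrow> \<forall>i\<in>I. \<forall>y\<in>A i. f y \<le> v i + e \<Longrightarrow>
       (\<integral>y. f y \<partial>\<mu>) \<le> (\<Sum>i\<in>I. m i * v i) + e"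
proof -
  interpret prob_space \<mu> by (rule prob)
  note sets[measurable_cong]
  define A where "A i = {y\<in>{\<alpha>..\<beta>}. k y = i}" for i
  have A[measurable]: "A i \<in> sets borel" for i unfolding A_def by measurable
  have spc: "space \<mu> = UNIV" using sets_eq_imp_space_eq[OF sets] by simp
  define m where "m i = measure \<mu> (A i)" for i
  \<comment> \<open>Null cells are dropped: their barycentre is meaningless and they may contain no
    point satisfying \<open>R\<close>.\<close>
  define I where "I = {i. i < N \<and> 0 < m i}"
  define x where "x i = (\<integral>y. indicator (A i) y * y \<partial>\<mu>) / m i" for i
  have fin: "finite I" by (auto simp: I_def)
  have int1: "(\<integral>y. indicator (A i) y * c \<partial>\<mu>) = m i * c" for i c
    by (simp add: m_def spc measure_def)
  have intA: "integrable \<mu> (\<lambda>y. indicator (A i) y * f y)" if "integrable \<mu> f" for i and f :: "real \<Rightarrow> real"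
    using integrable_mult_indicator[OF _ that, of "A i"] by (simp add: sets)
  have split: "(\<integral>y. f y \<partial>\<mu>) = (\<Sum>i\<in>I. \<integral>y. indicator (A i) y * f y \<partial>\<mu>)" if f: "integrable \<mu> f" for f :: "real \<Rightarrow> real"
  proof -
    have "(\<integral>y. f y \<partial>\<mu>) = (\<integral>y. (\<Sum>i<N. indicator (A i) y * f y) \<partial>\<mu>)"
    proof (rule integral_cong_AE)
      show "AE y in \<mu>. f y = (\<Sum>i<N. indicator (A i) y * f y)"
        using supp
      proof eventually_elim
        case (elim y)
        then have "(\<Sum>i<N. indicator (A i) y * f y) = (\<Sum>i<N. if k y = i then f y else 0)"
          by (intro sum.cong) (auto simp: A_def indicator_def)
        then show ?case using k(2)[of y] by simp
      qed
    qed (use f in auto)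
    also have "\<dots> = (\<Sum>i<N. \<integral>y. indicator (A i) y * f y \<partial>\<mu>)"
      by (rule Bochner_Integration.integral_sum) (rule intA[OF f])
    also have "\<dots> = (\<Sum>i\<in>I. \<integral>y. indicator (A i) y * f y \<partial>\<mu>)"
    proof (rule sum.mono_neutral_right)
      show "\<forall>i\<in>{..<N} - I. (\<integral>y. indicator (A i) y * f y \<partial>\<mu>) = 0"
      proof
        fix i assume "i \<in> {..<N} - I"
        then have "measure \<mu> (A i) = 0" using measure_nonneg[of \<mu> "A i"] by (auto simp: I_def m_def not_less intro: antisym)
        then have "A i \<in> null_sets \<mu>" by (simp add: null_sets_def emeasure_eq_measure sets)
        then have "AE y in \<mu>. y \<notin> A i" by (rule AE_not_in)
        then have "AE y in \<mu>. indicator (A i) y * f y = 0" by eventually_elim simp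
        then show "(\<integral>y. indicator (A i) y * f y \<partial>\<mu>) = 0" by (rule integral_eq_zero_AE)
      qed
    qed (auto simp: I_def)
    finally show ?thesis .
  qed
  have id: "integrable \<mu> (\<lambda>y. y)"
    by (rule finite_measure_integrable_bounded_on[OF _ sets supp, of _ "max \<bar>\<alpha>\<bar> \<bar>\<beta>\<bar>"]) (auto, unfold_locales)
  have put_int: "integrable \<mu> (\<lambda>y. max 0 (p - y))" for p
    using id by auto
  have mx: "m i * x i = (\<integral>y. indicator (A i) y * y \<partial>\<mu>)" if "i \<in> I" for i
    using that by (simp add: x_def I_def)
  have xcell: "\<alpha> + real i * d \<le> x i \<and> x i \<le> \<alpha> + real i * d + d \<and> x i \<in> {\<alpha>..\<beta>}" if i: "i \<in> I" for i
  proof -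
    have mi: "0 < m i" using i by (simp add: I_def)
    have lo: "c \<le> x i" if "\<And>y. y \<in> A i \<Longrightarrow> c \<le> y" for c
    proof -
      have "(\<integral>y. indicator (A i) y * c \<partial>\<mu>) \<le> (\<integral>y. indicator (A i) y * y \<partial>\<mu>)"
        by (rule integral_mono[OF intA intA[OF id]]) (use that in \<open>auto simp: indicator_def\<close>)
      then show ?thesis using mi unfolding int1 mx[OF i, symmetric] by simp
    qed
    have hi: "x i \<le> c" if "\<And>y. y \<in> A i \<Longrightarrow> y \<le> c" for c
    proof -
      have "(\<integral>y. indicator (A i) y * y \<partial>\<mu>) \<le> (\<integral>y. indicator (A i) y * c \<partial>\<mu>)"
        by (rule integral_mono[OF intA[OF id] intA]) (use that in \<open>auto simp: indicator_def\<close>)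
      then show ?thesis using mi unfolding int1 mx[OF i, symmetric] by simp
    qed
    have "\<alpha> \<le> x i" by (rule lo) (simp add: A_def)
    moreover have "x i \<le> \<beta>" by (rule hi) (simp add: A_def)
    moreover have "\<alpha> + real i * d \<le> x i" by (rule lo) (use cell in \<open>auto simp: A_def\<close>)
    moreover have "x i \<le> \<alpha> + real i * d + d" by (rule hi) (use cell in \<open>auto simp: A_def\<close>)
    ultimately show ?thesis by auto
  qed
  have "\<exists>t. t \<in> A i \<and> R t" if i: "i \<in> I" for i
  proof (rule ccontr)
    assume "\<nexists>t. t \<in> A i \<and> R t"
    then have "AE y in \<mu>. y \<notin> A i" using R by (auto elim: eventually_mono)
    then have "measure \<mu> (A i) = 0" by (subst (asm) AE_iff_measurable[of "A i"]) (auto simp: sets spc measure_def)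
    then show False using i by (simp add: I_def m_def)
  qed
  then obtain t where t: "\<And>i. i \<in> I \<Longrightarrow> t i \<in> A i \<and> R (t i)" by metis
  show thesis
  proof (rule that[of I m t x A])
    show "0 < m i" if "i \<in> I" for i using that by (simp add: I_def)
    show "(\<Sum>i\<in>I. m i) = 1" using split[of "\<lambda>_. 1"] int1[of _ 1] by (simp add: prob_space)
    show "R (t i)" if "i \<in> I" for i using t[OF that] by blast
    show "x i \<in> {\<alpha>..\<beta>}" if "i \<in> I" for i using xcell[OF that] by blast
    show "(\<Sum>i\<in>I. m i * x i) = (\<integral>y. y \<partial>\<mu>)" using split[OF id] mx by simp
    show "(\<Sum>i\<in>I. m i * max 0 (p - x i)) \<le> (\<integral>y. max 0 (p - y) \<partial>\<mu>)" for p
      unfolding split[OF put_int]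
    proof (rule sum_mono)
      fix i assume i: "i \<in> I"
      have "m i * (p - x i) = (\<integral>y. indicator (A i) y * (p - y) \<partial>\<mu>)"
        using Bochner_Integration.integral_diff[OF intA[of "\<lambda>_. p" i] intA[OF id, of i]] mx[OF i]
        by (simp add: right_diff_distrib m_def)
      also have "\<dots> \<le> (\<integral>y. indicator (A i) y * max 0 (p - y) \<partial>\<mu>)"
        using id by (intro integral_mono intA put_int) (auto simp: indicator_def)
      finally have "m i * (p - x i) \<le> (\<integral>y. indicator (A i) y * max 0 (p - y) \<partial>\<mu>)" .
      moreover have "0 \<le> (\<integral>y. indicator (A i) y * max 0 (p - y) \<partial>\<mu>)"
        by (rule integral_nonneg_AE) auto
      ultimately show "m i * max 0 (p - x i) \<le> (\<integral>y. indicator (A i) y * max 0 (p - y) \<partial>\<mu>)"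
        by (simp add: max_def)
    qed
    show "\<bar>y - t i\<bar> \<le> d \<and> \<bar>y - x i\<bar> \<le> d" if "i \<in> I" "y \<in> A i" for i y
      using cell[of y] cell[of "t i"] t[OF that(1)] that(2) xcell[OF that(1)] by (auto simp: A_def abs_le_iff)
    show "\<bar>t i - x i\<bar> \<le> d" if "i \<in> I" for i
      using cell[of "t i"] t[OF that(1)] xcell[OF that(1)] by (auto simp: A_def abs_le_iff)
    show "(\<integral>y. f y \<partial>\<mu>) \<le> (\<Sum>i\<in>I. m i * v i) + e"
      if f: "integrable \<mu> f" and le: "\<forall>i\<in>I. \<forall>y\<in>A i. f y \<le> v i + e" for f v e
    proof -
      have "(\<integral>y. f y \<partial>\<mu>) \<le> (\<Sum>i\<in>I. m i * (v i + e))"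
        unfolding split[OF f] int1[symmetric]
      proof (rule sum_mono)
        fix i assume i: "i \<in> I"
        show "(\<integral>y. indicator (A i) y * f y \<partial>\<mu>) \<le> (\<integral>y. indicator (A i) y * (v i + e) \<partial>\<mu>)"
          by (rule integral_mono[OF intA[OF f] intA]) (use le i in \<open>auto simp: indicator_def\<close>)
      qed
      also have "\<dots> = (\<Sum>i\<in>I. m i * v i) + e"
        using split[of "\<lambda>_. 1"] int1[of _ 1] by (simp add: prob_space distrib_left sum.distrib sum_distrib_right[symmetric])
      finally show ?thesis .
    qed
  qed (rule fin)
qed

text \<open>The mass at \<open>y\<close> is split between the two ends of its cell in the proportion
  that has barycentre \<open>y\<close>. This keeps the mean and, by convexity, raises put values,
  the direction opposite to that for the source.\<close>

lemma target_discretisation: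
  fixes \<nu> :: "real measure" and k :: "real \<Rightarrow> nat" and d :: real
  assumes prob: "prob_space \<nu>" and sets: "sets \<nu> = sets borel"
    and supp: "AE x in \<nu>. x \<in> {\<alpha>..\<beta>}" and d: "0 < d" and N: "\<beta> = \<alpha> + real N * d"
    and k[measurable]: "k \<in> measurable borel (count_space UNIV)" "\<And>x. k x < N"
    and cell: "\<And>x. x \<in> {\<alpha>..\<beta>} \<Longrightarrow> \<alpha> + real (k x) * d \<le> x \<and> x \<le> \<alpha> + real (k x) * d + d"
  obtains Y :: "real set" and n :: "real \<Rightarrow> real"
  where "finite Y" "Y \<subseteq> {\<alpha>..\<beta>}" "\<And>z. z \<in> Y \<Longrightarrow> 0 \<le> n z" "(\<Sum>z\<in>Y. n z) = 1"
    "(\<Sum>z\<in>Y. n z * z) = (\<integral>y. y \<partial>\<nu>)"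
    "\<And>p. (\<integral>y. max 0 (p - y) \<partial>\<nu>) \<le> (\<Sum>z\<in>Y. n z * max 0 (p - z))"
    "\<And>f B. B-lipschitz_on {\<alpha>..\<beta>} f \<Longrightarrow> integrable \<nu> f \<Longrightarrow> \<bar>(\<Sum>z\<in>Y. n z * f z) - (\<integral>y. f y \<partial>\<nu>)\<bar> \<le> B * d"
proof -
  interpret prob_space \<nu> by (rule prob)
  note sets[measurable_cong]
  define lo where "lo y = \<alpha> + real (k y) * d" for y
  \<comment> \<open>The share of the mass at \<open>y\<close> that moves to the right end. The
    truncation keeps it in the unit interval also at points outside the support, so that all bounds
    hold everywhere.\<close>
  define \<theta> where "\<theta> y = max 0 (min 1 ((y - lo y) / d))" for y
  define Y where "Y = (\<lambda>j. \<alpha> + real j * d) ` {..N}"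
  define w where "w z y = (1 - \<theta> y) * indicator {z} (lo y) + \<theta> y * indicator {z} (lo y + d)" for z y
  define n where "n z = (\<integral>y. w z y \<partial>\<nu>)" for z
  have [measurable]: "lo \<in> borel_measurable borel" unfolding lo_def by measurable
  have [measurable]: "\<theta> \<in> borel_measurable borel" unfolding \<theta>_def by measurable
  have [measurable]: "w z \<in> borel_measurable borel" for z unfolding w_def by measurable
  have \<theta>01: "0 \<le> \<theta> y" "\<theta> y \<le> 1" for y by (auto simp: \<theta>_def)
  have w0: "0 \<le> w z y" for z y using \<theta>01[of y] by (simp add: w_def)
  have w1: "w z y \<le> 1" for z y using \<theta>01[of y] d by (auto simp: w_def indicator_def)
  have wint: "integrable \<nu> (\<lambda>y. w z y * c)" for z c
    by (rule integrable_const_bound[of _ "\<bar>c\<bar>"]) (use w0 w1 in \<open>auto simp: abs_mult intro!: AE_I2 mult_left_le_one_le\<close>)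
  have fin: "finite Y" by (simp add: Y_def)
  have loY: "lo y \<in> Y" for y using k(2)[of y] by (auto simp: lo_def Y_def)
  have hiY: "lo y + d \<in> Y" for y
    unfolding lo_def Y_def using k(2)[of y] by (intro image_eqI[of _ _ "Suc (k y)"]) (auto simp: algebra_simps)
  have YJ: "Y \<subseteq> {\<alpha>..\<beta>}" using d by (auto simp: Y_def N mult_right_mono)
  have wsum: "(\<Sum>z\<in>Y. w z y * F z) = (1 - \<theta> y) * F (lo y) + \<theta> y * F (lo y + d)" for y and F :: "real \<Rightarrow> real"
  proof -
    have "(\<Sum>z\<in>Y. w z y * F z) = (\<Sum>z\<in>Y. (if lo y = z then (1 - \<theta> y) * F z else 0) + (if lo y + d = z then \<theta> y * F z else 0))"
      using d by (intro sum.cong) (auto simp: w_def indicator_def)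
    then show ?thesis using fin loY[of y] hiY[of y] by (simp only: sum.distrib sum.delta' if_True)
  qed
  have nsum: "(\<Sum>z\<in>Y. n z * F z) = (\<integral>y. (1 - \<theta> y) * F (lo y) + \<theta> y * F (lo y + d) \<partial>\<nu>)" for F :: "real \<Rightarrow> real"
    using wint by (simp add: n_def wsum[symmetric] Bochner_Integration.integral_sum)
  have rint: "integrable \<nu> (\<lambda>y. (1 - \<theta> y) * F (lo y) + \<theta> y * F (lo y + d))" for F :: "real \<Rightarrow> real"
    unfolding wsum[symmetric] by (intro Bochner_Integration.integrable_sum wint)
  have bary: "(1 - \<theta> y) * lo y + \<theta> y * (lo y + d) = y" if y: "y \<in> {\<alpha>..\<beta>}" for y
  proof -
    have "\<theta> y = (y - lo y) / d" using cell[OF y] d by (simp add: \<theta>_def lo_def)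
    then have "\<theta> y * d = y - lo y" using d by simp
    then show ?thesis by (simp add: algebra_simps)
  qed
  have lohi: "lo y \<in> {\<alpha>..\<beta>}" "lo y + d \<in> {\<alpha>..\<beta>}" for y using loY hiY YJ by blast+
  have id: "integrable \<nu> (\<lambda>y. y)"
    by (rule finite_measure_integrable_bounded_on[OF _ sets supp, of _ "max \<bar>\<alpha>\<bar> \<bar>\<beta>\<bar>"]) (auto, unfold_locales)
  show thesis
  proof (rule that[OF fin YJ])
    show "0 \<le> n z" for z unfolding n_def by (rule integral_nonneg_AE) (simp add: w0)
    show "(\<Sum>z\<in>Y. n z) = 1" using nsum[of "\<lambda>_. 1"] by (simp add: prob_space)
    show "(\<Sum>z\<in>Y. n z * z) = (\<integral>y. y \<partial>\<nu>)"
    proof -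
      have "AE y in \<nu>. (1 - \<theta> y) * lo y + \<theta> y * (lo y + d) = y"
        using supp by eventually_elim (rule bary)
      then show ?thesis unfolding nsum by (intro integral_cong_AE) auto
    qed
    show "(\<integral>y. max 0 (p - y) \<partial>\<nu>) \<le> (\<Sum>z\<in>Y. n z * max 0 (p - z))" for p
      unfolding nsum
    proof (rule integral_mono_AE)
      show "integrable \<nu> (\<lambda>y. max 0 (p - y))" using id by auto
      show "AE y in \<nu>. max 0 (p - y) \<le> (1 - \<theta> y) * max 0 (p - lo y) + \<theta> y * max 0 (p - (lo y + d))"
        using supp
      proof eventually_elim
        case (elim y)
        have "p - y = (1 - \<theta> y) * (p - lo y) + \<theta> y * (p - (lo y + d))"
          using bary[OF elim] by (simp add: algebra_simps)
        also have "\<dots> \<le> (1 - \<theta> y) * max 0 (p - lo y) + \<theta> y * max 0 (p - (lo y + d))"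
          using \<theta>01[of y] by (intro add_mono mult_left_mono) auto
        finally have "p - y \<le> \<dots>" .
        moreover have "0 \<le> (1 - \<theta> y) * max 0 (p - lo y) + \<theta> y * max 0 (p - (lo y + d))"
          using \<theta>01[of y] by simp
        ultimately show ?case by simp
      qed
    qed (rule rint)
    show "\<bar>(\<Sum>z\<in>Y. n z * f z) - (\<integral>y. f y \<partial>\<nu>)\<bar> \<le> B * d"
      if f: "B-lipschitz_on {\<alpha>..\<beta>} f" and fi: "integrable \<nu> f" for f B
    proof -
      let ?D = "\<lambda>y. ((1 - \<theta> y) * f (lo y) + \<theta> y * f (lo y + d)) - f y"
      have "\<bar>(\<Sum>z\<in>Y. n z * f z) - (\<integral>y. f y \<partial>\<nu>)\<bar> = \<bar>\<integral>y. ?D y \<partial>\<nu>\<bar>"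
        unfolding nsum using rint[of f] fi by simp
      also have "\<dots> \<le> (\<integral>y. \<bar>?D y\<bar> \<partial>\<nu>)" by (rule integral_abs_bound)
      also have "\<dots> \<le> (\<integral>y. B * d \<partial>\<nu>)"
      proof (rule integral_mono_AE)
        show "AE y in \<nu>. \<bar>?D y\<bar> \<le> B * d"
          using supp
        proof eventually_elim
          case (elim y)
          have B: "0 \<le> B" using f by (rule lipschitz_on_nonneg)
          have c: "\<bar>f z - f y\<bar> \<le> B * d" if "z \<in> {\<alpha>..\<beta>}" "\<bar>z - y\<bar> \<le> d" for z
            using lipschitz_onD[OF f that(1) elim] mult_left_mono[OF that(2) B] by (simp add: dist_real_def)
          have "?D y = (1 - \<theta> y) * (f (lo y) - f y) + \<theta> y * (f (lo y + d) - f y)" by (simp add: algebra_simps)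
          then have "\<bar>?D y\<bar> \<le> (1 - \<theta> y) * \<bar>f (lo y) - f y\<bar> + \<theta> y * \<bar>f (lo y + d) - f y\<bar>"
            using \<theta>01[of y] abs_triangle_ineq[of "(1 - \<theta> y) * (f (lo y) - f y)" "\<theta> y * (f (lo y + d) - f y)"]
            by (simp add: abs_mult)
          also have "\<dots> \<le> (1 - \<theta> y) * (B * d) + \<theta> y * (B * d)"
            using \<theta>01[of y] lohi[of y] cell[OF elim] d
            by (intro add_mono mult_left_mono c) (auto simp: lo_def)
          finally show ?case by (simp add: algebra_simps)
        qed
      qed (use rint[of f] fi in auto)
      finally show ?thesis by (simp add: prob_space)
    qed
  qed
qed

subsection \<open>Weak compactness of measures on a square\<close>

text \<open>Schoenberg's space-filling curve. On \<open>[0, 1/3]\<close> the function \<open>tooth\<close> is \<open>0\<close> and on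
  \<open>[2/3, 1]\<close> it is \<open>1\<close>, so that \<open>tooth (3 ^ k * t)\<close> reads off a ternary digit \<open>0\<close> or \<open>2\<close> of \<open>t\<close>.\<close>

definition tooth :: "real \<Rightarrow> real" where
  "tooth t = max 0 (min 1 (1 / 2 - cos (pi * t)))"

text \<open>The parity \<open>e\<close> selects the coordinate: ternary digits in even or in odd
  positions are read as the binary digits of the result.\<close>

definition schoenberg :: "nat \<Rightarrow> real \<Rightarrow> real" where
  "schoenberg e t = (\<Sum>k. tooth (3 ^ (2 * k + e) * t) / 2 ^ Suc k)"

definition cantor_code :: "(nat \<Rightarrow> real) \<Rightarrow> real" where
  "cantor_code d = (\<Sum>k. 2 * d k / 3 ^ Suc k)"

definition binary_digit :: "nat \<Rightarrow> real \<Rightarrow> real" where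
  "binary_digit k x = of_int (\<lfloor>2 ^ Suc k * x\<rfloor> mod 2)"

definition interleave :: "real \<Rightarrow> real \<Rightarrow> nat \<Rightarrow> real" where
  "interleave x y k = binary_digit (k div 2) (if even k then x else y)"

lemma tooth_bounds: "0 \<le> tooth t" "tooth t \<le> 1"
  by (auto simp: tooth_def)

lemma tooth_periodic: "tooth (2 * of_int N + t) = tooth t"
proof -
  have "cos (pi * (2 * of_int N + t)) = cos (2 * pi * of_int N + pi * t)"
    by (simp add: algebra_simps)
  also have "\<dots> = cos (pi * t)"
    by (simp add: cos_add)
  finally show ?thesis by (simp add: tooth_def)
qed

lemma tooth_0: "0 \<le> t \<Longrightarrow> t \<le> 1 / 3 \<Longrightarrow> tooth t = 0"
  using cos_monotone_0_pi_le[of "pi * t" "pi / 3"] by (simp add: tooth_def cos_60)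

lemma tooth_1: "2 / 3 \<le> t \<Longrightarrow> t \<le> 1 \<Longrightarrow> tooth t = 1"
proof -
  assume t: "2 / 3 \<le> t" "t \<le> 1"
  have "cos (2 * pi / 3) = - cos (pi / 3)"
    using cos_pi_minus[of "pi / 3"] by (simp add: field_simps)
  then show ?thesis
    using cos_monotone_0_pi_le[of "2 * pi / 3" "pi * t"] t by (simp add: tooth_def cos_60 field_simps)
qed

lemma half_series: "(\<lambda>k. 1 / 2 ^ Suc k :: real) sums 1"
  using power_half_series by (simp add: power_one_over)

lemma third_series: "(\<lambda>k. 2 / 3 ^ Suc k :: real) sums 1"
  using sums_mult[OF geometric_sums[of "1 / 3 :: real"], of "2 / 3"] by (simp add: power_one_over field_simps)

lemma continuous_schoenberg: "continuous_on UNIV (schoenberg e)"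
proof -
  have "uniform_limit UNIV (\<lambda>n t. \<Sum>k<n. tooth (3 ^ (2 * k + e) * t) / 2 ^ Suc k)
      (\<lambda>t. \<Sum>k. tooth (3 ^ (2 * k + e) * t) / 2 ^ Suc k) sequentially"
  proof (rule Weierstrass_m_test)
    show "summable (\<lambda>k. 1 / 2 ^ Suc k :: real)"
      by (rule sums_summable[OF half_series])
    show "norm (tooth (3 ^ (2 * k + e) * t) / 2 ^ Suc k) \<le> 1 / 2 ^ Suc k" for k t
      using tooth_bounds by (auto simp: divide_right_mono)
  qed
  then show ?thesis
    unfolding schoenberg_def
    by (rule uniform_limit_theorem[rotated])
      (auto simp: tooth_def intro!: always_eventually continuous_intros)
qed

lemma cantor_summable:
  fixes d :: "nat \<Rightarrow> real"
  assumes "\<And>k. 0 \<le> d k \<and> d k \<le> 1"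
  shows "summable (\<lambda>k. 2 * d k / 3 ^ Suc k)"
  by (rule summable_comparison_test'[of "\<lambda>k. 2 / 3 ^ Suc k" 0])
    (use assms sums_summable[OF third_series] in \<open>auto simp: divide_right_mono\<close>)

lemma cantor_code_bounds:
  assumes "\<And>k. 0 \<le> d k \<and> d k \<le> 1"
  shows "0 \<le> cantor_code d" "cantor_code d \<le> 1"
proof -
  show "0 \<le> cantor_code d"
    unfolding cantor_code_def by (rule suminf_nonneg[OF cantor_summable[OF assms]]) (use assms in auto)
  have "cantor_code d \<le> (\<Sum>k. 2 / 3 ^ Suc k)"
    unfolding cantor_code_def
    by (rule suminf_le[OF _ cantor_summable[OF assms] sums_summable[OF third_series]]) (use assms in \<open>auto simp: divide_right_mono\<close>)
  then show "cantor_code d \<le> 1" using sums_unique[OF third_series] by simp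
qed

lemma cantor_code_shift:
  assumes "\<And>k. 0 \<le> d k \<and> d k \<le> 1"
  shows "3 * cantor_code d = 2 * d 0 + cantor_code (\<lambda>k. d (Suc k))"
proof -
  have "cantor_code d = (\<Sum>k. 2 * d (Suc k) / 3 ^ Suc (Suc k)) + 2 * d 0 / 3"
    unfolding cantor_code_def using suminf_split_head[OF cantor_summable[of d]] assms by simp
  moreover have "(\<Sum>k. 2 * d (Suc k) / 3 ^ Suc (Suc k)) = (\<Sum>k. (2 * d (Suc k) / 3 ^ Suc k) / 3)"
    by (simp add: field_simps)
  moreover have "\<dots> = cantor_code (\<lambda>k. d (Suc k)) / 3"
    unfolding cantor_code_def by (rule suminf_divide) (rule cantor_summable, use assms in auto)
  ultimately show ?thesis by simp
qed

text \<open>Multiplying by \<open>3 ^ k\<close> removes the first \<open>k\<close> digits up to an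
  even integer, because the ternary digits are \<open>0\<close> or \<open>2\<close>, and
  \<open>tooth\<close> has period 2. What remains lies in the first or the last third according to
  its leading digit.\<close>

lemma tooth_cantor_code:
  assumes "\<And>k. d k \<in> {0, 1}"
  shows "tooth (3 ^ k * cantor_code d) = d k"
proof -
  have b: "0 \<le> d k \<and> d k \<le> 1" for k using assms[of k] by auto
  have "\<exists>N::int. 3 ^ k * cantor_code d = 2 * of_int N + cantor_code (\<lambda>j. d (k + j))"
  proof (induction k)
    case 0
    show ?case by (rule exI[of _ 0]) simp
  next
    case (Suc k)
    then obtain N :: int where "3 ^ k * cantor_code d = 2 * of_int N + cantor_code (\<lambda>j. d (k + j))" by blast
    moreover have "3 * cantor_code (\<lambda>j. d (k + j)) = 2 * d k + cantor_code (\<lambda>j. d (Suc k + j))"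
      using cantor_code_shift[of "\<lambda>j. d (k + j)"] b by simp
    moreover obtain M :: int where "d k = of_int M" using assms[of k] by (metis insert_iff of_int_0 of_int_1 singletonD)
    ultimately show ?case by (intro exI[of _ "3 * N + M"]) simp
  qed
  then obtain N :: int where N: "3 ^ k * cantor_code d = 2 * of_int N + cantor_code (\<lambda>j. d (k + j))" by blast
  define r where "r = cantor_code (\<lambda>j. d (Suc k + j)) / 3"
  have r: "0 \<le> r" "r \<le> 1 / 3"
    using cantor_code_bounds[of "\<lambda>j. d (Suc k + j)"] b by (auto simp: r_def)
  have "cantor_code (\<lambda>j. d (k + j)) = 2 * d k / 3 + r"
    using cantor_code_shift[of "\<lambda>j. d (k + j)"] b by (simp add: r_def)
  then have "tooth (3 ^ k * cantor_code d) = tooth (2 * d k / 3 + r)"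
    using N tooth_periodic by metis
  also have "\<dots> = d k"
    using assms[of k] r tooth_0[of r] tooth_1[of "2 / 3 + r"] by auto
  finally show ?thesis .
qed

lemma binary_digit_01: "binary_digit k x \<in> {0, 1}"
  unfolding binary_digit_def by (cases "even \<lfloor>2 ^ Suc k * x\<rfloor>") (auto simp: even_iff_mod_2_eq_zero odd_iff_mod_2_eq_one)

text \<open>The partial sum of length \<open>m\<close> is \<open>x\<close> rounded down to a
  multiple of \<open>1 / 2 ^ m\<close>. The bound \<open>x < 1\<close> makes the integer part vanish
  at the start.\<close>

lemma binary_expansion:
  assumes "0 \<le> x" "x < 1"
  shows "(\<lambda>k. binary_digit k x / 2 ^ Suc k) sums x"
proof -
  have fl: "\<lfloor>2 ^ Suc m * x\<rfloor> = 2 * \<lfloor>2 ^ m * x\<rfloor> + \<lfloor>2 ^ Suc m * x\<rfloor> mod 2" for m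
  proof -
    have "\<lfloor>2 ^ Suc m * x\<rfloor> div 2 = \<lfloor>2 ^ m * x\<rfloor>"
      using floor_divide_real_eq_div[of 2 "2 ^ Suc m * x"] by simp
    then show ?thesis by presburger
  qed
  have ps: "(\<Sum>k<m. binary_digit k x / 2 ^ Suc k) = of_int \<lfloor>2 ^ m * x\<rfloor> / 2 ^ m" for m
  proof (induction m)
    case 0
    then show ?case using assms by (simp add: floor_eq_iff)
  next
    case (Suc m)
    have "(of_int \<lfloor>2 ^ Suc m * x\<rfloor> :: real) = 2 * of_int \<lfloor>2 ^ m * x\<rfloor> + binary_digit m x"
      unfolding binary_digit_def by (subst fl) simp
    then show ?case using Suc by (simp add: field_simps)
  qed
  have "(\<lambda>m. of_int \<lfloor>2 ^ m * x\<rfloor> / 2 ^ m) \<longlonglongrightarrow> x"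
  proof (rule tendsto_sandwich)
    show "(\<lambda>m. x - (1 / 2) ^ m) \<longlonglongrightarrow> x"
      by (rule tendsto_eq_intros LIMSEQ_realpow_zero refl | simp)+
    show "\<forall>\<^sub>F m in sequentially. x - (1 / 2) ^ m \<le> of_int \<lfloor>2 ^ m * x\<rfloor> / 2 ^ m"
    proof (intro always_eventually allI)
      fix m
      have "2 ^ m * x - 1 \<le> of_int \<lfloor>2 ^ m * x\<rfloor>" by linarith
      then have "(2 ^ m * x - 1) / 2 ^ m \<le> of_int \<lfloor>2 ^ m * x\<rfloor> / 2 ^ m" by (rule divide_right_mono) simp
      then show "x - (1 / 2) ^ m \<le> of_int \<lfloor>2 ^ m * x\<rfloor> / 2 ^ m" by (simp add: diff_divide_distrib power_one_over)
    qed
    show "\<forall>\<^sub>F m in sequentially. of_int \<lfloor>2 ^ m * x\<rfloor> / 2 ^ m \<le> x"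
      by (rule always_eventually) (auto simp: field_simps)
  qed simp
  then show ?thesis unfolding sums_def ps .
qed

lemma schoenberg_cantor_code:
  assumes "0 \<le> x" "x < 1" "0 \<le> y" "y < 1"
  shows "schoenberg 0 (cantor_code (interleave x y)) = x"
    and "schoenberg 1 (cantor_code (interleave x y)) = y"
proof -
  have "tooth (3 ^ k * cantor_code (interleave x y)) = interleave x y k" for k
    by (rule tooth_cantor_code) (auto simp only: interleave_def binary_digit_01)
  then show "schoenberg 0 (cantor_code (interleave x y)) = x" "schoenberg 1 (cantor_code (interleave x y)) = y"
    using binary_expansion[OF assms(1,2)] binary_expansion[OF assms(3,4)]
    unfolding schoenberg_def by (simp_all add: interleave_def sums_iff del: power_Suc)
qed

lemma measurable_cantor_code:
  assumes [measurable]: "u \<in> borel_measurable M" "v \<in> borel_measurable M"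
  shows "(\<lambda>z. cantor_code (interleave (u z) (v z))) \<in> borel_measurable M"
proof -
  have [measurable]: "binary_digit k \<in> borel_measurable borel" for k
    unfolding binary_digit_def by measurable
  have "(\<lambda>z. 2 * interleave (u z) (v z) k / 3 ^ Suc k) \<in> borel_measurable M" for k
    unfolding interleave_def by (cases "even k"; simp)
  then show ?thesis unfolding cantor_code_def by (rule borel_measurable_suminf)
qed

text \<open>Reduction to tightness on the line. The measures are moved to the line by the Borel map
  \<open>code\<close> and the limit is moved back by the continuous curve \<open>\<phi>\<close>, a
  left inverse of \<open>code\<close> on the square. Discontinuity of \<open>code\<close> is
  harmless, since test functions are composed with \<open>\<phi>\<close> only.\<close>

lemma square_weak_subsequence:
  fixes P :: "nat \<Rightarrow> (real \<times> real) measure" and a b :: real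
  assumes ab: "a \<le> b" and prob: "\<And>n. prob_space (P n)" and sets[measurable_cong]: "\<And>n. sets (P n) = sets borel"
    and sq: "\<And>n. AE z in P n. z \<in> {a..b} \<times> {a..b}"
  obtains r Q where "strict_mono (r :: nat \<Rightarrow> nat)" "prob_space Q" "sets Q = sets borel"
    "AE z in Q. z \<in> {a..b} \<times> {a..b}"
    "\<And>F :: real \<times> real \<Rightarrow> real. F \<in> borel_measurable borel \<Longrightarrow> continuous_on ({a..b} \<times> {a..b}) F \<Longrightarrow>
       (\<lambda>n. \<integral>z. F z \<partial>P (r n)) \<longlonglongrightarrow> (\<integral>z. F z \<partial>Q)"
proof -
  \<comment> \<open>The clamp keeps the whole curve in the square, so that \<open>F\<close> composed
    with it is continuous and bounded although \<open>F\<close> is controlled only there.\<close>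
  define cl where "cl s = max a (min b (a + (b - a + 1) * s))" for s
  define \<phi> where "\<phi> t = (cl (schoenberg 0 t), cl (schoenberg 1 t))" for t
  \<comment> \<open>The denominator \<open>b - a + 1\<close> maps the interval into
    \<open>[0, 1)\<close>, where binary expansions are valid, and stays positive when
    \<open>a = b\<close>.\<close>
  define sc where "sc x = (x - a) / (b - a + 1)" for x
  define code where "code z = cantor_code (interleave (sc (fst z)) (sc (snd z)))" for z
  have cont: "continuous_on UNIV \<phi>"
  proof -
    have "continuous_on UNIV (\<lambda>t. cl (schoenberg e t))" for e
      unfolding cl_def by (intro continuous_intros continuous_on_compose2[OF continuous_schoenberg]) auto
    then show ?thesis unfolding \<phi>_def by (intro continuous_on_Pair)
  qed
  have [measurable]: "\<phi> \<in> borel_measurable borel"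
    using cont by (rule borel_measurable_continuous_onI)
  have \<phi>sq: "\<phi> t \<in> {a..b} \<times> {a..b}" for t using ab by (auto simp: \<phi>_def cl_def)
  have inv: "\<phi> (code z) = z" if "z \<in> {a..b} \<times> {a..b}" for z
  proof -
    have "0 \<le> sc x \<and> sc x < 1 \<and> cl (sc x) = x" if "x \<in> {a..b}" for x
    proof -
      have "(b - a + 1) * sc x = x - a" using ab by (simp add: sc_def)
      then show ?thesis using that by (auto simp: sc_def cl_def)
    qed
    then show ?thesis using that unfolding \<phi>_def code_def
      by (auto simp: schoenberg_cantor_code schoenberg_cantor_code(2)[unfolded One_nat_def] mem_Times_iff prod_eq_iff)
  qed
  have [measurable]: "code \<in> borel_measurable borel"
    unfolding code_def sc_def
    by (intro measurable_cantor_code borel_measurable_continuous_onI continuous_intros) (use ab in auto)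
  define \<mu> where "\<mu> n = distr (P n) borel code" for n
  have rd: "real_distribution (\<mu> n)" for n
    unfolding \<mu>_def by (intro prob_space.real_distribution_distr prob) measurable
  \<comment> \<open>Codes may equal \<open>0\<close>, so the half-open interval used for tightness
    starts at \<open>-1\<close>.\<close>
  have code01: "code z \<in> {-1<..1}" for z
  proof -
    have "0 \<le> interleave u v k \<and> interleave u v k \<le> 1" for u v k
      using binary_digit_01[of "k div 2" "if even k then u else v"] unfolding interleave_def by auto
    from cantor_code_bounds[of "interleave (sc (fst z)) (sc (snd z))", OF this]
    show ?thesis by (simp add: code_def)
  qed
  have "tight \<mu>"
    unfolding tight_def
  proof (intro conjI allI impI rd)
    fix \<epsilon> :: real assume "0 < \<epsilon>"
    have "measure (\<mu> n) {-1<..1} = 1" for n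
    proof -
      interpret prob_space "P n" by (rule prob)
      have "code -` {-1<..1} \<inter> space (P n) = space (P n)" using code01 by auto
      then show ?thesis unfolding \<mu>_def by (subst measure_distr) (auto simp: prob_space)
    qed
    then show "\<exists>a b. a < b \<and> (\<forall>n. 1 - \<epsilon> < measure (\<mu> n) {a<..b})"
      using \<open>0 < \<epsilon>\<close> by (intro exI[of _ "-1"] exI[of _ 1]) auto
  qed
  from tight_imp_convergent_subsubsequence[OF this strict_mono_id]
  obtain r M where r: "strict_mono r" and M: "real_distribution M" and wc: "weak_conv_m (\<lambda>n. \<mu> (r n)) M"
    by (auto simp: comp_def id_def)
  interpret M: real_distribution M by (rule M)
  define Q where "Q = distr M borel \<phi>"
  have \<phi>M: "\<phi> \<in> measurable M borel" by measurable
  show thesis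
  proof (rule that[OF r, of Q])
    show "prob_space Q" unfolding Q_def by (rule M.prob_space_distr) measurable
    show "sets Q = sets borel" by (simp add: Q_def)
    show "AE z in Q. z \<in> {a..b} \<times> {a..b}"
    proof -
      have "{z \<in> space borel. z \<in> {a..b} \<times> {a..b}} = {a..b} \<times> {a..b}" by auto
      moreover have "closed ({a..b} \<times> {a..b})" by (intro closed_Times closed_atLeastAtMost)
      ultimately have "{z \<in> space borel. z \<in> {a..b} \<times> {a..b}} \<in> sets borel" by simp
      moreover have "AE t in M. \<phi> t \<in> {a..b} \<times> {a..b}" by (rule AE_I2) (rule \<phi>sq)
      ultimately show ?thesis unfolding Q_def by (simp only: AE_distr_iff[OF \<phi>M])
    qed
    fix F :: "real \<times> real \<Rightarrow> real"
    assume F[measurable]: "F \<in> borel_measurable borel" and cF: "continuous_on ({a..b} \<times> {a..b}) F"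
    have F\<phi>: "continuous_on UNIV (\<lambda>t. F (\<phi> t))"
      by (rule continuous_on_compose2[OF cF cont]) (rule image_subsetI, rule \<phi>sq)
    have "compact (F ` ({a..b} \<times> {a..b}))"
      by (intro compact_continuous_image cF compact_Times compact_Icc)
    then obtain B where B: "\<And>z. z \<in> {a..b} \<times> {a..b} \<Longrightarrow> norm (F z) \<le> B"
      using compact_imp_bounded bounded_iff by (metis imageI)
    have "(\<lambda>n. \<integral>t. F (\<phi> t) \<partial>\<mu> (r n)) \<longlonglongrightarrow> (\<integral>t. F (\<phi> t) \<partial>M)"
      by (rule weak_conv_imp_integral_bdd_continuous_conv[OF rd M wc, of "\<lambda>t. F (\<phi> t)" B])
        (use F\<phi> B[OF \<phi>sq] in \<open>auto simp: continuous_on_eq_continuous_at\<close>)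
    moreover have "(\<integral>t. F (\<phi> t) \<partial>M) = (\<integral>z. F z \<partial>Q)"
      unfolding Q_def by (rule integral_distr[symmetric]) measurable
    moreover have "(\<integral>t. F (\<phi> t) \<partial>\<mu> n) = (\<integral>z. F z \<partial>P n)" for n
    proof -
      have "(\<integral>t. F (\<phi> t) \<partial>\<mu> n) = (\<integral>z. F (\<phi> (code z)) \<partial>P n)"
        unfolding \<mu>_def by (rule integral_distr) measurable
      also have "\<dots> = (\<integral>z. F z \<partial>P n)"
        using sq[of n] by (intro integral_cong_AE) (auto simp: inv elim!: eventually_mono)
      finally show ?thesis .
    qed
    ultimately show "(\<lambda>n. \<integral>z. F z \<partial>P (r n)) \<longlonglongrightarrow> (\<integral>z. F z \<partial>Q)" by simp
  qed
qed

subsection \<open>Passage to the limit\<close>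

lemma borel_measurable_fst_snd [measurable]:
  "fst \<in> borel_measurable (borel :: (real \<times> real) measure)"
  "snd \<in> borel_measurable (borel :: (real \<times> real) measure)"
  by (intro borel_measurable_continuous_onI continuous_intros)+

text \<open>The mass function lives on index pairs and is pushed to the plane afterwards, so the
  weights of atoms with the same position add up.\<close>

lemma weight_coupling_measure:
  fixes x :: "'i :: countable \<Rightarrow> real"
  assumes fin: "finite I" "finite Y" and \<pi>: "weight_coupling I Y m n \<pi>" and mass: "(\<Sum>i\<in>I. m i) = 1"
  obtains P :: "(real \<times> real) measure" where "prob_space P" "sets P = sets borel"
    "\<And>F :: real \<times> real \<Rightarrow> real. F \<in> borel_measurable borel \<Longrightarrow> (\<integral>z. F z \<partial>P) = (\<Sum>i\<in>I. \<Sum>y\<in>Y. \<pi> i y * F (x i, y))"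
    "\<And>S. \<forall>i\<in>I. \<forall>y\<in>Y. (x i, y) \<in> S \<Longrightarrow> S \<in> sets borel \<Longrightarrow> AE z in P. z \<in> S"
proof -
  define w where "w z = (if z \<in> I \<times> Y then \<pi> (fst z) (snd z) else 0)" for z
  have w0: "0 \<le> w z" for z using \<pi> by (auto simp: w_def weight_coupling_def)
  have w1: "(\<integral>\<^sup>+z. ennreal (w z) \<partial>count_space UNIV) = 1"
  proof -
    have "(\<integral>\<^sup>+z. ennreal (w z) \<partial>count_space UNIV) = (\<Sum>z\<in>I \<times> Y. ennreal (w z))"
      using fin by (intro nn_integral_count_space') (auto simp: w_def)
    also have "\<dots> = ennreal (\<Sum>z\<in>I \<times> Y. w z)" by (rule sum_ennreal) (rule w0)
    also have "(\<Sum>z\<in>I \<times> Y. w z) = (\<Sum>i\<in>I. \<Sum>y\<in>Y. \<pi> i y)"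
      by (simp add: w_def sum.cartesian_product split_def cong: sum.cong)
    also have "\<dots> = 1" using \<pi> mass by (simp add: weight_coupling_def)
    finally show ?thesis by simp
  qed
  define p where "p = embed_pmf w"
  have pw: "pmf p z = w z" for z unfolding p_def by (rule pmf_embed_pmf[OF w0 w1])
  have sp: "set_pmf p \<subseteq> I \<times> Y" by (auto simp: set_pmf_eq pw w_def split: if_splits)
  define \<tau> where "\<tau> z = (x (fst z), snd z)" for z :: "'i \<times> real"
  define P where "P = distr (measure_pmf p) borel \<tau>"
  show thesis
  proof (rule that[of P])
    show "prob_space P" unfolding P_def by (rule measure_pmf.prob_space_distr) simp
    show "sets P = sets borel" by (simp add: P_def)
    show "(\<integral>z. F z \<partial>P) = (\<Sum>i\<in>I. \<Sum>y\<in>Y. \<pi> i y * F (x i, y))"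
      if F: "F \<in> borel_measurable borel" for F :: "real \<times> real \<Rightarrow> real"
    proof -
      have "(\<integral>z. F z \<partial>P) = (\<integral>z. F (\<tau> z) \<partial>measure_pmf p)"
        unfolding P_def using F by (intro integral_distr) auto
      also have "\<dots> = (\<Sum>z\<in>I \<times> Y. F (\<tau> z) * pmf p z)"
        using fin sp by (intro integral_measure_pmf_real) auto
      also have "\<dots> = (\<Sum>z\<in>I \<times> Y. \<pi> (fst z) (snd z) * F (x (fst z), snd z))"
        by (intro sum.cong) (auto simp: \<tau>_def pw w_def)
      finally show ?thesis by (simp add: sum.cartesian_product split_def)
    qed
    show "AE z in P. z \<in> S" if "\<forall>i\<in>I. \<forall>y\<in>Y. (x i, y) \<in> S" "S \<in> sets borel" for S
    proof -
      have "AE z in measure_pmf p. \<tau> z \<in> S"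
        using sp that(1) by (auto simp: AE_measure_pmf_iff \<tau>_def)
      then show ?thesis unfolding P_def using that(2) by (subst AE_distr_iff) auto
    qed
  qed
qed

section \<open>Approximate primal and dual solutions from one discretisation\<close>

context lipschitz_cost
begin

text \<open>Origin of the error: \<open>L\<close> for sampling the cost at \<open>t i\<close>
  instead of \<open>x i\<close>, \<open>K + L\<close> for integrating \<open>g\<close> against the
  grid measure instead of \<nu>, and \<open>K + L\<close> for replacing the discrete
  \<open>f\<close> by \<open>dual_f g\<close>.\<close>

lemma discrete_step:
  fixes \<mu> \<nu> :: "real measure"
  assumes \<mu>: "prob_space \<mu>" "sets \<mu> = sets borel" "AE x in \<mu>. x \<in> {\<alpha>..\<beta>}"
    and \<nu>: "prob_space \<nu>" "sets \<nu> = sets borel" "AE x in \<nu>. x \<in> {\<alpha>..\<beta>}"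
    and mean: "(\<integral>x. x \<partial>\<mu>) = (\<integral>y. y \<partial>\<nu>)"
    and put: "\<And>p. (\<integral>x. max 0 (p - x) \<partial>\<mu>) \<le> (\<integral>y. max 0 (p - y) \<partial>\<nu>)"
    and conv: "AE x in \<mu>. convex_on {\<alpha>..\<beta>} (C x)" and \<delta>: "0 < \<delta>"
  obtains P g where "prob_space P" "sets P = sets borel" "AE z in P. z \<in> {\<alpha>..\<beta>} \<times> {\<alpha>..\<beta>}"
    "(K + L)-lipschitz_on UNIV g"
    "\<And>f B. B-lipschitz_on UNIV f \<Longrightarrow> \<bar>(\<integral>z. f (fst z) \<partial>P) - (\<integral>x. f x \<partial>\<mu>)\<bar> \<le> B * \<delta>"
    "\<And>f B. B-lipschitz_on UNIV f \<Longrightarrow> \<bar>(\<integral>z. f (snd z) \<partial>P) - (\<integral>y. f y \<partial>\<nu>)\<bar> \<le> B * \<delta>"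
    "\<And>f. f \<in> borel_measurable borel \<Longrightarrow> (\<integral>z. f (fst z) * (snd z - fst z) \<partial>P) = 0"
    "(\<integral>z. C (fst z) (snd z) \<partial>P) \<le> (\<integral>y. g y \<partial>\<nu>) - (\<integral>x. dual_f g x \<partial>\<mu>) + (2 * K + 3 * L) * \<delta>"
proof -
  obtain d :: real and N :: nat and k :: "real \<Rightarrow> nat" where d: "0 < d" "d \<le> \<delta>" and N: "\<beta> = \<alpha> + real N * d"
    and k: "k \<in> measurable borel (count_space UNIV)" "\<And>x. k x < N"
    "\<And>x. x \<in> {\<alpha>..\<beta>} \<Longrightarrow> \<alpha> + real (k x) * d \<le> x \<and> x \<le> \<alpha> + real (k x) * d + d"
    by (rule interval_grid[OF \<alpha>\<beta> \<delta>]) (rule that)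
  obtain I :: "nat set" and m x t :: "nat \<Rightarrow> real" and A :: "nat \<Rightarrow> real set" where
    finI: "finite I" and m: "\<And>i. i \<in> I \<Longrightarrow> 0 < m i" and m1: "(\<Sum>i\<in>I. m i) = 1"
    and t: "\<And>i. i \<in> I \<Longrightarrow> convex_on {\<alpha>..\<beta>} (C (t i))" and x: "\<And>i. i \<in> I \<Longrightarrow> x i \<in> {\<alpha>..\<beta>}"
    and meanI: "(\<Sum>i\<in>I. m i * x i) = (\<integral>y. y \<partial>\<mu>)"
    and putI: "\<And>p. (\<Sum>i\<in>I. m i * max 0 (p - x i)) \<le> (\<integral>y. max 0 (p - y) \<partial>\<mu>)"
    and A: "\<And>i y. i \<in> I \<Longrightarrow> y \<in> A i \<Longrightarrow> \<bar>y - t i\<bar> \<le> d \<and> \<bar>y - x i\<bar> \<le> d"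
    and tx: "\<And>i. i \<in> I \<Longrightarrow> \<bar>t i - x i\<bar> \<le> d"
    and upI: "\<And>f v e. integrable \<mu> f \<Longrightarrow> \<forall>i\<in>I. \<forall>y\<in>A i. f y \<le> v i + e \<Longrightarrow>
       (\<integral>y. f y \<partial>\<mu>) \<le> (\<Sum>i\<in>I. m i * v i) + e"
    by (rule source_discretisation[OF \<mu> conv k]) (assumption, rule that)
  obtain Y :: "real set" and n :: "real \<Rightarrow> real" where
    finY: "finite Y" and YJ: "Y \<subseteq> {\<alpha>..\<beta>}" and n: "\<And>z. z \<in> Y \<Longrightarrow> 0 \<le> n z" and n1: "(\<Sum>z\<in>Y. n z) = 1"
    and meanY: "(\<Sum>z\<in>Y. n z * z) = (\<integral>y. y \<partial>\<nu>)"
    and putY: "\<And>p. (\<integral>y. max 0 (p - y) \<partial>\<nu>) \<le> (\<Sum>z\<in>Y. n z * max 0 (p - z))"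
    and lipY: "\<And>f B. B-lipschitz_on {\<alpha>..\<beta>} f \<Longrightarrow> integrable \<nu> f \<Longrightarrow> \<bar>(\<Sum>z\<in>Y. n z * f z) - (\<integral>y. f y \<partial>\<nu>)\<bar> \<le> B * d"
    by (rule target_discretisation[OF \<nu> d(1) N k]) (assumption, rule that)
  have Clip: "\<bar>C (t i) y - C (t i) z\<bar> \<le> L * \<bar>y - z\<bar>" for i y z using C_lip[of "t i" y "t i" z] by simp
  obtain \<pi> f h g0 where \<pi>: "weight_coupling I Y m n \<pi>"
    and mart: "\<And>i. i \<in> I \<Longrightarrow> (\<Sum>y\<in>Y. \<pi> i y * (y - x i)) = 0"
    and feas: "\<And>i y. i \<in> I \<Longrightarrow> y \<in> Y \<Longrightarrow> g0 y - f i - h i * (y - x i) \<le> C (t i) y"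
    and hK: "\<And>i. i \<in> I \<Longrightarrow> \<bar>h i\<bar> \<le> K"
    and val: "(\<Sum>i\<in>I. \<Sum>y\<in>Y. \<pi> i y * C (t i) y) \<le> (\<Sum>y\<in>Y. n y * g0 y) - (\<Sum>i\<in>I. m i * f i)"
  proof (rule finite_martingale_duality[where c = "\<lambda>i. C (t i)", OF finI finY m n m1 n1 _ _ t YJ Clip L0 LK])
    show "(\<Sum>i\<in>I. m i * x i) = (\<Sum>y\<in>Y. n y * y)" using meanI meanY mean by simp
    show "(\<Sum>i\<in>I. m i * max 0 (p - x i)) \<le> (\<Sum>y\<in>Y. n y * max 0 (p - y))" for p
      using putI[of p] put[of p] putY[of p] by linarith
  qed (assumption, assumption, assumption, rule that)
  obtain P :: "(real \<times> real) measure" where P: "prob_space P" "sets P = sets borel"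
    and PF: "\<And>F :: real \<times> real \<Rightarrow> real. F \<in> borel_measurable borel \<Longrightarrow> (\<integral>z. F z \<partial>P) = (\<Sum>i\<in>I. \<Sum>y\<in>Y. \<pi> i y * F (x i, y))"
    and PS: "\<And>S. \<forall>i\<in>I. \<forall>y\<in>Y. (x i, y) \<in> S \<Longrightarrow> S \<in> sets borel \<Longrightarrow> AE z in P. z \<in> S"
    by (rule weight_coupling_measure[OF finI finY \<pi> m1]) (rule that)
  define \<phi> where "\<phi> i y = f i + h i * (y - x i) + C (t i) y" for i y
  \<comment> \<open>The discrete dual function is controlled on the grid only. The lower envelope of
    the \<open>\<phi> i\<close> is no smaller there, obeys the constraints at every
    \<open>y\<close>, and has a Lipschitz constant that is independent of the grid.\<close>
  define g where "g y = Min ((\<lambda>i. \<phi> i y) ` I)" for y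
  have Ine: "I \<noteq> {}" using m1 by auto
  have gle: "g y \<le> \<phi> i y" if "i \<in> I" for i y using finI that by (auto simp: g_def)
  have gex: "\<exists>i\<in>I. g y = \<phi> i y" for y
  proof -
    have "Min ((\<lambda>i. \<phi> i y) ` I) \<in> (\<lambda>i. \<phi> i y) ` I" using finI Ine by (intro Min_in) auto
    then show ?thesis unfolding g_def by blast
  qed
  have \<phi>lip: "\<phi> i y \<le> \<phi> i z + (K + L) * \<bar>y - z\<bar>" if "i \<in> I" for i y z
  proof -
    have "h i * (y - z) \<le> \<bar>h i\<bar> * \<bar>y - z\<bar>" by (metis abs_ge_self abs_mult)
    also have "\<dots> \<le> K * \<bar>y - z\<bar>" using hK[OF that] by (intro mult_right_mono) auto
    finally show ?thesis using Clip[of i y z] by (simp add: \<phi>_def algebra_simps)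
  qed
  have g1: "g y \<le> g z + (K + L) * \<bar>y - z\<bar>" for y z
  proof -
    obtain i where "i \<in> I" "g z = \<phi> i z" using gex by blast
    then show ?thesis using gle[of i y] \<phi>lip[of i y z] by linarith
  qed
  have glip: "(K + L)-lipschitz_on UNIV g"
  proof (rule lipschitz_onI)
    show "dist (g y) (g z) \<le> (K + L) * dist y z" for y z
      using g1[of y z] g1[of z y] by (simp add: dist_real_def abs_le_iff abs_minus_commute)
  qed (use K0 L0 in simp)
  have glipJ: "(K + L)-lipschitz_on {\<alpha>..\<beta>} g" by (rule lipschitz_on_subset[OF glip]) simp
  note int = integrable_lipschitz_on_interval
  have row: "(\<Sum>y\<in>Y. \<pi> i y) = m i" if "i \<in> I" for i using \<pi> that by (auto simp: weight_coupling_def)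
  have col: "(\<Sum>i\<in>I. \<pi> i y) = n y" if "y \<in> Y" for y using \<pi> that by (auto simp: weight_coupling_def)
  have \<pi>0: "0 \<le> \<pi> i y" if "i \<in> I" "y \<in> Y" for i y using \<pi> that by (auto simp: weight_coupling_def)
  show thesis
  proof (rule that[OF P _ glip])
    have "closed ({\<alpha>..\<beta>} \<times> {\<alpha>..\<beta>})" by (intro closed_Times closed_atLeastAtMost)
    then show "AE z in P. z \<in> {\<alpha>..\<beta>} \<times> {\<alpha>..\<beta>}"
      using x YJ by (intro PS) auto
    show "\<bar>(\<integral>z. q (fst z) \<partial>P) - (\<integral>x. q x \<partial>\<mu>)\<bar> \<le> B * \<delta>" if q: "B-lipschitz_on UNIV q" for q B
    proof -
      have [measurable]: "q \<in> borel_measurable borel"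
        using q by (intro borel_measurable_continuous_onI lipschitz_on_continuous_on)
      have B: "0 \<le> B" using q by (rule lipschitz_on_nonneg)
      have "(\<integral>z. q (fst z) \<partial>P) = (\<Sum>i\<in>I. m i * q (x i))"
        by (subst PF) (auto simp: row sum_distrib_right[symmetric])
      moreover have near: "\<bar>q y - q (x i)\<bar> \<le> B * d" if "i \<in> I" "y \<in> A i" for i y
        using lipschitz_onD[OF q, of y "x i"] A[OF that] mult_left_mono[OF _ B, of "\<bar>y - x i\<bar>" d]
        by (auto simp: dist_real_def)
      moreover have "(\<integral>x. q x \<partial>\<mu>) \<le> (\<Sum>i\<in>I. m i * q (x i)) + B * d"
        using near by (intro upI int[OF \<mu> q]) (auto simp: abs_le_iff algebra_simps)
      moreover have "(\<integral>x. - q x \<partial>\<mu>) \<le> (\<Sum>i\<in>I. m i * - q (x i)) + B * d"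
        using near int[OF \<mu> q] by (intro upI) (auto simp: abs_le_iff algebra_simps)
      ultimately have "\<bar>(\<integral>z. q (fst z) \<partial>P) - (\<integral>x. q x \<partial>\<mu>)\<bar> \<le> B * d"
        by (simp add: sum_negf abs_le_iff)
      also have "\<dots> \<le> B * \<delta>" using d B by (intro mult_left_mono) auto
      finally show ?thesis .
    qed
    show "\<bar>(\<integral>z. q (snd z) \<partial>P) - (\<integral>x. q x \<partial>\<nu>)\<bar> \<le> B * \<delta>" if q: "B-lipschitz_on UNIV q" for q B
    proof -
      have [measurable]: "q \<in> borel_measurable borel"
        using q by (intro borel_measurable_continuous_onI lipschitz_on_continuous_on)
      have B: "0 \<le> B" using q by (rule lipschitz_on_nonneg)
      have "(\<integral>z. q (snd z) \<partial>P) = (\<Sum>i\<in>I. \<Sum>y\<in>Y. \<pi> i y * q y)"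
        by (subst PF) auto
      also have "\<dots> = (\<Sum>y\<in>Y. \<Sum>i\<in>I. \<pi> i y * q y)" by (rule sum.swap)
      also have "\<dots> = (\<Sum>y\<in>Y. n y * q y)" by (simp add: col sum_distrib_right[symmetric])
      finally have "\<bar>(\<integral>z. q (snd z) \<partial>P) - (\<integral>x. q x \<partial>\<nu>)\<bar> \<le> B * d"
        using lipY[OF lipschitz_on_subset[OF q] int[OF \<nu> q]] by simp
      also have "\<dots> \<le> B * \<delta>" using d B by (intro mult_left_mono) auto
      finally show ?thesis .
    qed
    show "(\<integral>z. q (fst z) * (snd z - fst z) \<partial>P) = 0" if [measurable]: "q \<in> borel_measurable borel" for q
    proof -
      have "(\<integral>z. q (fst z) * (snd z - fst z) \<partial>P) = (\<Sum>i\<in>I. q (x i) * (\<Sum>y\<in>Y. \<pi> i y * (y - x i)))"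
        unfolding sum_distrib_left by (subst PF) (auto intro!: sum.cong)
      then show ?thesis using mart by simp
    qed
    have [measurable]: "(\<lambda>z. C (fst z) (snd z)) \<in> borel_measurable borel"
      using continuous_C by (rule borel_measurable_continuous_onI)
    have "(\<integral>z. C (fst z) (snd z) \<partial>P) = (\<Sum>i\<in>I. \<Sum>y\<in>Y. \<pi> i y * C (x i) y)"
      by (subst PF) auto
    also have "\<dots> \<le> (\<Sum>i\<in>I. \<Sum>y\<in>Y. \<pi> i y * (C (t i) y + L * \<delta>))"
    proof (intro sum_mono mult_left_mono \<pi>0)
      fix i y assume i: "i \<in> I"
      have "\<bar>C (x i) y - C (t i) y\<bar> \<le> L * \<bar>t i - x i\<bar>" using C_lip[of "x i" y "t i" y] by (simp add: abs_minus_commute)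
      also have "\<dots> \<le> L * \<delta>" using tx[OF i] d L0 by (intro mult_left_mono) auto
      finally show "C (x i) y \<le> C (t i) y + L * \<delta>" by linarith
    qed
    also have "\<dots> = (\<Sum>i\<in>I. \<Sum>y\<in>Y. \<pi> i y * C (t i) y) + L * \<delta>"
      using row m1 by (simp add: distrib_left sum.distrib sum_distrib_right[symmetric])
    also have "\<dots> \<le> (\<Sum>y\<in>Y. n y * g0 y) - (\<Sum>i\<in>I. m i * f i) + L * \<delta>" using val by simp
    also have "(\<Sum>y\<in>Y. n y * g0 y) \<le> (\<Sum>y\<in>Y. n y * g y)"
    proof (intro sum_mono mult_left_mono n)
      fix y assume y: "y \<in> Y"
      obtain i where "i \<in> I" "g y = \<phi> i y" using gex by blast
      then show "g0 y \<le> g y" using feas[of i y] y by (simp add: \<phi>_def)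
    qed
    also have "(\<Sum>y\<in>Y. n y * g y) \<le> (\<integral>y. g y \<partial>\<nu>) + (K + L) * \<delta>"
    proof -
      have "\<bar>(\<Sum>z\<in>Y. n z * g z) - (\<integral>y. g y \<partial>\<nu>)\<bar> \<le> (K + L) * d" by (rule lipY[OF glipJ int[OF \<nu> glip]])
      also have "\<dots> \<le> (K + L) * \<delta>" using d K0 L0 by (intro mult_left_mono) auto
      finally show ?thesis by linarith
    qed
    finally have 1: "(\<integral>z. C (fst z) (snd z) \<partial>P) \<le> (\<integral>y. g y \<partial>\<nu>) + (K + L) * \<delta> - (\<Sum>i\<in>I. m i * f i) + L * \<delta>"
      by simp
    have 2: "(\<integral>x. dual_f g x \<partial>\<mu>) \<le> (\<Sum>i\<in>I. m i * f i) + (K + L) * \<delta>"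
    proof (rule upI[OF int[OF \<mu> dual_f_lipschitz[OF glipJ]]], intro ballI)
      fix i z assume i: "i \<in> I" and z: "z \<in> A i"
      \<comment> \<open>The discrete pair \<open>f i\<close>, \<open>h i\<close> competes for the
        envelope at every point \<open>z\<close> of its cell, once \<open>f i\<close> is raised to
        pay for moving \<open>x i\<close> and \<open>t i\<close> to \<open>z\<close>.\<close>
      have "dual_slack g z (h i) (f i + (K + L) * \<delta>)"
        unfolding dual_slack_def
      proof
        fix y
        have "h i * (z - x i) \<le> \<bar>h i\<bar> * \<bar>z - x i\<bar>" by (metis abs_ge_self abs_mult)
        also have "\<dots> \<le> K * \<delta>" using hK[OF i] A[OF i z] d K0 by (intro mult_mono) auto
        finally have a: "h i * (z - x i) \<le> K * \<delta>" .
        have "\<bar>C (t i) y - C z y\<bar> \<le> L * \<bar>z - t i\<bar>" using C_lip[of "t i" y z y] by (simp add: abs_minus_commute)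
        also have "\<dots> \<le> L * \<delta>" using A[OF i z] d L0 by (intro mult_left_mono) auto
        finally have b: "C (t i) y - C z y \<le> L * \<delta>" by linarith
        show "g y - h i * (y - z) - C z y \<le> f i + (K + L) * \<delta>"
          using gle[OF i, of y] a b by (simp add: \<phi>_def algebra_simps)
      qed
      then show "dual_f g z \<le> f i + (K + L) * \<delta>"
        using hK[OF i] by (intro dual_f_le[OF glipJ, of "h i"]) (auto simp: abs_le_iff)
    qed
    show "(\<integral>z. C (fst z) (snd z) \<partial>P) \<le> (\<integral>y. g y \<partial>\<nu>) - (\<integral>x. dual_f g x \<partial>\<mu>) + (2 * K + 3 * L) * \<delta>"
      using 1 2 by (simp add: algebra_simps)
  qed
qed

end

text \<open>Ramps that equal 1 up to \<open>b\<close> and then descend with slope \<open>- k\<close>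
  decrease to the indicator of the half-line, so Lipschitz tests determine the distribution
  function.\<close>

lemma finite_borel_measure_eqI_lipschitz:
  fixes M N :: "real measure"
  assumes M: "finite_measure M" "sets M = sets borel" and N: "finite_measure N" "sets N = sets borel"
    and eq: "\<And>(f :: real \<Rightarrow> real) B. B-lipschitz_on UNIV f \<Longrightarrow> (\<And>x. 0 \<le> f x \<and> f x \<le> 1) \<Longrightarrow> (\<integral>x. f x \<partial>M) = (\<integral>x. f x \<partial>N)"
  shows "M = N"
proof (rule cdf_unique')
  show "finite_borel_measure M" "finite_borel_measure N"
    using M N by (simp_all add: finite_borel_measure_def finite_borel_measure_axioms_def)
  define r where "r b k x = max 0 (min 1 (1 - real k * (x - b)))" for b x :: real and k :: nat
  have rlip: "(real k)-lipschitz_on UNIV (r b k)" for b k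
  proof (rule lipschitz_onI)
    fix x y :: real
    have "dist (r b k x) (r b k y) \<le> \<bar>(1 - real k * (x - b)) - (1 - real k * (y - b))\<bar>"
      unfolding r_def dist_real_def by (auto simp: max_def min_def)
    also have "\<dots> = \<bar>real k * (y - x)\<bar>" by (simp add: algebra_simps)
    finally show "dist (r b k x) (r b k y) \<le> real k * dist x y"
      by (simp add: abs_mult dist_real_def abs_minus_commute)
  qed simp
  have r01: "0 \<le> r b k x \<and> r b k x \<le> 1" for b k x by (simp add: r_def)
  have lim: "(\<lambda>k. r b k x) \<longlonglongrightarrow> indicator {..b} x" for b x
  proof (cases "x \<le> b")
    case True
    then have "r b k x = 1" for k by (simp add: r_def mult_nonneg_nonpos)
    then show ?thesis using True by simp
  next
    case False
    then obtain k0 where k0: "1 / (x - b) < real k0" using reals_Archimedean2 by blast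
    have "r b k x = 0" if "k0 \<le> k" for k
    proof -
      have "1 / (x - b) < real k" using k0 that by linarith
      then have "1 < real k * (x - b)" using False by (simp add: pos_divide_less_eq)
      then show ?thesis by (simp add: r_def)
    qed
    then have "\<forall>\<^sub>F k in sequentially. r b k x = 0" by (rule eventually_sequentiallyI)
    then show ?thesis using False by (simp add: tendsto_eventually)
  qed
  have conv: "(\<lambda>k. \<integral>x. r b k x \<partial>W) \<longlonglongrightarrow> measure W {..b}" if W: "finite_measure W" "sets W = sets borel" for W b
  proof -
    interpret finite_measure W by (rule W)
    note W(2)[measurable_cong]
    have [measurable]: "r b k \<in> borel_measurable borel" for k unfolding r_def by measurable
    have "(\<lambda>k. \<integral>x. r b k x \<partial>W) \<longlonglongrightarrow> (\<integral>x. indicator {..b} x \<partial>W)"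
      by (rule integral_dominated_convergence[where w = "\<lambda>_. 1"]) (use lim r01 in auto)
    then show ?thesis using sets_eq_imp_space_eq[OF W(2)] by simp
  qed
  show "cdf M = cdf N"
  proof
    fix b
    have "(\<lambda>k. \<integral>x. r b k x \<partial>M) = (\<lambda>k. \<integral>x. r b k x \<partial>N)"
      by (intro ext eq[OF rlip]) (rule r01)
    then show "cdf M b = cdf N b"
      using LIMSEQ_unique[OF conv[OF M, of b]] conv[OF N, of b] by (simp add: cdf_def)
  qed
qed

lemma weighted_fst_marginal:
  fixes P :: "(real \<times> real) measure" and w :: "real \<times> real \<Rightarrow> real"
  assumes P: "prob_space P" "sets P = sets borel" and w: "w \<in> borel_measurable borel"
    and bd: "AE z in P. 0 \<le> w z \<and> w z \<le> D"
  defines "W \<equiv> distr (density P (\<lambda>z. ennreal (w z))) borel fst"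
  shows "finite_measure W" "sets W = sets borel"
    and "f \<in> borel_measurable borel \<Longrightarrow> (\<integral>x. f x \<partial>W) = (\<integral>z. w z * f (fst z) \<partial>P)"
proof -
  interpret prob_space P by (rule P)
  note P(2)[measurable_cong] w[measurable]
  show s: "sets W = sets borel" by (simp add: W_def)
  show "finite_measure W"
  proof
    have "emeasure W (space W) = (\<integral>\<^sup>+z. ennreal (w z) \<partial>P)"
      unfolding W_def by (subst emeasure_distr) (auto simp: emeasure_density)
    also have "\<dots> \<le> (\<integral>\<^sup>+z. ennreal D \<partial>P)"
    proof (rule nn_integral_mono_AE)
      show "AE z in P. ennreal (w z) \<le> ennreal D"
        using bd by eventually_elim (auto intro: ennreal_leI)
    qed
    also have "\<dots> < \<infinity>" by (simp add: emeasure_space_1)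
    finally show "emeasure W (space W) \<noteq> \<infinity>" by simp
  qed
  show "(\<integral>x. f x \<partial>W) = (\<integral>z. w z * f (fst z) \<partial>P)" if [measurable]: "f \<in> borel_measurable borel"
  proof -
    have "(\<integral>x. f x \<partial>W) = (\<integral>z. f (fst z) \<partial>density P (\<lambda>z. ennreal (w z)))"
      unfolding W_def by (rule integral_distr) measurable
    also have "\<dots> = (\<integral>z. w z * f (fst z) \<partial>P)"
      by (subst integral_density) (use bd in \<open>auto elim: eventually_mono\<close>)
    finally show ?thesis .
  qed
qed

text \<open>The first marginals of \<open>Y - \<alpha>\<close> and \<open>X - \<alpha>\<close>, as densities, turn the signed martingale condition into an equality of finite measures.\<close>
lemma martingale_test_extension:
  fixes P :: "(real \<times> real) measure"
  assumes P: "prob_space P" "sets P = sets borel" and sq: "AE z in P. z \<in> {\<alpha>..\<beta>} \<times> {\<alpha>..\<beta>}"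
    and test: "(\<forall>f B. B-lipschitz_on UNIV f \<longrightarrow> (\<integral>z. f (fst z) * (snd z - fst z) \<partial>P) = 0)
      \<or> (\<forall>A\<in>sets borel. (\<integral>z. indicator A (fst z) * (snd z - fst z) \<partial>P) = 0)"
    and f: "f \<in> borel_measurable borel" "\<And>x. x \<in> {\<alpha>..\<beta>} \<Longrightarrow> \<bar>f x\<bar> \<le> B"
  shows "(\<integral>z. f (fst z) * (snd z - fst z) \<partial>P) = 0"
proof -
  interpret prob_space P by (rule P)
  note P(2)[measurable_cong]
  define W where "W w = distr (density P (\<lambda>z. ennreal (w z))) borel fst" for w :: "real \<times> real \<Rightarrow> real"
  let ?s = "\<lambda>z :: real \<times> real. snd z - \<alpha>" and ?t = "\<lambda>z :: real \<times> real. fst z - \<alpha>"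
  have bs: "AE z in P. 0 \<le> ?s z \<and> ?s z \<le> \<beta> - \<alpha>" and bt: "AE z in P. 0 \<le> ?t z \<and> ?t z \<le> \<beta> - \<alpha>"
    using sq by (auto elim!: eventually_mono simp: mem_Times_iff)
  have ms: "?s \<in> borel_measurable borel" and mt: "?t \<in> borel_measurable borel"
    by (intro borel_measurable_diff borel_measurable_const borel_measurable_fst_snd)+
  note Ws = weighted_fst_marginal[OF P ms bs, folded W_def] and Wt = weighted_fst_marginal[OF P mt bt, folded W_def]
  have diff: "(\<integral>x. q x \<partial>W ?s) - (\<integral>x. q x \<partial>W ?t) = (\<integral>z. q (fst z) * (snd z - fst z) \<partial>P)"
    if q[measurable]: "q \<in> borel_measurable borel" and bq: "\<And>x. x \<in> {\<alpha>..\<beta>} \<Longrightarrow> \<bar>q x\<bar> \<le> D" for q D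
  proof -
    have i: "integrable P (\<lambda>z. w z * q (fst z))"
      if w[measurable]: "w \<in> borel_measurable borel" and bw: "AE z in P. 0 \<le> w z \<and> w z \<le> \<beta> - \<alpha>" for w
    proof (rule integrable_const_bound)
      show "AE z in P. norm (w z * q (fst z)) \<le> (\<beta> - \<alpha>) * D"
        using bw sq
      proof eventually_elim
        case (elim z)
        then have "\<bar>q (fst z)\<bar> \<le> D" by (intro bq) (auto simp: mem_Times_iff)
        then show ?case using elim by (auto simp: abs_mult intro!: mult_mono)
      qed
    qed measurable
    have "(\<integral>x. q x \<partial>W ?s) - (\<integral>x. q x \<partial>W ?t) = (\<integral>z. ?s z * q (fst z) \<partial>P) - (\<integral>z. ?t z * q (fst z) \<partial>P)"
      by (simp only: Ws(3)[OF q] Wt(3)[OF q])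
    also have "\<dots> = (\<integral>z. ?s z * q (fst z) - ?t z * q (fst z) \<partial>P)"
      by (rule Bochner_Integration.integral_diff[symmetric]) (intro i bs bt ms mt)+
    finally show ?thesis by (simp add: algebra_simps)
  qed
  \<comment> \<open>Either kind of test identifies the two measures: Lipschitz functions, which a
    weak limit provides, or Borel sets, which the definition of \<open>mart_couplings\<close>
    provides.\<close>
  have "W ?s = W ?t"
    using test
  proof
    assume t: "\<forall>f B. B-lipschitz_on UNIV f \<longrightarrow> (\<integral>z. f (fst z) * (snd z - fst z) \<partial>P) = 0"
    show ?thesis
    proof (rule finite_borel_measure_eqI_lipschitz)
      show "(\<integral>x. q x \<partial>W ?s) = (\<integral>x. q x \<partial>W ?t)" if q: "D-lipschitz_on UNIV q" "\<And>x. 0 \<le> q x \<and> q x \<le> 1" for q :: "real \<Rightarrow> real" and D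
        using diff[of q 1] t q borel_measurable_continuous_onI[OF lipschitz_on_continuous_on[OF q(1)]] by auto
    qed (rule Ws(1) Ws(2) Wt(1) Wt(2))+
  next
    assume t: "\<forall>A\<in>sets borel. (\<integral>z. indicator A (fst z) * (snd z - fst z) \<partial>P) = 0"
    have fm: "finite_measure (W ?s)" "finite_measure (W ?t)" by (rule Ws(1) Wt(1))+
    show ?thesis
    proof (rule measure_eqI)
      show "sets (W ?s) = sets (W ?t)" by (simp add: W_def)
      fix A assume "A \<in> sets (W ?s)"
      then have A[measurable]: "A \<in> sets borel" by (simp add: W_def)
      have "(\<integral>x. indicator A x \<partial>W ?s) - (\<integral>x. indicator A x \<partial>W ?t) = (0 :: real)"
        using diff[of "indicator A" 1] t A by (simp add: indicator_le_1)
      then have "measure (W ?s) A = measure (W ?t) A" by (simp add: W_def)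
      then show "emeasure (W ?s) A = emeasure (W ?t) A"
        using fm by (simp add: finite_measure.emeasure_eq_measure)
    qed
  qed
  then show ?thesis using diff[OF f] by simp
qed

section \<open>Limit of the discretised problems\<close>

context lipschitz_cost
begin

text \<open>A constant added to \<open>g\<close> moves the envelope equally, so normalising
  \<open>g\<close> leaves the dual value for two probability measures unchanged.\<close>

lemma dual_f_shift:
  assumes g: "M-lipschitz_on {\<alpha>..\<beta>} g"
  shows "dual_f (\<lambda>y. g y - a) x = dual_f g x - a"
proof -
  have g': "M-lipschitz_on {\<alpha>..\<beta>} (\<lambda>y. g y - a)"
    using g by (simp add: lipschitz_on_def dist_real_def)
  show ?thesis
    using dual_f_mono[OF g' g, of "- a" x] dual_f_mono[OF g g', of a x] by simp
qed

text \<open>The inequality between cost and dual value survives the limit for two reasons: the cost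
  is continuous, so weak convergence of the couplings suffices, and \<open>dual_f\<close> moves by
  at most the uniform distance of its arguments.\<close>

lemma martingale_duality:
  fixes \<mu> \<nu> :: "real measure"
  assumes \<mu>: "prob_space \<mu>" "sets \<mu> = sets borel" "AE x in \<mu>. x \<in> {\<alpha>..\<beta>}"
    and \<nu>: "prob_space \<nu>" "sets \<nu> = sets borel" "AE x in \<nu>. x \<in> {\<alpha>..\<beta>}"
    and mean: "(\<integral>x. x \<partial>\<mu>) = (\<integral>y. y \<partial>\<nu>)"
    and put: "\<And>p. (\<integral>x. max 0 (p - x) \<partial>\<mu>) \<le> (\<integral>y. max 0 (p - y) \<partial>\<nu>)"
    and conv: "AE x in \<mu>. convex_on {\<alpha>..\<beta>} (C x)"
  obtains Q g where "Q \<in> mart_couplings \<mu> \<nu>" "(K + L)-lipschitz_on UNIV g"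
    "(\<integral>z. C (fst z) (snd z) \<partial>Q) \<le> (\<integral>y. g y \<partial>\<nu>) - (\<integral>x. dual_f g x \<partial>\<mu>)"
proof -
  define J2 where "J2 = {\<alpha>..\<beta>} \<times> {\<alpha>..\<beta>}"
  define ok where "ok n P g \<longleftrightarrow> prob_space P \<and> sets P = sets borel \<and> (AE z in P. z \<in> J2) \<and> (K + L)-lipschitz_on UNIV g \<and>
    (\<forall>f B. B-lipschitz_on UNIV f \<longrightarrow> \<bar>(\<integral>z. f (fst z) \<partial>P) - (\<integral>x. f x \<partial>\<mu>)\<bar> \<le> B * (1 / Suc n)) \<and>
    (\<forall>f B. B-lipschitz_on UNIV f \<longrightarrow> \<bar>(\<integral>z. f (snd z) \<partial>P) - (\<integral>y. f y \<partial>\<nu>)\<bar> \<le> B * (1 / Suc n)) \<and>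
    (\<forall>f\<in>borel_measurable borel. (\<integral>z. f (fst z) * (snd z - fst z) \<partial>P) = 0) \<and>
    (\<integral>z. C (fst z) (snd z) \<partial>P) \<le> (\<integral>y. g y \<partial>\<nu>) - (\<integral>x. dual_f g x \<partial>\<mu>) + (2 * K + 3 * L) * (1 / Suc n)"
    for n :: nat and P :: "(real \<times> real) measure" and g :: "real \<Rightarrow> real"
  have "\<exists>P g. ok n P g" for n
  proof -
    have "0 < 1 / real (Suc n)" by simp
    show ?thesis
      by (rule discrete_step[OF \<mu> \<nu> mean put conv \<open>0 < 1 / real (Suc n)\<close>]) (unfold ok_def J2_def, blast)
  qed
  then obtain P g where ok: "\<And>n. ok n (P n) (g n)" by metis
  have P: "prob_space (P n)" "sets (P n) = sets borel" "AE z in P n. z \<in> J2" for n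
    using ok[of n] by (auto simp: ok_def)
  have gl: "(K + L)-lipschitz_on UNIV (g n)" for n using ok[of n] by (simp add: ok_def)
  have glJ: "(K + L)-lipschitz_on {\<alpha>..\<beta>} (g n)" for n by (rule lipschitz_on_subset[OF gl]) simp
  have KL: "0 \<le> K + L" using K0 L0 by simp
  \<comment> \<open>The constants \<open>g n \<alpha>\<close> may be unbounded; subtracting them
    makes the equi-Lipschitz family uniformly bounded.\<close>
  define G where "G n y = g n y - g n \<alpha>" for n y
  have Gl: "(K + L)-lipschitz_on UNIV (G n)" for n
    using gl[of n] by (simp add: G_def lipschitz_on_def dist_real_def)
  have GlJ: "(K + L)-lipschitz_on {\<alpha>..\<beta>} (G n)" for n by (rule lipschitz_on_subset[OF Gl]) simp
  have G\<alpha>: "norm (G n y) \<le> (K + L) * (\<beta> - \<alpha>)" if y: "y \<in> {\<alpha>..\<beta>}" for n y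
  proof -
    have "\<bar>G n y\<bar> \<le> (K + L) * \<bar>y - \<alpha>\<bar>"
      using lipschitz_onD[OF Gl[of n], of y \<alpha>] by (simp add: dist_real_def G_def)
    also have "\<dots> \<le> (K + L) * (\<beta> - \<alpha>)" using y KL by (intro mult_left_mono) auto
    finally show ?thesis by simp
  qed
  note int = integrable_lipschitz_on_interval
  obtain g' k1 where k1: "strict_mono (k1 :: nat \<Rightarrow> nat)"
    and unif: "\<And>e. 0 < e \<Longrightarrow> \<exists>N. \<forall>n x. n \<ge> N \<and> x \<in> {\<alpha>..\<beta>} \<longrightarrow> norm (G (k1 n) x - g' x) < e"
  proof (rule Arzela_Ascoli[of "{\<alpha>..\<beta>}" G "(K + L) * (\<beta> - \<alpha>)"])
    fix x e :: real assume "x \<in> {\<alpha>..\<beta>}" "0 < e"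
    show "\<exists>d>0. \<forall>n y. y \<in> {\<alpha>..\<beta>} \<and> norm (x - y) < d \<longrightarrow> norm (G n x - G n y) < e"
    proof (intro exI[of _ "e / (K + L + 1)"] conjI allI impI)
      show "0 < e / (K + L + 1)" using \<open>0 < e\<close> KL by simp
      fix n y assume y: "y \<in> {\<alpha>..\<beta>} \<and> norm (x - y) < e / (K + L + 1)"
      have "norm (G n x - G n y) \<le> (K + L) * norm (x - y)"
        using lipschitz_onD[OF Gl[of n], of x y] by (simp add: dist_real_def)
      also have "\<dots> \<le> (K + L + 1) * norm (x - y)" by (intro mult_right_mono) auto
      also have "\<dots> < e" using y KL by (simp add: pos_less_divide_eq mult.commute)
      finally show "norm (G n x - G n y) < e" .
    qed
  qed (use G\<alpha> in auto)
  \<comment> \<open>The uniform limit is known on the interval only; clamping the argument extends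
    it to the line with the same constant.\<close>
  define \<gamma> where "\<gamma> y = g' (max \<alpha> (min \<beta> y))" for y
  have \<gamma>J: "\<gamma> y = g' y" if "y \<in> {\<alpha>..\<beta>}" for y using that by (simp add: \<gamma>_def)
  have g'lip: "\<bar>g' x - g' y\<bar> \<le> (K + L) * \<bar>x - y\<bar>" if xy: "x \<in> {\<alpha>..\<beta>}" "y \<in> {\<alpha>..\<beta>}" for x y
  proof (rule field_le_epsilon)
    fix e :: real assume "0 < e"
    then obtain N where N: "\<And>z. z \<in> {\<alpha>..\<beta>} \<Longrightarrow> norm (G (k1 N) z - g' z) < e / 2"
      using unif[of "e / 2"] by auto
    show "\<bar>g' x - g' y\<bar> \<le> (K + L) * \<bar>x - y\<bar> + e"
      using N[OF xy(1)] N[OF xy(2)] lipschitz_onD[OF Gl[of "k1 N"] UNIV_I UNIV_I, of x y]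
      unfolding dist_real_def real_norm_def by linarith
  qed
  have \<gamma>l: "(K + L)-lipschitz_on UNIV \<gamma>"
  proof (rule lipschitz_onI[OF _ KL])
    fix x y
    have "\<bar>\<gamma> x - \<gamma> y\<bar> \<le> (K + L) * \<bar>max \<alpha> (min \<beta> x) - max \<alpha> (min \<beta> y)\<bar>"
      unfolding \<gamma>_def using \<alpha>\<beta> by (intro g'lip) auto
    also have "\<dots> \<le> (K + L) * \<bar>x - y\<bar>" using KL by (intro mult_left_mono) auto
    finally show "dist (\<gamma> x) (\<gamma> y) \<le> (K + L) * dist x y" by (simp add: dist_real_def)
  qed
  have \<gamma>lJ: "(K + L)-lipschitz_on {\<alpha>..\<beta>} \<gamma>" by (rule lipschitz_on_subset[OF \<gamma>l]) simp
  have "\<exists>r Q. strict_mono (r :: nat \<Rightarrow> nat) \<and> prob_space Q \<and> sets Q = sets borel \<and>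
      (AE z in Q. z \<in> {\<alpha>..\<beta>} \<times> {\<alpha>..\<beta>}) \<and>
      (\<forall>F :: real \<times> real \<Rightarrow> real. F \<in> borel_measurable borel \<longrightarrow> continuous_on ({\<alpha>..\<beta>} \<times> {\<alpha>..\<beta>}) F \<longrightarrow>
        (\<lambda>n. \<integral>z. F z \<partial>P (k1 (r n))) \<longlonglongrightarrow> (\<integral>z. F z \<partial>Q))"
    by (rule square_weak_subsequence[OF less_imp_le[OF \<alpha>\<beta>], of "\<lambda>n. P (k1 n)", OF P(1) P(2) P(3)[unfolded J2_def]])
      (intro exI conjI allI impI; assumption | blast)
  then obtain r Q where r: "strict_mono (r :: nat \<Rightarrow> nat)" and Q: "prob_space Q" "sets Q = sets borel"
    and QJ: "AE z in Q. z \<in> {\<alpha>..\<beta>} \<times> {\<alpha>..\<beta>}"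
    and lim: "\<And>F :: real \<times> real \<Rightarrow> real. F \<in> borel_measurable borel \<Longrightarrow> continuous_on ({\<alpha>..\<beta>} \<times> {\<alpha>..\<beta>}) F \<Longrightarrow>
       (\<lambda>n. \<integral>z. F z \<partial>P (k1 (r n))) \<longlonglongrightarrow> (\<integral>z. F z \<partial>Q)"
    by blast
  have limc: "(\<lambda>n. \<integral>z. F z \<partial>P (k1 (r n))) \<longlonglongrightarrow> (\<integral>z. F z \<partial>Q)"
    if "continuous_on UNIV F" for F :: "real \<times> real \<Rightarrow> real"
    using that by (intro lim borel_measurable_continuous_onI) (auto intro: continuous_on_subset)
  have s: "strict_mono (\<lambda>n. k1 (r n))" using k1 r by (simp add: strict_mono_def)
  have small: "(\<lambda>n. B * (1 / Suc (k1 (r n)))) \<longlonglongrightarrow> 0" for B :: real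
    using tendsto_mult_right_zero[OF LIMSEQ_subseq_LIMSEQ[OF LIMSEQ_inverse_real_of_nat s], of B]
    by (simp add: comp_def inverse_eq_divide)
  interpret Q: prob_space Q by (rule Q)
  note Q(2)[measurable_cong]
  have marg: "(\<integral>z. f (pr z) \<partial>Q) = (\<integral>x. f x \<partial>M)"
    if f: "B-lipschitz_on UNIV f" and pr: "continuous_on UNIV pr"
      and b: "\<And>n. \<bar>(\<integral>z. f (pr z) \<partial>P n) - (\<integral>x. f x \<partial>M)\<bar> \<le> B * (1 / Suc n)"
    for f :: "real \<Rightarrow> real" and pr :: "real \<times> real \<Rightarrow> real" and M B
  proof -
    have "(\<lambda>n. \<integral>z. f (pr z) \<partial>P (k1 (r n))) \<longlonglongrightarrow> (\<integral>z. f (pr z) \<partial>Q)"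
      by (intro limc continuous_on_compose2[OF lipschitz_on_continuous_on[OF f] pr]) simp
    moreover have "(\<lambda>n. \<integral>z. f (pr z) \<partial>P (k1 (r n))) \<longlonglongrightarrow> (\<integral>x. f x \<partial>M)"
      by (rule LIM_zero_cancel, rule Lim_null_comparison[OF _ small[of B]]) (use b in \<open>auto intro!: always_eventually\<close>)
    ultimately show ?thesis by (rule LIMSEQ_unique)
  qed
  have dist: "distr Q borel pr = M"
    if M: "prob_space M" "sets M = sets borel" and pr: "continuous_on UNIV pr"
      and b: "\<And>n f B. B-lipschitz_on UNIV f \<Longrightarrow> \<bar>(\<integral>z. f (pr z) \<partial>P n) - (\<integral>x. f x \<partial>M)\<bar> \<le> B * (1 / Suc n)"
    for pr :: "real \<times> real \<Rightarrow> real" and M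
  proof (rule finite_borel_measure_eqI_lipschitz)
    have m: "pr \<in> measurable Q borel"
      using borel_measurable_continuous_onI[OF pr] by (simp cong: measurable_cong_sets)
    then show "finite_measure (distr Q borel pr)" by (intro prob_space.finite_measure Q.prob_space_distr)
    show "(\<integral>x. f x \<partial>distr Q borel pr) = (\<integral>x. f x \<partial>M)" if f: "B-lipschitz_on UNIV f" for f :: "real \<Rightarrow> real" and B
    proof -
      have "f \<in> borel_measurable borel" using f by (intro borel_measurable_continuous_onI lipschitz_on_continuous_on)
      then have "(\<integral>x. f x \<partial>distr Q borel pr) = (\<integral>z. f (pr z) \<partial>Q)" by (intro integral_distr m)
      then show ?thesis using marg[OF f pr b[OF f]] by simp
    qed
  qed (use M in \<open>auto intro: prob_space.finite_measure\<close>)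
  have d1: "distr Q borel fst = \<mu>"
    by (rule dist[OF \<mu>(1,2)]) (use ok in \<open>auto simp: ok_def intro: continuous_intros\<close>)
  have d2: "distr Q borel snd = \<nu>"
    by (rule dist[OF \<nu>(1,2)]) (use ok in \<open>auto simp: ok_def intro: continuous_intros\<close>)
  have mart0: "(\<integral>z. f (fst z) * (snd z - fst z) \<partial>Q) = 0" if f: "B-lipschitz_on UNIV f" for f :: "real \<Rightarrow> real" and B
  proof -
    have c: "continuous_on UNIV f" using f by (rule lipschitz_on_continuous_on)
    have "(\<lambda>n. \<integral>z. f (fst z) * (snd z - fst z) \<partial>P (k1 (r n))) \<longlonglongrightarrow> (\<integral>z. f (fst z) * (snd z - fst z) \<partial>Q)"
      by (intro limc continuous_intros continuous_on_compose2[OF c]) auto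
    moreover have "(\<integral>z. f (fst z) * (snd z - fst z) \<partial>P n) = 0" for n
      using ok[of n] borel_measurable_continuous_onI[OF c] by (auto simp: ok_def)
    ultimately show ?thesis by (simp add: LIMSEQ_const_iff)
  qed
  \<comment> \<open>Indicators are not continuous, so the weak limit yields Lipschitz tests first
    and Borel sets by extension.\<close>
  have mart: "(\<integral>z. indicator A (fst z) * (snd z - fst z) \<partial>Q) = 0" if "A \<in> sets borel" for A
    by (rule martingale_test_extension[OF Q QJ, of "indicator A" 1]) (use that mart0 in \<open>auto simp: indicator_def\<close>)
  have "integrable Q pr" if pr: "pr \<in> borel_measurable borel" "\<And>z. z \<in> {\<alpha>..\<beta>} \<times> {\<alpha>..\<beta>} \<Longrightarrow> pr z \<in> {\<alpha>..\<beta>}" for pr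
  proof (rule Q.integrable_const_bound)
    show "AE z in Q. norm (pr z) \<le> max \<bar>\<alpha>\<bar> \<bar>\<beta>\<bar>"
      using QJ
    proof eventually_elim
      case (elim z)
      then show ?case using pr(2)[of z] by auto
    qed
  qed (use pr(1) in simp)
  then have ifs: "integrable Q fst" "integrable Q snd"
    by (auto simp: borel_measurable_fst_snd)
  show thesis
  proof (rule that[OF _ \<gamma>l])
    show "Q \<in> mart_couplings \<mu> \<nu>"
      unfolding mart_couplings_def using Q d1 d2 ifs mart by blast
    show "(\<integral>z. C (fst z) (snd z) \<partial>Q) \<le> (\<integral>y. \<gamma> y \<partial>\<nu>) - (\<integral>x. dual_f \<gamma> x \<partial>\<mu>)"
    proof (rule field_le_epsilon)
      fix e :: real assume e: "0 < e"
      obtain N where N: "\<And>n x. n \<ge> N \<Longrightarrow> x \<in> {\<alpha>..\<beta>} \<Longrightarrow> \<bar>G (k1 n) x - \<gamma> x\<bar> < e / 2"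
        using unif[of "e / 2"] e \<gamma>J by auto
      let ?V = "(\<integral>y. \<gamma> y \<partial>\<nu>) - (\<integral>x. dual_f \<gamma> x \<partial>\<mu>) + e"
      have "(\<integral>z. C (fst z) (snd z) \<partial>P (k1 (r n))) \<le> ?V + (2 * K + 3 * L) * (1 / Suc (k1 (r n)))" if n: "N \<le> n" for n
      proof -
        let ?j = "k1 (r n)"
        have rn: "N \<le> r n" using n seq_suble[OF r, of n] by linarith
        interpret \<mu>: prob_space \<mu> by (rule \<mu>)
        interpret \<nu>: prob_space \<nu> by (rule \<nu>)
        have sh: "dual_f (G ?j) x = dual_f (g ?j) x - g ?j \<alpha>" for x
          unfolding G_def by (rule dual_f_shift[OF glJ])
        have i1: "integrable \<mu> (dual_f (g ?j))" by (rule int[OF \<mu> dual_f_lipschitz[OF glJ]])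
        have i2: "integrable \<mu> (dual_f (G ?j))" by (rule int[OF \<mu> dual_f_lipschitz[OF GlJ]])
        have i3: "integrable \<mu> (dual_f \<gamma>)" by (rule int[OF \<mu> dual_f_lipschitz[OF \<gamma>lJ]])
        have v1: "(\<integral>y. G ?j y \<partial>\<nu>) = (\<integral>y. g ?j y \<partial>\<nu>) - g ?j \<alpha>"
          unfolding G_def using int[OF \<nu> gl[of ?j]] by (simp add: \<nu>.prob_space)
        have v2: "(\<integral>x. dual_f (G ?j) x \<partial>\<mu>) = (\<integral>x. dual_f (g ?j) x \<partial>\<mu>) - g ?j \<alpha>"
          unfolding sh using i1 by (simp add: \<mu>.prob_space)
        have v3: "(\<integral>y. G ?j y \<partial>\<nu>) \<le> (\<integral>y. \<gamma> y \<partial>\<nu>) + e / 2"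
        proof -
          have "(\<integral>y. G ?j y \<partial>\<nu>) \<le> (\<integral>y. \<gamma> y + e / 2 \<partial>\<nu>)"
          proof (rule integral_mono_AE)
            show "AE y in \<nu>. G ?j y \<le> \<gamma> y + e / 2"
              using \<nu>(3)
            proof eventually_elim
              case (elim y)
              then show ?case using N[OF rn, of y] by linarith
            qed
          qed (use int[OF \<nu> Gl[of ?j]] int[OF \<nu> \<gamma>l] in auto)
          then show ?thesis using int[OF \<nu> \<gamma>l] by (simp add: \<nu>.prob_space)
        qed
        have v4: "(\<integral>x. dual_f \<gamma> x \<partial>\<mu>) \<le> (\<integral>x. dual_f (G ?j) x \<partial>\<mu>) + e / 2"
        proof -
          have "dual_f \<gamma> x \<le> dual_f (G ?j) x + e / 2" for x
          proof (rule dual_f_mono[OF \<gamma>lJ GlJ])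
            show "\<gamma> y \<le> G ?j y + e / 2" if "y \<in> {\<alpha>..\<beta>}" for y using N[OF rn that] by linarith
          qed
          then have "(\<integral>x. dual_f \<gamma> x \<partial>\<mu>) \<le> (\<integral>x. dual_f (G ?j) x + e / 2 \<partial>\<mu>)"
            using i2 i3 by (intro integral_mono) auto
          then show ?thesis using i2 by (simp add: \<mu>.prob_space)
        qed
        have "(\<integral>z. C (fst z) (snd z) \<partial>P ?j) \<le> (\<integral>y. g ?j y \<partial>\<nu>) - (\<integral>x. dual_f (g ?j) x \<partial>\<mu>) + (2 * K + 3 * L) * (1 / Suc ?j)"
          using ok[of ?j] unfolding ok_def by blast
        then show ?thesis using v1 v2 v3 v4 by linarith
      qed
      then have ev: "\<exists>N. \<forall>n\<ge>N. (\<integral>z. C (fst z) (snd z) \<partial>P (k1 (r n))) \<le> ?V + (2 * K + 3 * L) * (1 / Suc (k1 (r n)))"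
        by blast
      have "(\<lambda>n. ?V + (2 * K + 3 * L) * (1 / Suc (k1 (r n)))) \<longlonglongrightarrow> ?V + 0"
        by (intro tendsto_add tendsto_const small)
      then show "(\<integral>z. C (fst z) (snd z) \<partial>Q) \<le> ?V"
        using LIMSEQ_le[OF limc[OF continuous_C] _ ev] by simp
    qed
  qed
qed

end

subsection \<open>Dual maximizers\<close>

text \<open>The complement of the support is a union of null balls, and by Lindelof countably many
  of them cover it.\<close>

lemma AE_in_supp:
  assumes "sets \<nu> = sets borel"
  shows "AE y in \<nu>. y \<in> supp \<nu>"
proof -
  define F where "F = {ball x e | x e. 0 < e \<and> emeasure \<nu> (ball x e) = 0}"
  obtain F' where F': "F' \<subseteq> F" "countable F'" "\<Union>F' = \<Union>F"
    using Lindelof[of F] by (auto simp: F_def)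
  have "\<Union>F' \<in> null_sets \<nu>"
    using F'(1,2) assms by (intro null_sets_UN'[of F' "\<lambda>S. S", simplified]) (auto simp: F_def null_sets_def)
  then have "AE y in \<nu>. y \<notin> \<Union>F" unfolding F'(3) by (rule AE_not_in)
  then show ?thesis
  proof eventually_elim
    case (elim y)
    have "emeasure \<nu> (ball y e) \<noteq> 0" if "0 < e" for e
    proof
      assume "emeasure \<nu> (ball y e) = 0"
      then have "ball y e \<in> F" using that by (auto simp: F_def)
      then show False using elim that by (meson UnionI centre_in_ball)
    qed
    then show ?case by (simp add: supp_def zero_less_iff_neq_zero)
  qed
qed

lemma mart_couplings_AE:
  assumes P: "P \<in> mart_couplings \<mu> \<nu>" and \<mu>: "AE x in \<mu>. x \<in> S" and \<nu>: "AE y in \<nu>. y \<in> T"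
  shows "AE z in P. z \<in> S \<times> T"
proof -
  have m: "fst \<in> measurable P borel" "snd \<in> measurable P borel" and d: "distr P borel fst = \<mu>" "distr P borel snd = \<nu>"
    using P by (auto simp: mart_couplings_def borel_measurable_fst_snd cong: measurable_cong_sets)
  have "AE z in P. fst z \<in> S" "AE z in P. snd z \<in> T"
    using AE_distrD[OF m(1), of "\<lambda>x. x \<in> S"] AE_distrD[OF m(2), of "\<lambda>y. y \<in> T"] \<mu> \<nu> unfolding d by blast+
  then show ?thesis by eventually_elim (simp add: mem_Times_iff)
qed

lemma expect_c_eq_integral:
  assumes i: "integrable P (\<lambda>z. c (fst z) (snd z))"
  shows "expect_c P c = ereal (\<integral>z. c (fst z) (snd z) \<partial>P)"
proof -
  have ip: "integrable P (\<lambda>z. max (c (fst z) (snd z)) 0)" and im: "integrable P (\<lambda>z. max (- c (fst z) (snd z)) 0)"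
    using i by auto
  have "(\<integral>z. max (c (fst z) (snd z)) 0 \<partial>P) - (\<integral>z. max (- c (fst z) (snd z)) 0 \<partial>P) = (\<integral>z. c (fst z) (snd z) \<partial>P)"
    by (subst Bochner_Integration.integral_diff[OF ip im, symmetric]) (auto intro!: Bochner_Integration.integral_cong simp: max_def)
  moreover have "0 \<le> (\<integral>z. max (c (fst z) (snd z)) 0 \<partial>P)" "0 \<le> (\<integral>z. max (- c (fst z) (snd z)) 0 \<partial>P)"
    by (auto intro!: integral_nonneg_AE)
  ultimately show ?thesis
    unfolding expect_c_def
    by (subst (1 2) nn_integral_eq_integral) (use ip im in \<open>auto simp: enn2ereal_ennreal\<close>)
qed

lemma lsc_cost_measurable:
  assumes "lsc_cost c"
  shows "(\<lambda>z. c (fst z) (snd z)) \<in> borel_measurable borel"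
  using assms by (intro borel_measurableI_le) (simp add: lsc_cost_def)

lemma convex_put: "convex_on UNIV (\<lambda>x::real. max 0 (p - x))" "convex_on UNIV (\<lambda>x::real. max 0 (x - p))"
proof -
  have a: "convex_on UNIV (\<lambda>x. max 0 (s * x + r))" for s r :: real
  proof (rule convex_onI)
    fix t x y :: real assume t: "0 < t" "t < 1"
    have "s * ((1 - t) * x + t * y) + r = (1 - t) * (s * x + r) + t * (s * y + r)" by (simp add: algebra_simps)
    also have "\<dots> \<le> (1 - t) * max 0 (s * x + r) + t * max 0 (s * y + r)"
      using t by (intro add_mono mult_left_mono) auto
    finally show "max 0 (s * ((1 - t) *\<^sub>R x + t *\<^sub>R y) + r) \<le> (1 - t) * max 0 (s * x + r) + t * max 0 (s * y + r)"
      using t by simp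
  qed simp
  show "convex_on UNIV (\<lambda>x::real. max 0 (p - x))" "convex_on UNIV (\<lambda>x::real. max 0 (x - p))"
    using a[of "-1" p] a[of 1 "-p"] by (simp_all add: algebra_simps)
qed

text \<open>Everything comes from testing the order: \<open>x\<close> and \<open>- x\<close> give
  equal means, and the functions \<open>max 0 (\<alpha> - x)\<close> and
  \<open>max 0 (x - \<beta>)\<close>, which vanish \<nu>-almost surely, must vanish \<mu>-almost
  surely, so \<mu> does not leave the interval.\<close>

lemma convex_order_interval:
  assumes o: "convex_order \<mu> \<nu>" and \<nu>: "AE y in \<nu>. y \<in> {\<alpha>..\<beta>}"
    and finite: "finite_measure \<mu>" "finite_measure \<nu>"
  shows "(\<integral>x. x \<partial>\<mu>) = (\<integral>y. y \<partial>\<nu>)"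
    and "(\<integral>x. max 0 (p - x) \<partial>\<mu>) \<le> (\<integral>y. max 0 (p - y) \<partial>\<nu>)"
    and "AE x in \<mu>. x \<in> {\<alpha>..\<beta>}"
proof -
  interpret \<mu>: finite_measure \<mu> by (rule finite)
  interpret \<nu>: finite_measure \<nu> by (rule finite)
  have i: "integrable \<mu> (\<lambda>x. x)" "integrable \<nu> (\<lambda>x. x)" using o by (auto simp: convex_order_def)
  have le: "(\<integral>x. \<xi> x \<partial>\<mu>) \<le> (\<integral>x. \<xi> x \<partial>\<nu>)" if "convex_on UNIV \<xi>" "integrable \<mu> \<xi>" "integrable \<nu> \<xi>" for \<xi>
    using o that by (auto simp: convex_order_def)
  have lin: "convex_on UNIV (\<lambda>x::real. x)" "convex_on UNIV (\<lambda>x::real. - x)"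
    by (auto intro!: convex_onI simp: algebra_simps)
  show "(\<integral>x. x \<partial>\<mu>) = (\<integral>y. y \<partial>\<nu>)"
    using le[OF lin(1)] le[OF lin(2)] i by auto
  have ip: "integrable \<mu> (\<lambda>x. max 0 (p - x))" "integrable \<nu> (\<lambda>x. max 0 (p - x))"
    "integrable \<mu> (\<lambda>x. max 0 (x - p))" "integrable \<nu> (\<lambda>x. max 0 (x - p))" for p
    using i by auto
  show "(\<integral>x. max 0 (p - x) \<partial>\<mu>) \<le> (\<integral>y. max 0 (p - y) \<partial>\<nu>)"
    by (rule le[OF convex_put(1) ip(1,2)])
  have z: "AE x in \<mu>. \<xi> x = 0"
    if "convex_on UNIV \<xi>" "integrable \<mu> \<xi>" "integrable \<nu> \<xi>" "\<And>x. 0 \<le> \<xi> x" "\<And>x. x \<in> {\<alpha>..\<beta>} \<Longrightarrow> \<xi> x = 0" for \<xi>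
  proof -
    have "AE y in \<nu>. \<xi> y = 0" using \<nu> by eventually_elim (rule that(5))
    then have "(\<integral>x. \<xi> x \<partial>\<nu>) = 0" by (rule integral_eq_zero_AE)
    then have "(\<integral>x. \<xi> x \<partial>\<mu>) \<le> 0" using le[OF that(1-3)] by simp
    moreover have "0 \<le> (\<integral>x. \<xi> x \<partial>\<mu>)" by (rule integral_nonneg_AE) (simp add: that(4))
    ultimately have "(\<integral>x. \<xi> x \<partial>\<mu>) = 0" by (rule antisym)
    then show ?thesis using integral_nonneg_eq_0_iff_AE[OF that(2)] that(4) by simp
  qed
  have "AE x in \<mu>. max 0 (\<alpha> - x) = 0" "AE x in \<mu>. max 0 (x - \<beta>) = 0"
    by (rule z[OF convex_put(1) ip(1,2)] z[OF convex_put(2) ip(3,4)]; simp)+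
  then show "AE x in \<mu>. x \<in> {\<alpha>..\<beta>}" by eventually_elim (simp add: max_def split: if_splits)
qed

lemma mart_couplings_test_integral:
  assumes P: "P \<in> mart_couplings \<mu> \<nu>" and sq: "AE z in P. z \<in> {\<alpha>..\<beta>} \<times> {\<alpha>..\<beta>}"
    and h: "h \<in> borel_measurable borel" "\<And>x. x \<in> {\<alpha>..\<beta>} \<Longrightarrow> \<bar>h x\<bar> \<le> D"
  shows "integrable P (\<lambda>z. h (fst z) * (snd z - fst z))" "(\<integral>z. h (fst z) * (snd z - fst z) \<partial>P) = 0"
proof -
  have PP: "prob_space P" "sets P = sets borel" using P by (auto simp: mart_couplings_def)
  show "(\<integral>z. h (fst z) * (snd z - fst z) \<partial>P) = 0"
    by (rule martingale_test_extension[OF PP sq _ h]) (use P in \<open>auto simp: mart_couplings_def\<close>)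
  have m: "(\<lambda>z. h (fst z) * (snd z - fst z)) \<in> borel_measurable borel"
    by (intro borel_measurable_times borel_measurable_diff borel_measurable_fst_snd
        measurable_compose[OF borel_measurable_fst_snd(1) h(1)])
  have "\<bar>h (fst z) * (snd z - fst z)\<bar> \<le> D * (\<beta> - \<alpha>)" if "z \<in> {\<alpha>..\<beta>} \<times> {\<alpha>..\<beta>}" for z
    unfolding abs_mult using that h(2)[of "fst z"] by (intro mult_mono) (auto simp: mem_Times_iff abs_le_iff)
  then show "integrable P (\<lambda>z. h (fst z) * (snd z - fst z))"
    by (rule finite_measure_integrable_bounded_on[OF prob_space.finite_measure[OF PP(1)] PP(2) sq m])
qed

text \<open>Infinite values off the interval make the pointwise inequality trivial there, so
  feasibility is required on the square only. The term with \<open>h\<close> integrates to zero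
  under every martingale coupling, which leaves the cost minus the dual value as the mean of the
  gap.\<close>

lemma dual_maximizer_of_real_functions:
  fixes F G h :: "real \<Rightarrow> real"
  assumes \<mu>: "prob_space \<mu>" "sets \<mu> = sets borel" "AE x in \<mu>. x \<in> {\<alpha>..\<beta>}"
    and \<nu>: "prob_space \<nu>" "sets \<nu> = sets borel" "AE x in \<nu>. x \<in> {\<alpha>..\<beta>}"
    and c: "(\<lambda>z. c (fst z) (snd z)) \<in> borel_measurable borel"
    and cb: "\<And>z. z \<in> {\<alpha>..\<beta>} \<times> {\<alpha>..\<beta>} \<Longrightarrow> \<bar>c (fst z) (snd z)\<bar> \<le> D"
    and F: "LF-lipschitz_on UNIV F" and G: "LG-lipschitz_on UNIV G"
    and h: "h \<in> borel_measurable borel" "\<And>x. x \<in> {\<alpha>..\<beta>} \<Longrightarrow> \<bar>h x\<bar> \<le> K"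
    and feas: "\<And>x y. x \<in> {\<alpha>..\<beta>} \<Longrightarrow> y \<in> {\<alpha>..\<beta>} \<Longrightarrow> G y - F x - h x * (y - x) \<le> c x y"
    and val: "\<And>P. minimizer \<mu> \<nu> c P \<Longrightarrow> (\<integral>z. c (fst z) (snd z) \<partial>P) \<le> (\<integral>y. G y \<partial>\<nu>) - (\<integral>x. F x \<partial>\<mu>)"
  defines "f \<equiv> \<lambda>x. if x \<in> {\<alpha>..\<beta>} then ereal (F x) else \<infinity>"
    and "g \<equiv> \<lambda>y. if y \<in> {\<alpha>..\<beta>} then ereal (G y) else -\<infinity>"
  shows "dual_maximizer \<mu> \<nu> c f g h"
    and "minimizer \<mu> \<nu> c P \<Longrightarrow>
      ereal ((\<integral>y. indicator {\<alpha>..\<beta>} y * real_of_ereal (g y) \<partial>\<nu>)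
        - (\<integral>x. indicator {\<alpha>..\<beta>} x * real_of_ereal (f x) \<partial>\<mu>)) = expect_c P c"
proof -
  have mF: "F \<in> borel_measurable borel" and mG: "G \<in> borel_measurable borel"
    using F G by (auto intro: borel_measurable_continuous_onI lipschitz_on_continuous_on)
  note BF = lipschitz_bound_on_interval[OF F] and BG = lipschitz_bound_on_interval[OF G]
  have iF: "(\<integral>x. indicator {\<alpha>..\<beta>} x * real_of_ereal (f x) \<partial>\<mu>) = (\<integral>x. F x \<partial>\<mu>)"
  proof -
    have "(\<lambda>x. indicator {\<alpha>..\<beta>} x * real_of_ereal (f x)) = (\<lambda>x. indicator {\<alpha>..\<beta>} x * F x)"
      by (auto simp: f_def indicator_def)
    moreover have "(\<integral>x. indicator {\<alpha>..\<beta>} x * F x \<partial>\<mu>) = (\<integral>x. F x \<partial>\<mu>)"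
      using \<mu>(3) mF \<mu>(2) by (intro integral_cong_AE) (auto elim: eventually_mono cong: measurable_cong_sets)
    ultimately show ?thesis by simp
  qed
  have iG: "(\<integral>y. indicator {\<alpha>..\<beta>} y * real_of_ereal (g y) \<partial>\<nu>) = (\<integral>y. G y \<partial>\<nu>)"
  proof -
    have "(\<lambda>x. indicator {\<alpha>..\<beta>} x * real_of_ereal (g x)) = (\<lambda>x. indicator {\<alpha>..\<beta>} x * G x)"
      by (auto simp: g_def indicator_def)
    moreover have "(\<integral>x. indicator {\<alpha>..\<beta>} x * G x \<partial>\<nu>) = (\<integral>x. G x \<partial>\<nu>)"
      using \<nu>(3) mG \<nu>(2) by (intro integral_cong_AE) (auto elim: eventually_mono cong: measurable_cong_sets)
    ultimately show ?thesis by simp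
  qed
  have main: "(AE z in P. c (fst z) (snd z) = G (snd z) - F (fst z) - h (fst z) * (snd z - fst z)) \<and>
      (AE z in P. z \<in> {\<alpha>..\<beta>} \<times> {\<alpha>..\<beta>}) \<and> expect_c P c = ereal ((\<integral>y. G y \<partial>\<nu>) - (\<integral>x. F x \<partial>\<mu>))"
    if min: "minimizer \<mu> \<nu> c P" for P
  proof -
    have P: "P \<in> mart_couplings \<mu> \<nu>" using min by (simp add: minimizer_def)
    have PP: "prob_space P" "sets P = sets borel" and d: "distr P borel fst = \<mu>" "distr P borel snd = \<nu>"
      using P by (auto simp: mart_couplings_def)
    have sq: "AE z in P. z \<in> {\<alpha>..\<beta>} \<times> {\<alpha>..\<beta>}" by (rule mart_couplings_AE[OF P \<mu>(3) \<nu>(3)])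
    have m: "fst \<in> measurable P borel" "snd \<in> measurable P borel"
      using PP(2) by (auto simp: borel_measurable_fst_snd cong: measurable_cong_sets)
    note bnd = finite_measure_integrable_bounded_on[OF prob_space.finite_measure[OF PP(1)] PP(2) sq]
    have ic: "integrable P (\<lambda>z. c (fst z) (snd z))" by (rule bnd[OF c cb])
    have iFP: "integrable P (\<lambda>z. F (fst z))"
      by (rule bnd[OF measurable_compose[OF borel_measurable_fst_snd(1) mF] BF]) (auto simp: mem_Times_iff)
    have iGP: "integrable P (\<lambda>z. G (snd z))"
      by (rule bnd[OF measurable_compose[OF borel_measurable_fst_snd(2) mG] BG]) (auto simp: mem_Times_iff)
    note ih = mart_couplings_test_integral[OF P sq h]
    let ?R = "\<lambda>z. c (fst z) (snd z) - (G (snd z) - F (fst z) - h (fst z) * (snd z - fst z))"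
    have iR: "integrable P ?R"
      by (intro Bochner_Integration.integrable_diff ic iGP iFP ih(1))
    have eF: "(\<integral>z. F (fst z) \<partial>P) = (\<integral>x. F x \<partial>\<mu>)" unfolding d(1)[symmetric] by (rule integral_distr[symmetric, OF m(1) mF])
    have eG: "(\<integral>z. G (snd z) \<partial>P) = (\<integral>x. G x \<partial>\<nu>)" unfolding d(2)[symmetric] by (rule integral_distr[symmetric, OF m(2) mG])
    have R: "(\<integral>z. ?R z \<partial>P) = (\<integral>z. c (fst z) (snd z) \<partial>P) - ((\<integral>y. G y \<partial>\<nu>) - (\<integral>x. F x \<partial>\<mu>))"
      by (simp only: Bochner_Integration.integral_diff Bochner_Integration.integrable_diff ic iGP iFP ih eF eG diff_0_right)
    have R0: "AE z in P. 0 \<le> ?R z"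
      using sq
    proof eventually_elim
      case (elim z)
      then show ?case using feas[of "fst z" "snd z"] by (simp add: mem_Times_iff)
    qed
    have "0 \<le> (\<integral>z. ?R z \<partial>P)" using R0 by (rule integral_nonneg_AE)
    then have Rz: "(\<integral>z. ?R z \<partial>P) = 0" using R val[OF min] by simp
    then have "AE z in P. ?R z = 0" using integral_nonneg_eq_0_iff_AE[OF iR R0] by simp
    then have "AE z in P. c (fst z) (snd z) = G (snd z) - F (fst z) - h (fst z) * (snd z - fst z)"
      by eventually_elim simp
    moreover have "expect_c P c = ereal ((\<integral>y. G y \<partial>\<nu>) - (\<integral>x. F x \<partial>\<mu>))"
      using expect_c_eq_integral[OF ic] R Rz by simp
    ultimately show ?thesis using sq by blast
  qed
  show "dual_maximizer \<mu> \<nu> c f g h"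
    unfolding dual_maximizer_def
  proof (intro conjI allI impI)
    show "AE x in \<mu>. f x \<noteq> \<infinity>" using \<mu>(3) by eventually_elim (simp add: f_def)
    show "AE y in \<nu>. g y \<noteq> -\<infinity>" using \<nu>(3) by eventually_elim (simp add: g_def)
    show "g y - f x - ereal (h x * (y - x)) \<le> ereal (c x y)" for x y
      using feas[of x y] by (auto simp: f_def g_def)
    show "AE z in P. g (snd z) - f (fst z) - ereal (h (fst z) * (snd z - fst z)) = ereal (c (fst z) (snd z))"
      if "minimizer \<mu> \<nu> c P" for P
    proof -
      from main[OF that] have a: "AE z in P. c (fst z) (snd z) = G (snd z) - F (fst z) - h (fst z) * (snd z - fst z)"
        and b: "AE z in P. z \<in> {\<alpha>..\<beta>} \<times> {\<alpha>..\<beta>}" by auto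
      from a b show ?thesis by eventually_elim (auto simp: f_def g_def mem_Times_iff)
    qed
  qed (auto simp: f_def g_def)
  show "ereal ((\<integral>y. indicator {\<alpha>..\<beta>} y * real_of_ereal (g y) \<partial>\<nu>)
        - (\<integral>x. indicator {\<alpha>..\<beta>} x * real_of_ereal (f x) \<partial>\<mu>)) = expect_c P c" if "minimizer \<mu> \<nu> c P"
    using main[OF that] iF iG by simp
qed

section \<open>Reduction to a globally Lipschitz cost and conclusion\<close>

theorem theorem2p4:
  fixes \<mu> \<nu> :: "real measure" and c :: "real \<Rightarrow> real \<Rightarrow> real"
    and a b :: "real \<Rightarrow> real" and J :: "real set"
  assumes "prob_on_R \<mu>" and "prob_on_R \<nu>"
    and "convex_order \<mu> \<nu>"
    and J_def: "J = convex hull (supp \<nu>)"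
    and "compact J"
    and "lsc_cost c"
    and "integrable \<mu> a" and "integrable \<nu> b"
    and "\<And>x y. c x y \<le> a x + b y"
    and "\<bar>primal \<mu> \<nu> c\<bar> \<noteq> \<infinity>"
    and "\<exists>L. L-lipschitz_on (J \<times> J) (\<lambda>z. c (fst z) (snd z))"
    and "\<exists>u L. L-lipschitz_on J u \<and> (AE x in \<mu>. convex_on J (\<lambda>y. c x y + u y))"
  shows "\<exists>f g h. dual_maximizer \<mu> \<nu> c f g h
      \<and> (\<forall>x\<in>J. \<bar>f x\<bar> \<noteq> \<infinity>) \<and> (\<exists>L. L-lipschitz_on J (\<lambda>x. real_of_ereal (f x)))
      \<and> (\<forall>y\<in>J. \<bar>g y\<bar> \<noteq> \<infinity>) \<and> (\<exists>L. L-lipschitz_on J (\<lambda>y. real_of_ereal (g y)))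
      \<and> bounded (h ` J)
      \<and> (\<forall>P. minimizer \<mu> \<nu> c P \<longrightarrow>
           ereal ((\<integral>y. indicator J y * real_of_ereal (g y) \<partial>\<nu>)
                  - (\<integral>x. indicator J x * real_of_ereal (f x) \<partial>\<mu>)) = expect_c P c)"
proof -
  have \<mu>: "prob_space \<mu>" "sets \<mu> = sets borel" and \<nu>: "prob_space \<nu>" "sets \<nu> = sets borel"
    using assms(1,2) by (auto simp: prob_on_R_def)
  have "connected J" unfolding J_def by (rule convex_connected) (rule convex_convex_hull)
  then obtain \<alpha> \<beta> where J: "J = {\<alpha>..\<beta>}"
    using \<open>compact J\<close> connected_compact_interval_1[of J] by blast
  have \<nu>J: "AE y in \<nu>. y \<in> {\<alpha>..\<beta>}"
    using AE_in_supp[OF \<nu>(2)]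
  proof eventually_elim
    case (elim y)
    then show ?case using hull_subset[of "supp \<nu>" convex] unfolding J[symmetric] J_def by blast
  qed
  have \<alpha>\<beta>: "\<alpha> \<le> \<beta>"
  proof (rule ccontr)
    assume "\<not> \<alpha> \<le> \<beta>"
    then have "AE y in \<nu>. False" using \<nu>J by simp
    then show False using prob_space.AE_False[OF \<nu>(1)] by simp
  qed
  note fm = prob_space.finite_measure[OF \<mu>(1)] prob_space.finite_measure[OF \<nu>(1)]
  note co = convex_order_interval[OF assms(3) \<nu>J fm]
  note \<mu>' = \<mu> co(3) and \<nu>' = \<nu> \<nu>J
  have cm: "(\<lambda>z. c (fst z) (snd z)) \<in> borel_measurable borel"
    by (rule lsc_cost_measurable[OF assms(6)])
  obtain L1 where L1: "L1-lipschitz_on ({\<alpha>..\<beta>} \<times> {\<alpha>..\<beta>}) (\<lambda>z. c (fst z) (snd z))" using assms(11) unfolding J by blast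
  obtain u L2 where L2: "L2-lipschitz_on {\<alpha>..\<beta>} u" and conv: "AE x in \<mu>. convex_on {\<alpha>..\<beta>} (\<lambda>y. c x y + u y)"
    using assms(12) unfolding J by blast
  have L12: "0 \<le> L1" "0 \<le> L2" by (rule lipschitz_on_nonneg[OF L1], rule lipschitz_on_nonneg[OF L2])
  have "bounded ((\<lambda>z. c (fst z) (snd z)) ` ({\<alpha>..\<beta>} \<times> {\<alpha>..\<beta>}))"
    by (intro compact_imp_bounded compact_continuous_image lipschitz_on_continuous_on[OF L1] compact_Times compact_Icc)
  then obtain D where D0: "\<forall>w\<in>(\<lambda>z. c (fst z) (snd z)) ` ({\<alpha>..\<beta>} \<times> {\<alpha>..\<beta>}). \<bar>w\<bar> \<le> D"
    unfolding bounded_real ..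
  have D: "\<bar>c (fst z) (snd z)\<bar> \<le> D" if "z \<in> {\<alpha>..\<beta>} \<times> {\<alpha>..\<beta>}" for z
    using D0[THEN bspec, OF imageI[OF that]] .
  have fin: "integrable P (\<lambda>z. c (fst z) (snd z))" if "P \<in> mart_couplings \<mu> \<nu>" for P
  proof -
    have "prob_space P" "sets P = sets borel" using that by (auto simp: mart_couplings_def)
    then show ?thesis
      by (rule finite_measure_integrable_bounded_on[OF prob_space.finite_measure _ mart_couplings_AE[OF that \<mu>'(3) \<nu>'(3)] cm D])
  qed
  \<comment> \<open>Common end of the degenerate and the general case: real functions on the line
    are turned into the extended-valued triple.\<close>
  have goal: ?thesis
    if F: "LF-lipschitz_on UNIV F" and G: "LG-lipschitz_on UNIV G"
    and h: "h \<in> borel_measurable borel" "\<And>x. x \<in> {\<alpha>..\<beta>} \<Longrightarrow> \<bar>h x\<bar> \<le> K"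
    and feas: "\<And>x y. x \<in> {\<alpha>..\<beta>} \<Longrightarrow> y \<in> {\<alpha>..\<beta>} \<Longrightarrow> G y - F x - h x * (y - x) \<le> c x y"
    and val: "\<And>P. minimizer \<mu> \<nu> c P \<Longrightarrow> (\<integral>z. c (fst z) (snd z) \<partial>P) \<le> (\<integral>y. G y \<partial>\<nu>) - (\<integral>x. F x \<partial>\<mu>)"
    for F G h :: "real \<Rightarrow> real" and LF LG K
  proof -
    let ?f = "\<lambda>x. if x \<in> {\<alpha>..\<beta>} then ereal (F x) else \<infinity>" and ?g = "\<lambda>y. if y \<in> {\<alpha>..\<beta>} then ereal (G y) else -\<infinity>"
    note R = dual_maximizer_of_real_functions[OF \<mu>' \<nu>' cm D F G h feas val]
    have lF: "LF-lipschitz_on J (\<lambda>x. real_of_ereal (?f x))" and lG: "LG-lipschitz_on J (\<lambda>x. real_of_ereal (?g x))"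
      using F G by (auto simp: J lipschitz_on_def)
    have hb: "bounded (h ` J)" unfolding J bounded_real using h(2) by blast
    have "dual_maximizer \<mu> \<nu> c ?f ?g h" by (rule R(1))
    moreover have "\<forall>P. minimizer \<mu> \<nu> c P \<longrightarrow>
           ereal ((\<integral>y. indicator J y * real_of_ereal (?g y) \<partial>\<nu>)
                  - (\<integral>x. indicator J x * real_of_ereal (?f x) \<partial>\<mu>)) = expect_c P c"
      unfolding J by (intro allI impI R(2))
    moreover have "\<forall>x\<in>J. \<bar>?f x\<bar> \<noteq> \<infinity>" "\<forall>y\<in>J. \<bar>?g y\<bar> \<noteq> \<infinity>" by (simp_all add: J)
    ultimately show ?thesis using lF lG hb by blast
  qed
  show ?thesis
  proof (cases "\<alpha> = \<beta>")
    \<comment> \<open>On a single point the cost is almost surely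
      \<open>c \<alpha> \<alpha>\<close>, so a constant \<open>g\<close> with
      \<open>f = h = 0\<close> attains the value.\<close>
    case True
    show ?thesis
    proof (rule goal[of 0 "\<lambda>_. 0" 0 "\<lambda>_. c \<alpha> \<alpha>" "\<lambda>_. 0" 0])
      fix P assume "minimizer \<mu> \<nu> c P"
      then have P: "P \<in> mart_couplings \<mu> \<nu>" by (simp add: minimizer_def)
      then interpret P: prob_space P by (simp add: mart_couplings_def)
      have "AE z in P. c (fst z) (snd z) = c \<alpha> \<alpha>"
        using mart_couplings_AE[OF P \<mu>'(3) \<nu>'(3)] by eventually_elim (auto simp: True mem_Times_iff)
      then have "(\<integral>z. c (fst z) (snd z) \<partial>P) = (\<integral>z. c \<alpha> \<alpha> \<partial>P)"
        using fin[OF P] by (intro integral_cong_AE) auto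
      then show "(\<integral>z. c (fst z) (snd z) \<partial>P) \<le> (\<integral>y. c \<alpha> \<alpha> \<partial>\<nu>) - (\<integral>x. 0 \<partial>\<mu>)"
        using prob_space.prob_space[OF \<nu>(1)] by (simp add: P.prob_space)
    qed (auto simp: True lipschitz_on_def)
  next
    case False
    \<comment> \<open>Projection onto the interval is nonexpansive, so composing with it extends
      \<open>c\<close> and \<open>u\<close> to the whole line with their Lipschitz
      constants.\<close>
    define cl where "cl x = max \<alpha> (min \<beta> x)" for x
    have cl: "cl x \<in> {\<alpha>..\<beta>}" "\<bar>cl x - cl y\<bar> \<le> \<bar>x - y\<bar>" "x \<in> {\<alpha>..\<beta>} \<Longrightarrow> cl x = x" for x y
      using \<alpha>\<beta> by (auto simp: cl_def)
    define C where "C x y = c (cl x) (cl y) + u (cl y)" for x y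
    define L where "L = L1 + L2"
    have ucl: "\<bar>u (cl y) - u (cl y')\<bar> \<le> L2 * \<bar>y - y'\<bar>" for y y'
    proof -
      have "\<bar>u (cl y) - u (cl y')\<bar> \<le> L2 * \<bar>cl y - cl y'\<bar>"
        using lipschitz_onD[OF L2 cl(1) cl(1)] by (simp add: dist_real_def)
      also have "\<dots> \<le> L2 * \<bar>y - y'\<bar>" using cl(2) L12 by (intro mult_left_mono)
      finally show ?thesis .
    qed
    interpret lipschitz_cost C L "L + 1" \<alpha> \<beta>
    proof
      show "\<alpha> < \<beta>" using \<alpha>\<beta> False by simp
      show "\<bar>C x y - C x' y'\<bar> \<le> L * (\<bar>x - x'\<bar> + \<bar>y - y'\<bar>)" for x y x' y'
      proof -
        have "\<bar>c (cl x) (cl y) - c (cl x') (cl y')\<bar> \<le> L1 * dist (cl x, cl y) (cl x', cl y')"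
          using lipschitz_onD[OF L1, of "(cl x, cl y)" "(cl x', cl y')"] cl(1) by (simp add: dist_real_def)
        also have "\<dots> \<le> L1 * (\<bar>x - x'\<bar> + \<bar>y - y'\<bar>)"
        proof (rule mult_left_mono[OF _ L12(1)])
          have "dist (cl x, cl y) (cl x', cl y') \<le> \<bar>cl x - cl x'\<bar> + \<bar>cl y - cl y'\<bar>"
            unfolding dist_Pair_Pair dist_real_def using sqrt_sum_squares_le_sum_abs[of "\<bar>cl x - cl x'\<bar>" "\<bar>cl y - cl y'\<bar>"] by simp
          also have "\<dots> \<le> \<bar>x - x'\<bar> + \<bar>y - y'\<bar>" by (intro add_mono cl(2))
          finally show "dist (cl x, cl y) (cl x', cl y') \<le> \<bar>x - x'\<bar> + \<bar>y - y'\<bar>" .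
        qed
        finally have "\<bar>c (cl x) (cl y) - c (cl x') (cl y')\<bar> \<le> L1 * (\<bar>x - x'\<bar> + \<bar>y - y'\<bar>)" .
        moreover have "L2 * \<bar>y - y'\<bar> \<le> L2 * (\<bar>x - x'\<bar> + \<bar>y - y'\<bar>)" using L12 by (intro mult_left_mono) auto
        ultimately have "\<bar>C x y - C x' y'\<bar> \<le> L1 * (\<bar>x - x'\<bar> + \<bar>y - y'\<bar>) + L2 * (\<bar>x - x'\<bar> + \<bar>y - y'\<bar>)"
          using ucl[of y y'] unfolding C_def by linarith
        then show ?thesis by (simp add: L_def algebra_simps)
      qed
    qed (use L12 in \<open>auto simp: L_def\<close>)
    have convC: "AE x in \<mu>. convex_on {\<alpha>..\<beta>} (C x)"
      using conv co(3)
    proof eventually_elim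
      case (elim x)
      have "C x y = c x y + u y" if "y \<in> {\<alpha>..\<beta>}" for y using that elim(2) by (simp add: C_def cl(3))
      moreover have "u *\<^sub>R y + v *\<^sub>R z \<in> {\<alpha>..\<beta>}"
        if "y \<in> {\<alpha>..\<beta>}" "z \<in> {\<alpha>..\<beta>}" "0 \<le> u" "0 \<le> v" "u + v = 1" for u v y z
        using convexD[OF convex_real_interval(5) that] .
      ultimately show ?case using elim(1) unfolding convex_on_def by simp
    qed
    obtain Q g where Q: "Q \<in> mart_couplings \<mu> \<nu>" and g: "(L + 1 + L)-lipschitz_on UNIV g"
      and val: "(\<integral>z. C (fst z) (snd z) \<partial>Q) \<le> (\<integral>y. g y \<partial>\<nu>) - (\<integral>x. dual_f g x \<partial>\<mu>)"
      by (rule martingale_duality[OF \<mu>' \<nu>' co(1,2) convC])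
    have gJ: "(L + 1 + L)-lipschitz_on {\<alpha>..\<beta>} g" by (rule lipschitz_on_subset[OF g]) simp
    have ul: "L2-lipschitz_on UNIV (\<lambda>y. u (cl y))"
      using ucl L12 by (intro lipschitz_onI) (auto simp: dist_real_def)
    note lint = integrable_lipschitz_on_interval[OF \<nu>']
    show ?thesis
    proof (rule goal[of "L + 1 + L" "dual_f g" "L + 1 + L + L2" "\<lambda>y. g y - u (cl y)" "dual_h g" "L + 1"])
      show "(L + 1 + L)-lipschitz_on UNIV (dual_f g)" by (rule dual_f_lipschitz[OF gJ])
      show "(L + 1 + L + L2)-lipschitz_on UNIV (\<lambda>y. g y - u (cl y))"
        by (rule lipschitz_on_diff[OF g ul])
      show "dual_h g \<in> borel_measurable borel" by (rule dual_h_measurable[OF gJ])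
      show "\<bar>dual_h g x\<bar> \<le> L + 1" for x using dual_h_least(1)[OF gJ, of x] by auto
      show "g y - u (cl y) - dual_f g x - dual_h g x * (y - x) \<le> c x y"
        if "x \<in> {\<alpha>..\<beta>}" "y \<in> {\<alpha>..\<beta>}" for x y
      proof -
        have "g y - dual_h g x * (y - x) - C x y \<le> dual_f g x"
          using dual_h_least(2)[OF gJ, of x] that by (auto simp: dual_slack_def)
        then show ?thesis using that by (simp add: C_def cl(3))
      qed
      fix P assume min: "minimizer \<mu> \<nu> c P"
      then have P: "P \<in> mart_couplings \<mu> \<nu>" by (simp add: minimizer_def)
      \<comment> \<open>\<open>Q\<close> costs no more than the dual value, hence neither does any
        minimizer. The shift by \<open>u\<close> contributes the same number on both sides, since
        \<nu> is the second marginal of \<open>Q\<close>.\<close>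
      have "expect_c P c \<le> expect_c Q c"
        using min Q unfolding minimizer_def primal_def by (auto intro: INF_lower)
      then have le: "(\<integral>z. c (fst z) (snd z) \<partial>P) \<le> (\<integral>z. c (fst z) (snd z) \<partial>Q)"
        by (simp add: expect_c_eq_integral fin P Q)
      have QQ: "prob_space Q" "sets Q = sets borel" and d: "distr Q borel snd = \<nu>"
        using Q by (auto simp: mart_couplings_def)
      have ms: "snd \<in> measurable Q borel" using QQ(2) by (auto simp: borel_measurable_fst_snd cong: measurable_cong_sets)
      have um: "(\<lambda>y. u (cl y)) \<in> borel_measurable borel"
        using ul by (intro borel_measurable_continuous_onI lipschitz_on_continuous_on)
      have iu: "integrable Q (\<lambda>z. u (cl (snd z)))"
        using lint[OF ul] unfolding d[symmetric] by (subst (asm) integrable_distr_eq[OF ms um])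
      have eu: "(\<integral>z. u (cl (snd z)) \<partial>Q) = (\<integral>y. u (cl y) \<partial>\<nu>)"
        unfolding d[symmetric] by (rule integral_distr[OF ms um, symmetric])
      have Cm: "(\<lambda>z. C (fst z) (snd z)) \<in> borel_measurable Q"
        using borel_measurable_continuous_onI[OF continuous_C] QQ(2) by (simp cong: measurable_cong_sets)
      have "(\<integral>z. C (fst z) (snd z) \<partial>Q) = (\<integral>z. c (fst z) (snd z) + u (cl (snd z)) \<partial>Q)"
      proof (rule integral_cong_AE[OF Cm])
        show "AE z in Q. C (fst z) (snd z) = c (fst z) (snd z) + u (cl (snd z))"
          using mart_couplings_AE[OF Q \<mu>'(3) \<nu>'(3)] by eventually_elim (simp add: C_def cl(3) mem_Times_iff)
      qed (use fin[OF Q] iu in auto)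
      also have "\<dots> = (\<integral>z. c (fst z) (snd z) \<partial>Q) + (\<integral>y. u (cl y) \<partial>\<nu>)"
        using fin[OF Q] iu eu by simp
      finally show "(\<integral>z. c (fst z) (snd z) \<partial>P) \<le> (\<integral>y. g y - u (cl y) \<partial>\<nu>) - (\<integral>x. dual_f g x \<partial>\<mu>)"
        using le val lint[OF g] lint[OF ul] by simp
    qed
  qed
qed

end
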